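(* Let $p>1$ and $q\ge1$. A function $f$ belongs to the Sobolev--Lorentz space $W^1L^{p,q}(\mathbb{R}^n)$ if and only if $f\in L^{p,q}(\mathbb{R}^n)$ and there exists a non-negative function $g\in L^{p,q}(\mathbb{R}^n)$ such that the inequality $$|f(x)-f(y)|\le|x-y|\,(g(x)+g(y))$$ holds for a.e. $x,y\in\mathbb{R}^n$, i.e. for all $x,y\in\mathbb{R}^n\setminus S$ with some set $S$ of Lebesgue measure zero.
   Context: $L^{p,q}(\mathbb{R}^n)$ is the Lorentz space of measurable functions $f$ on $\mathbb{R}^n$ with $\left(\int_0^\infty (t^{1/p}f^*(t))^q\,\frac{dt}{t}\right)^{1/q}<\infty$ (with $\sup_{t>0}t^{1/p}f^*(t)<\infty$ if $q=\infty$), where $f^*$ is the non-increasing rearrangement of $f$. $W^1L^{p,q}(\mathbb{R}^n)$ is the space of functions $f\in L^{p,q}(\mathbb{R}^n)$ having a weak gradient $\nabla f$ with $|\nabla f|\in L^{p,q}(\mathbb{R}^n)$. *)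

theory Defs
  imports "HOL-Analysis.Analysis"
begin

section \<open>Lorentz spaces\<close>

(* Powers of extended nonnegative reals; used for positive real exponents a only. *)
definition ennpowr :: "ennreal \<Rightarrow> real \<Rightarrow> ennreal" where
  "ennpowr x a = (if x = \<infinity> then \<infinity> else ennreal (enn2real x powr a))"

(* The value is \<infinity> when no finite s satisfies the condition. *)
definition rearrangement :: "(real ^ 'n \<Rightarrow> real) \<Rightarrow> real \<Rightarrow> ennreal" where
  "rearrangement f t =
     Inf {ennreal s | s. 0 \<le> s \<and> emeasure lebesgue {x. s < \<bar>f x\<bar>} \<le> ennreal t}"

definition lorentz_norm :: "real \<Rightarrow> ennreal \<Rightarrow> (real ^ 'n \<Rightarrow> real) \<Rightarrow> ennreal" where
  "lorentz_norm p q f =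
     (if q = \<infinity> then SUP t\<in>{0<..}. ennreal (t powr (1 / p)) * rearrangement f t
      else ennpowr
        (\<integral>\<^sup>+ t\<in>{0<..}. ennpowr (ennreal (t powr (1 / p)) * rearrangement f t) (enn2real q)
                          / ennreal t \<partial>lborel)
        (1 / enn2real q))"

definition lorentz_space :: "real \<Rightarrow> ennreal \<Rightarrow> (real ^ 'n \<Rightarrow> real) set" where
  "lorentz_space p q = {f \<in> borel_measurable lebesgue. lorentz_norm p q f < \<infinity>}"

section \<open>Weak gradients and Sobolev--Lorentz spaces\<close>

definition partial_deriv :: "'n \<Rightarrow> (real ^ 'n \<Rightarrow> real) \<Rightarrow> real ^ 'n \<Rightarrow> real" where
  "partial_deriv i \<phi> x = frechet_derivative \<phi> (at x) (axis i 1)"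

primrec C_k :: "nat \<Rightarrow> (real ^ 'n \<Rightarrow> real) \<Rightarrow> bool" where
  "C_k 0 \<phi> \<longleftrightarrow> continuous_on UNIV \<phi>"
| "C_k (Suc k) \<phi> \<longleftrightarrow> \<phi> differentiable_on UNIV \<and> (\<forall>i. C_k k (partial_deriv i \<phi>))"

definition test_function :: "(real ^ 'n \<Rightarrow> real) \<Rightarrow> bool" where
  "test_function \<phi> \<longleftrightarrow> (\<forall>k. C_k k \<phi>) \<and> compact (closure {x. \<phi> x \<noteq> 0})"

definition locally_integrable :: "(real ^ 'n \<Rightarrow> 'b::euclidean_space) \<Rightarrow> bool" where
  "locally_integrable f \<longleftrightarrow> (\<forall>K. compact K \<longrightarrow> set_integrable lebesgue K f)"

definition has_weak_gradient ::
    "(real ^ 'n \<Rightarrow> real) \<Rightarrow> (real ^ 'n \<Rightarrow> real ^ 'n) \<Rightarrow> bool" where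
  "has_weak_gradient f v \<longleftrightarrow>
     locally_integrable f \<and> locally_integrable v \<and>
     (\<forall>\<phi> i. test_function \<phi> \<longrightarrow>
        (LINT x|lebesgue. f x * partial_deriv i \<phi> x) = - (LINT x|lebesgue. v x $ i * \<phi> x))"

definition sobolev_lorentz_space :: "real \<Rightarrow> ennreal \<Rightarrow> (real ^ 'n \<Rightarrow> real) set" where
  "sobolev_lorentz_space p q =
     {f \<in> lorentz_space p q.
        \<exists>v. has_weak_gradient f v \<and> (\<lambda>x. norm (v x)) \<in> lorentz_space p q}"

end

theory Submission
  imports Defs
begin

text \<open>
  Let \<open>M\<close> be the uncentred Hardy--Littlewood maximal operator over balls.

  \<^bold>\<open>From a weak gradient to the pointwise inequality.\<close> Let \<open>v\<close> be a weak gradient of \<open>f\<close>. The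
  mollification of \<open>f\<close> at scale \<open>\<epsilon>\<close> has as gradient the mollification of \<open>v\<close>, which a constant times
  \<open>M\<bar>v\<bar>\<close> dominates, uniformly in \<open>\<epsilon>\<close>. Integrating along a segment and letting \<open>\<epsilon>\<close> tend to \<open>0\<close> at
  Lebesgue points of \<open>f\<close> yields, for almost all \<open>x\<close> and \<open>z\<close>,
  \<open>\<bar>f z - f x\<bar> \<le> c * \<bar>z - x\<bar> * (\<integral>t\<in>{0..1}. M\<bar>v\<bar> (x + t * (z - x)))\<close>. The average of the right-hand
  side over all \<open>z\<close> in a ball through \<open>x\<close> is, for each \<open>t\<close>, an average of \<open>M\<bar>v\<bar>\<close> over a smaller ball
  through \<open>x\<close>, hence at most \<open>M(M\<bar>v\<bar>) x\<close> (\<open>nn_integral_segment_average\<close>). Averaging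
  \<open>\<bar>f x - f y\<bar> \<le> \<bar>f x - f z\<bar> + \<bar>f z - f y\<bar>\<close> over the ball with centre \<open>x\<close> and radius \<open>2 * \<bar>x - y\<bar>\<close> shows that a
  multiple of \<open>M(M\<bar>v\<bar>)\<close> can serve as \<open>g\<close>. Iterating \<open>M\<close> costs nothing, because \<open>M\<close> preserves
  \<open>L\<^sup>p\<^sup>,\<^sup>q\<close> (\<open>lorentz_space_maximal_fun\<close>).

  \<^bold>\<open>Boundedness of \<open>M\<close>.\<close> Cutting \<open>f\<close> at the height \<open>f\<^sup>*(t)\<close> and applying the weak type (1,1) inequality
  to the excess gives \<open>(M f)\<^sup>*(t) \<le> C * (\<Sum>k. 2\<^sup>-\<^sup>k * f\<^sup>*(2\<^sup>-\<^sup>k\<^sup>-\<^sup>1 * t))\<close>, a dyadic form of the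
  classical bound by the mean of \<open>f\<^sup>*\<close> over \<open>(0,t)\<close>. A function whose rearrangement is dominated in this way
  lies in \<open>L\<^sup>p\<^sup>,\<^sup>q\<close> along with \<open>f\<close> (\<open>lorentz_space_rearrangement_bound\<close>): replacing \<open>f\<^sup>*(t)\<close> by
  \<open>f\<^sup>*(2\<^sup>-\<^sup>k t)\<close> multiplies the Lorentz norm by \<open>2\<^sup>k\<^sup>/\<^sup>p\<close>, and for \<open>p > 1\<close> the factor \<open>2\<^sup>-\<^sup>k\<close> outweighs this power,
  so that the norms of the terms form a geometric series.

  \<^bold>\<open>From the pointwise inequality to a weak gradient.\<close> Moving the difference quotient from the test
  function to \<open>f\<close> turns the pointwise inequality into
  \<open>\<bar>\<integral> f * \<partial>\<^sub>i \<phi>\<bar> \<le> 2 * (\<integral> g * \<bar>\<phi>\<bar>)\<close> (\<open>distributional_derivative_bound\<close>). The distributional derivative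
  is thus a functional bounded in \<open>L\<^sup>1(g dx)\<close>, whatever \<open>q\<close> is. After passing to a finite measure by means of an
  integrable weight, minimising a quadratic functional represents it by a function \<open>u\<close>
  (\<open>riesz_representation_bounded_functions\<close>), and testing with bumps that shrink to a point shows
  \<open>\<bar>u\<bar> \<le> 2 * g\<close> almost everywhere.
\<close>

section \<open>Powers of extended nonnegative reals\<close>

lemma borel_measurable_ennpowr [measurable]:
  "(\<lambda>x. ennpowr x a) \<in> borel_measurable borel"
  unfolding ennpowr_def by measurable

lemma ennpowr_top [simp]: "ennpowr top a = top" "ennpowr \<infinity> a = top"
  by (auto simp: ennpowr_def)

lemma ennpowr_ennreal: "0 \<le> x \<Longrightarrow> ennpowr (ennreal x) a = ennreal (x powr a)"
  by (simp add: ennpowr_def)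

lemma ennpowr_less_top_iff: "ennpowr x a < top \<longleftrightarrow> x < top"
  by (auto simp: ennpowr_def less_top)

lemma ennpowr_mono: "0 \<le> a \<Longrightarrow> x \<le> y \<Longrightarrow> ennpowr x a \<le> ennpowr y a"
  by (cases x; cases y) (auto simp: ennpowr_ennreal top_unique intro!: ennreal_leI powr_mono2)

lemma ennpowr_mult:
  assumes "0 < a" "0 \<le> c"
  shows "ennpowr (ennreal c * x) a = ennreal (c powr a) * ennpowr x a"
proof (cases x)
  case (real r)
  then show ?thesis using assms
    by (simp add: ennpowr_ennreal powr_mult flip: ennreal_mult)
next
  case top
  then show ?thesis using assms
    by (cases "c = 0") (auto simp: ennreal_mult_top ennpowr_ennreal[of 0, simplified])
qed

lemma ennpowr_inverse: "0 < a \<Longrightarrow> ennpowr (ennpowr x (1/a)) a = x"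
  by (cases x) (auto simp: ennpowr_ennreal powr_powr)

lemma ennreal_le_suminf:
  fixes Y :: "nat \<Rightarrow> ennreal"
  shows "Y k \<le> (\<Sum>k. Y k)"
  using sum_le_suminf[of Y "{k}"] by (simp add: summableI)

lemma ennreal_suminf_geometric:
  assumes "0 < \<sigma>" "\<sigma> < 1"
  shows "(\<Sum>k. ennreal (\<sigma> ^ k)) = ennreal (1 / (1 - \<sigma>))"
  using assms by (subst suminf_ennreal2) (auto simp: suminf_geometric summable_geometric)

text \<open>
  Plays the part of Jensen's inequality for geometric weights. Every \<open>Y k\<close> is at most the \<open>a\<close>-th root of
  \<open>\<Sum>k. (Y k)\<^sup>a\<close>, and a geometric series sums this uniform bound.
\<close>

lemma ennpowr_geometric_suminf_le:
  fixes Y :: "nat \<Rightarrow> ennreal"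
  assumes "0 < a" "0 < \<sigma>" "\<sigma> < 1"
  shows "ennpowr (\<Sum>k. ennreal (\<sigma> ^ k) * Y k) a
           \<le> ennreal ((1 / (1 - \<sigma>)) powr a) * (\<Sum>k. ennpowr (Y k) a)"
proof -
  define T where "T = (\<Sum>k. ennpowr (Y k) a)"
  have "Y k \<le> ennpowr T (1 / a)" for k
  proof -
    have "ennpowr (Y k) a \<le> T" unfolding T_def
      by (rule ennreal_le_suminf)
    from ennpowr_mono[OF _ this, of "1/a"] show ?thesis
      using assms ennpowr_inverse[of "1/a" "Y k"] by simp
  qed
  then have "(\<Sum>k. ennreal (\<sigma> ^ k) * Y k) \<le> (\<Sum>k. ennreal (\<sigma> ^ k) * ennpowr T (1 / a))"
    by (intro suminf_le mult_left_mono) (auto simp: summableI)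
  also have "\<dots> = ennreal (1 / (1 - \<sigma>)) * ennpowr T (1 / a)"
    using assms by (simp only: ennreal_suminf_cmult[symmetric] mult.commute ennreal_suminf_multc ennreal_suminf_geometric)
  finally have "ennpowr (\<Sum>k. ennreal (\<sigma> ^ k) * Y k) a
      \<le> ennpowr (ennreal (1 / (1 - \<sigma>)) * ennpowr T (1 / a)) a"
    using assms by (intro ennpowr_mono) auto
  also have "\<dots> = ennreal ((1 / (1 - \<sigma>)) powr a) * T"
    using assms by (simp add: ennpowr_mult ennpowr_inverse)
  finally show ?thesis unfolding T_def .
qed

section \<open>Rearrangements and Lorentz spaces\<close>

lemma rearrangement_antimono:
  "s \<le> t \<Longrightarrow> rearrangement f t \<le> rearrangement f s"
  unfolding rearrangement_def by (rule Inf_superset_mono) (blast intro: order_trans ennreal_leI)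

lemma rearrangement_le:
  "0 \<le> s \<Longrightarrow> emeasure lebesgue {x. s < \<bar>f x\<bar>} \<le> ennreal t \<Longrightarrow> rearrangement f t \<le> ennreal s"
  unfolding rearrangement_def by (rule Inf_lower) auto

text \<open>
  Since \<open>f\<^sup>*\<close> decreases, this sum is comparable to the mean of \<open>f\<^sup>*\<close> over \<open>(0,t)\<close>.
\<close>

abbreviation dyadic_mean :: "(real ^ 'n \<Rightarrow> real) \<Rightarrow> real \<Rightarrow> ennreal" where
  "dyadic_mean f t \<equiv> (\<Sum>k. ennreal ((1/2) ^ k) * rearrangement f ((1/2) ^ (k+1) * t))"

lemma measurable_antimono_ennreal:
  fixes F :: "real \<Rightarrow> ennreal"
  assumes "antimono F"
  shows "F \<in> borel_measurable borel"
proof (rule borel_measurableI_greater)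
  fix y
  have "is_interval {x. y < F x}"
    unfolding is_interval_1 using assms by (auto simp: antimono_def intro: less_le_trans)
  then show "{x \<in> space borel. y < F x} \<in> sets borel"
    by (simp add: is_interval_convex_1 real_interval_borel_measurable)
qed

lemma borel_measurable_rearrangement [measurable]:
  "rearrangement f \<in> borel_measurable borel"
  by (rule measurable_antimono_ennreal) (auto simp: antimono_def intro: rearrangement_antimono)

text \<open>
  The infimum that defines \<open>f\<^sup>*(t)\<close> is attained, by continuity of the measure along the increasing
  sets \<open>{\<bar>f\<bar> > f\<^sup>*(t) + 1/(k+1)}\<close>.
\<close>

lemma emeasure_rearrangement_less:
  assumes [measurable]: "f \<in> borel_measurable lebesgue"
  shows "emeasure lebesgue {x. rearrangement f t < ennreal \<bar>f x\<bar>} \<le> ennreal t"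
proof (cases "rearrangement f t = top")
  case True
  then show ?thesis by simp
next
  case False
  define r where "r = enn2real (rearrangement f t)"
  have r: "rearrangement f t = ennreal r" "0 \<le> r"
    using False by (auto simp: r_def less_top)
  define A where "A k = {x. r + 1 / real (Suc k) < \<bar>f x\<bar>}" for k
  have A[measurable]: "A k \<in> sets lebesgue" for k
  proof -
    have "{x \<in> space lebesgue. r + 1 / real (Suc k) < \<bar>f x\<bar>} \<in> sets lebesgue" by measurable
    then show ?thesis by (simp add: A_def)
  qed
  have "{x. rearrangement f t < ennreal \<bar>f x\<bar>} = (\<Union>k. A k)"
  proof (intro equalityI subsetI)
    fix x assume "x \<in> {x. rearrangement f t < ennreal \<bar>f x\<bar>}"
    then have "0 < \<bar>f x\<bar> - r" using r by (auto simp: ennreal_less_iff)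
    then obtain k where "1 / real (Suc k) < \<bar>f x\<bar> - r"
      using reals_Archimedean[of "\<bar>f x\<bar> - r"] by (auto simp: inverse_eq_divide)
    then show "x \<in> (\<Union>k. A k)" by (auto simp: A_def intro!: exI[of _ k])
  next
    fix x assume "x \<in> (\<Union>k. A k)"
    then obtain k where "r + 1 / real (Suc k) < \<bar>f x\<bar>" by (auto simp: A_def)
    moreover have "0 < 1 / real (Suc k)" by simp
    ultimately have "r < \<bar>f x\<bar>" by linarith
    then show "x \<in> {x. rearrangement f t < ennreal \<bar>f x\<bar>}"
      using r by (auto simp: ennreal_less_iff)
  qed
  also have "emeasure lebesgue \<dots> = (SUP k. emeasure lebesgue (A k))"
  proof (rule SUP_emeasure_incseq[symmetric])
    show "incseq A"
    proof (rule incseq_SucI)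
      fix k show "A k \<subseteq> A (Suc k)"
      proof
        fix x assume "x \<in> A k"
        moreover have "1 / real (Suc (Suc k)) \<le> 1 / real (Suc k)" by (simp add: frac_le)
        ultimately show "x \<in> A (Suc k)" unfolding A_def by simp
      qed
    qed
  qed (use A in auto)
  also have "\<dots> \<le> ennreal t"
  proof (rule SUP_least)
    fix k
    have "rearrangement f t < ennreal (r + 1 / real (Suc k))"
      using r by (simp add: ennreal_less_iff)
    then obtain s where s: "0 \<le> s" "emeasure lebesgue {x. s < \<bar>f x\<bar>} \<le> ennreal t"
        "ennreal s < ennreal (r + 1 / real (Suc k))"
      unfolding rearrangement_def Inf_less_iff by blast
    have "{x \<in> space lebesgue. s < \<bar>f x\<bar>} \<in> sets lebesgue" by measurable
    then have "emeasure lebesgue (A k) \<le> emeasure lebesgue {x. s < \<bar>f x\<bar>}"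
      using s(1,3) by (intro emeasure_mono) (auto simp: A_def ennreal_less_iff)
    then show "emeasure lebesgue (A k) \<le> ennreal t" using s(2) by simp
  qed
  finally show ?thesis .
qed

text \<open>
  The measure \<open>dt/t\<close> on the half-line is invariant under dilations.
\<close>

lemma nn_integral_dilation:
  fixes G :: "real \<Rightarrow> ennreal"
  assumes [measurable]: "G \<in> borel_measurable borel" and "0 < c"
  shows "(\<integral>\<^sup>+ t\<in>{0<..}. G (c * t) / ennreal t \<partial>lborel) = (\<integral>\<^sup>+ t\<in>{0<..}. G t / ennreal t \<partial>lborel)"
proof -
  have "(\<integral>\<^sup>+ t\<in>{0<..}. G t / ennreal t \<partial>lborel)
      = ennreal \<bar>c\<bar> * (\<integral>\<^sup>+ t. G (0 + c * t) / ennreal (0 + c * t) * indicator {0<..} (0 + c * t) \<partial>lborel)"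
    using assms by (intro nn_integral_real_affine) auto
  also have "\<dots> = (\<integral>\<^sup>+ t. ennreal \<bar>c\<bar> * (G (0 + c * t) / ennreal (0 + c * t) * indicator {0<..} (0 + c * t)) \<partial>lborel)"
    by (intro nn_integral_cmult[symmetric]) auto
  also have "\<dots> = (\<integral>\<^sup>+ t\<in>{0<..}. G (c * t) / ennreal t \<partial>lborel)"
  proof (rule nn_integral_cong)
    fix t :: real
    show "ennreal \<bar>c\<bar> * (G (0 + c * t) / ennreal (0 + c * t) * indicator {0<..} (0 + c * t))
        = G (c * t) / ennreal t * indicator {0<..} t"
    proof (cases "0 < t")
      case True
      have "ennreal \<bar>c\<bar> * ennreal (inverse (c * t)) = ennreal (inverse t)"
        using True assms(2) by (subst ennreal_mult[symmetric]) auto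
      then have "ennreal \<bar>c\<bar> * (G (c * t) * ennreal (inverse (c * t))) = G (c * t) * ennreal (inverse t)"
        by (metis mult.left_commute)
      then show ?thesis using True assms(2)
        by (simp add: divide_ennreal_def inverse_ennreal del: inverse_mult_distrib)
    next
      case False
      then show ?thesis using assms(2) by (auto simp: indicator_def zero_less_mult_iff)
    qed
  qed
  finally show ?thesis ..
qed

text \<open>
  Splits the factor \<open>2\<^sup>-\<^sup>k\<close> into the weight \<open>\<tau>\<^sup>1\<^sup>/\<^sup>p\<close> at \<open>\<tau> = 2\<^sup>-\<^sup>k\<^sup>-\<^sup>1 * t\<close>, which the Lorentz norm absorbs,
  and a geometric factor, whose ratio is below \<open>1\<close> for \<open>p > 1\<close>.
\<close>

lemma half_power_eq_powr:
  assumes "0 < t"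
  shows "(1/2::real) ^ k = (2 / t) powr (1/p) * (2 powr (1/p - 1)) ^ k * ((1/2) ^ (k+1) * t) powr (1/p)"
proof -
  have half: "(1/2::real) ^ m = 2 powr (- real m)" for m
    by (simp add: powr_minus powr_realpow power_one_over inverse_eq_divide)
  have 1: "(2 powr (1/p - 1)) ^ k = 2 powr ((1/p - 1) * real k)"
    by (simp add: powr_powr flip: powr_realpow)
  have 2: "((1/2) ^ (k+1) * t) powr (1/p) = 2 powr (- real (k+1) * (1/p)) * t powr (1/p)"
    using assms by (simp only: half powr_mult powr_powr)
  have 3: "(2 / t) powr (1/p) * t powr (1/p) = 2 powr (1/p)"
    using assms by (simp add: powr_divide)
  have 4: "2 powr (1/p) * (2 powr ((1/p - 1) * real k) * 2 powr (- real (k+1) * (1/p))) = 2 powr (- real k)"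
    unfolding powr_add[symmetric] by (rule arg_cong[of _ _ "\<lambda>x. 2 powr x"]) (simp add: algebra_simps)
  have "(2 / t) powr (1/p) * (2 powr (1/p - 1)) ^ k * ((1/2) ^ (k+1) * t) powr (1/p)
    = ((2 / t) powr (1/p) * t powr (1/p)) * (2 powr ((1/p - 1) * real k) * 2 powr (- real (k+1) * (1/p)))"
    unfolding 1 2 by (simp only: mult_ac)
  then show ?thesis unfolding 3 4 half by simp
qed

lemma two_powr_ratio_bounds: "(1::real) < p \<Longrightarrow> 0 < 2 powr (1/p - 1) \<and> 2 powr (1/p - 1) < (1::real)"
  by (simp add: powr_less_one)

lemma lorentz_norm_finite_iff:
  assumes "q \<noteq> \<infinity>"
  shows "lorentz_norm p q f < \<infinity> \<longleftrightarrow>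
    (\<integral>\<^sup>+ t\<in>{0<..}. ennpowr (ennreal (t powr (1 / p)) * rearrangement f t) (enn2real q) / ennreal t \<partial>lborel) < \<infinity>"
  using assms by (simp add: lorentz_norm_def ennpowr_less_top_iff)

lemma enn2real_ge_one: "1 \<le> q \<Longrightarrow> q \<noteq> \<infinity> \<Longrightarrow> 1 \<le> enn2real q"
  by (cases q) auto

text \<open>
  A dyadic form of Hardy's inequality. All comparisons between Lorentz functions below are instances:
  domination almost everywhere keeps only the term \<open>k = 0\<close>, and the maximal function takes the whole
  series.
\<close>

theorem lorentz_space_rearrangement_bound:
  fixes f h :: "real ^ 'n \<Rightarrow> real"
  assumes p: "1 < p" and q: "1 \<le> q" and f: "f \<in> lorentz_space p q"
    and h: "h \<in> borel_measurable lebesgue" and C: "0 \<le> C"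
    and le: "\<And>t. 0 < t \<Longrightarrow> rearrangement h t
       \<le> ennreal C * dyadic_mean f t"
  shows "h \<in> lorentz_space p q"
proof -
  define \<rho> where "\<rho> = (2::real) powr (1/p - 1)"
  have \<rho>: "0 < \<rho>" "\<rho> < 1" using two_powr_ratio_bounds[OF p] by (auto simp: \<rho>_def)
  define Y where "Y t = ennreal (t powr (1/p)) * rearrangement f t" for t
  define D where "D = C * 2 powr (1/p)"
  have D: "0 \<le> D" using C by (simp add: D_def)
  have [measurable]: "Y \<in> borel_measurable borel" unfolding Y_def by measurable
  have key: "ennreal (t powr (1/p)) * rearrangement h t
      \<le> ennreal D * (\<Sum>k. ennreal (\<rho> ^ k) * Y ((1/2) ^ (k+1) * t))" if t: "0 < t" for t
  proof -
    have "ennreal (t powr (1/p)) * (ennreal C * (ennreal ((1/2) ^ k) * rearrangement f ((1/2) ^ (k+1) * t)))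
        = ennreal D * (ennreal (\<rho> ^ k) * Y ((1/2) ^ (k+1) * t))" for k
    proof -
      have tt: "t powr (1/p) * (2/t) powr (1/p) = 2 powr (1/p)"
        using t by (simp add: powr_divide)
      have "t powr (1/p) * (C * (1/2) ^ k)
          = (t powr (1/p) * (2/t) powr (1/p)) * C * (\<rho> ^ k * ((1/2) ^ (k+1) * t) powr (1/p))"
        unfolding half_power_eq_powr[OF t, of k p] \<rho>_def[symmetric] by (simp only: mult_ac)
      also have "\<dots> = D * (\<rho> ^ k * ((1/2) ^ (k+1) * t) powr (1/p))"
        unfolding tt D_def by (simp only: mult_ac)
      finally have "ennreal (t powr (1/p)) * (ennreal C * ennreal ((1/2) ^ k))
          = ennreal D * (ennreal (\<rho> ^ k) * ennreal (((1/2) ^ (k+1) * t) powr (1/p)))"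
        using \<rho> C D by (simp flip: ennreal_mult)
      then show ?thesis unfolding Y_def by (simp only: mult.assoc[symmetric])
    qed
    then have "ennreal (t powr (1/p)) * (ennreal C * dyadic_mean f t)
        = ennreal D * (\<Sum>k. ennreal (\<rho> ^ k) * Y ((1/2) ^ (k+1) * t))"
      by (simp flip: ennreal_suminf_cmult)
    then show ?thesis using mult_left_mono[OF le[OF t], of "ennreal (t powr (1/p))"] by simp
  qed
  have "lorentz_norm p q h < \<infinity>"
  proof (cases "q = \<infinity>")
    case True
    define N where "N = lorentz_norm p q f"
    have N: "N < top" using f by (simp add: lorentz_space_def N_def)
    have Y: "Y t \<le> N" if "0 < t" for t
      unfolding N_def lorentz_norm_def Y_def using True that by (auto intro: SUP_upper2)
    have "ennreal (t powr (1/p)) * rearrangement h t \<le> ennreal D * (ennreal (1 / (1 - \<rho>)) * N)" if "0 < t" for t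
    proof -
      have "(\<Sum>k. ennreal (\<rho> ^ k) * Y ((1/2) ^ (k+1) * t)) \<le> (\<Sum>k. ennreal (\<rho> ^ k) * N)"
        using that by (intro suminf_le mult_left_mono Y) (auto simp: summableI)
      also have "\<dots> = ennreal (1 / (1 - \<rho>)) * N"
        using \<rho> by (simp only: ennreal_suminf_multc ennreal_suminf_geometric)
      finally show ?thesis using key[OF that] by (meson mult_left_mono order_trans zero_le)
    qed
    then have "lorentz_norm p q h \<le> ennreal D * (ennreal (1 / (1 - \<rho>)) * N)"
      using True by (auto simp: lorentz_norm_def intro!: SUP_least)
    also have "\<dots> < top" using N by (auto simp: ennreal_mult_less_top)
    finally show ?thesis by simp
  next
    case False
    define r where "r = enn2real q"
    have r: "1 \<le> r" using enn2real_ge_one[OF q False] by (simp add: r_def)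
    define I where "I = (\<integral>\<^sup>+ t\<in>{0<..}. ennpowr (Y t) r / ennreal t \<partial>lborel)"
    have I: "I < top"
      using f lorentz_norm_finite_iff[OF False, of p f]
      by (simp add: lorentz_space_def I_def Y_def r_def)
    \<comment> \<open>Half of the geometric decay is spent on the summation over \<open>k\<close>, the other half on the summation of the norms.\<close>
    define \<sigma> where "\<sigma> = sqrt \<rho>"
    have \<sigma>: "0 < \<sigma>" "\<sigma> < 1" "\<rho> = \<sigma> * \<sigma>" using \<rho> by (auto simp: \<sigma>_def)
    define E where "E = (1 / (1 - \<sigma>)) powr r"
    have key2: "ennpowr (ennreal (t powr (1/p)) * rearrangement h t) r
        \<le> ennreal (D powr r) * (ennreal E * (\<Sum>k. ennreal ((\<sigma> ^ k) powr r) * ennpowr (Y ((1/2) ^ (k+1) * t)) r))"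
      if t: "0 < t" for t
    proof -
      have "ennpowr (ennreal (t powr (1/p)) * rearrangement h t) r
          \<le> ennpowr (ennreal D * (\<Sum>k. ennreal (\<rho> ^ k) * Y ((1/2) ^ (k+1) * t))) r"
        using r by (intro ennpowr_mono key t) auto
      also have "\<dots> = ennreal (D powr r) * ennpowr (\<Sum>k. ennreal (\<sigma> ^ k) * (ennreal (\<sigma> ^ k) * Y ((1/2) ^ (k+1) * t))) r"
        using r D \<sigma> by (simp add: ennpowr_mult power_mult_distrib ennreal_mult mult.assoc)
      also have "\<dots> \<le> ennreal (D powr r) * (ennreal E * (\<Sum>k. ennpowr (ennreal (\<sigma> ^ k) * Y ((1/2) ^ (k+1) * t)) r))"
        unfolding E_def using r \<sigma> by (intro mult_left_mono ennpowr_geometric_suminf_le) auto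
      also have "\<dots> = ennreal (D powr r) * (ennreal E * (\<Sum>k. ennreal ((\<sigma> ^ k) powr r) * ennpowr (Y ((1/2) ^ (k+1) * t)) r))"
        using r \<sigma> by (simp add: ennpowr_mult)
      finally show ?thesis .
    qed
    define S where "S = (\<Sum>k. ennreal ((\<sigma> ^ k) powr r))"
    have S: "S < top"
    proof -
      have "(\<sigma> ^ k) powr r = (\<sigma> powr r) ^ k" for k
        using \<sigma> by (simp add: powr_powr mult.commute flip: powr_realpow)
      then have "S = ennreal (1 / (1 - \<sigma> powr r))"
        unfolding S_def using \<sigma> r
        using powr_less_mono2[of r \<sigma> 1]
        by (simp only:) (rule ennreal_suminf_geometric, auto)
      then show ?thesis by simp
    qed
    have "(\<integral>\<^sup>+ t\<in>{0<..}. ennpowr (ennreal (t powr (1/p)) * rearrangement h t) r / ennreal t \<partial>lborel)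
        \<le> (\<integral>\<^sup>+ t. ennreal (D powr r) * (ennreal E * (\<Sum>k. ennreal ((\<sigma> ^ k) powr r) *
              (ennpowr (Y ((1/2) ^ (k+1) * t)) r / ennreal t * indicator {0<..} t))) \<partial>lborel)"
    proof (rule nn_integral_mono)
      fix t :: real
      show "ennpowr (ennreal (t powr (1/p)) * rearrangement h t) r / ennreal t * indicator {0<..} t
        \<le> ennreal (D powr r) * (ennreal E * (\<Sum>k. ennreal ((\<sigma> ^ k) powr r) *
              (ennpowr (Y ((1/2) ^ (k+1) * t)) r / ennreal t * indicator {0<..} t)))"
      proof (cases "0 < t")
        case True
        from divide_right_mono_ennreal[OF key2[OF True], of "ennreal t"] True show ?thesis
          by (simp add: divide_ennreal_def mult.assoc flip: ennreal_suminf_multc)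
      qed auto
    qed
    also have "\<dots> = ennreal (D powr r) * (ennreal E * (\<Sum>k. ennreal ((\<sigma> ^ k) powr r) *
              (\<integral>\<^sup>+ t\<in>{0<..}. ennpowr (Y ((1/2) ^ (k+1) * t)) r / ennreal t \<partial>lborel)))"
      by (simp add: nn_integral_cmult nn_integral_suminf)
    also have "\<dots> = ennreal (D powr r) * (ennreal E * (\<Sum>k. ennreal ((\<sigma> ^ k) powr r) * I))"
    proof -
      have "(\<integral>\<^sup>+ t\<in>{0<..}. ennpowr (Y ((1/2) ^ (k+1) * t)) r / ennreal t \<partial>lborel) = I" for k
        unfolding I_def by (rule nn_integral_dilation) auto
      then show ?thesis by (simp only:)
    qed
    also have "\<dots> = ennreal (D powr r) * (ennreal E * (S * I))"
      by (simp add: S_def)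
    also have "\<dots> < top" using S I by (auto simp: ennreal_mult_less_top)
    finally show ?thesis
      unfolding lorentz_norm_finite_iff[OF False] r_def[symmetric] by simp
  qed
  then show ?thesis using h by (simp add: lorentz_space_def)
qed

lemma lorentz_space_mono:
  fixes f h :: "real ^ 'n \<Rightarrow> real"
  assumes p: "1 < p" and q: "1 \<le> q" and f: "f \<in> lorentz_space p q"
    and h [measurable]: "h \<in> borel_measurable lebesgue" and C: "0 \<le> C"
    and le: "AE x in lebesgue. \<bar>h x\<bar> \<le> C * \<bar>f x\<bar>"
  shows "h \<in> lorentz_space p q"
proof (rule lorentz_space_rearrangement_bound[OF p q f h C])
  fix t :: real assume t: "0 < t"
  have [measurable]: "f \<in> borel_measurable lebesgue" using f by (simp add: lorentz_space_def)
  have "rearrangement h t \<le> ennreal C * rearrangement f ((1/2) ^ (0+1) * t)"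
  proof (cases "rearrangement f ((1/2) ^ (0+1) * t)")
    case (real s)
    have "{x \<in> space lebesgue. C * s < \<bar>h x\<bar>} \<in> sets lebesgue"
      "{x \<in> space lebesgue. ennreal s < ennreal \<bar>f x\<bar>} \<in> sets lebesgue" by measurable
    then have "emeasure lebesgue {x. C * s < \<bar>h x\<bar>} \<le> emeasure lebesgue {x. ennreal s < ennreal \<bar>f x\<bar>}"
      using le C by (intro emeasure_mono_AE)
        (auto elim!: eventually_mono simp: ennreal_less_iff real(1) not_less intro: mult_left_mono dest: order_trans[OF _ mult_left_mono])
    also have "\<dots> \<le> ennreal ((1/2) ^ (0+1) * t)"
      using emeasure_rearrangement_less[of f "(1/2) ^ (0+1) * t"] real by simp
    also have "\<dots> \<le> ennreal t" using t by (intro ennreal_leI) auto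
    finally show ?thesis using real C rearrangement_le[of "C * s" h t] by (simp add: ennreal_mult)
  next
    case top
    show ?thesis
    proof (cases "C = 0")
      case True
      have "emeasure lebesgue {x \<in> space lebesgue. 0 < \<bar>h x\<bar>} = 0"
        by (rule emeasure_eq_0_AE) (use le True in auto)
      then show ?thesis using rearrangement_le[of 0 h t] by simp
    qed (use top C in \<open>simp add: ennreal_mult_top\<close>)
  qed
  also have "\<dots> \<le> ennreal C * dyadic_mean f t"
    using ennreal_le_suminf[of "\<lambda>k. ennreal ((1/2) ^ k) * rearrangement f ((1/2) ^ (k+1) * t)" 0]
    by (intro mult_left_mono) auto
  finally show "rearrangement h t \<le> \<dots>" .
qed

text \<open>
  The embedding of \<open>L\<^sup>p\<^sup>,\<^sup>q\<close> into \<open>L\<^sup>p\<^sup>,\<^sup>\<infinity>\<close>: as \<open>f\<^sup>*\<close> decreases, its values on \<open>[t/2,t]\<close> alone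
  force the norm to be of size \<open>t\<^sup>1\<^sup>/\<^sup>p f\<^sup>*(t)\<close>. The weight at \<open>t/2\<close> instead of \<open>t\<close> is what the lower bound on
  \<open>[t/2,t]\<close> gives directly.
\<close>

lemma lorentz_space_weak_type:
  fixes f :: "real ^ 'n \<Rightarrow> real"
  assumes p: "1 < p" and q: "1 \<le> q" and f: "f \<in> lorentz_space p q"
  shows "\<exists>K. \<forall>t>0. ennreal ((t/2) powr (1/p)) * rearrangement f t \<le> ennreal K"
proof (cases "q = \<infinity>")
  case True
  define N where "N = lorentz_norm p q f"
  have N: "N < top" using f by (simp add: lorentz_space_def N_def)
  have "ennreal ((t/2) powr (1/p)) * rearrangement f t \<le> ennreal (enn2real N)" if "0 < t" for t
  proof -
    have "ennreal ((t/2) powr (1/p)) * rearrangement f t \<le> ennreal (t powr (1/p)) * rearrangement f t"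
      using that p by (intro mult_right_mono ennreal_leI powr_mono2) auto
    also have "\<dots> \<le> N" unfolding N_def lorentz_norm_def using True that by (auto intro: SUP_upper2)
    finally show ?thesis using N by simp
  qed
  then show ?thesis by blast
next
  case False
  define r where "r = enn2real q"
  have r: "1 \<le> r" using enn2real_ge_one[OF q False] by (simp add: r_def)
  define I where "I = (\<integral>\<^sup>+ t\<in>{0<..}. ennpowr (ennreal (t powr (1/p)) * rearrangement f t) r / ennreal t \<partial>lborel)"
  have I: "I < top"
    using f lorentz_norm_finite_iff[OF False, of p f]
    by (simp add: lorentz_space_def I_def r_def)
  have J: "ennpowr (2 * I) (1/r) < top" using I by (simp add: ennpowr_less_top_iff ennreal_mult_less_top)
  have "ennreal ((t/2) powr (1/p)) * rearrangement f t \<le> ennpowr (2 * I) (1/r)" if t: "0 < t" for t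
  proof -
    \<comment> \<open>A lower bound for the numerator of the integrand on \<open>[t/2,t]\<close>.\<close>
    define Z where "Z = ennpowr (ennreal ((t/2) powr (1/p)) * rearrangement f t) r"
    have "Z / ennreal t * ennreal (t / 2) = (\<integral>\<^sup>+u. Z / ennreal t * indicator {t/2..t} u \<partial>lborel)"
      using t by (simp add: nn_integral_cmult_indicator)
    also have "\<dots> \<le> I" unfolding I_def
    proof (rule nn_integral_mono)
      fix u :: real
      show "Z / ennreal t * indicator {t/2..t} u
         \<le> ennpowr (ennreal (u powr (1/p)) * rearrangement f u) r / ennreal u * indicator {0<..} u"
      proof (cases "u \<in> {t/2..t}")
        case True
        then have "Z \<le> ennpowr (ennreal (u powr (1/p)) * rearrangement f u) r"
          unfolding Z_def using t p r
          by (intro ennpowr_mono mult_mono ennreal_leI powr_mono2 rearrangement_antimono) auto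
        moreover have "inverse (ennreal t) \<le> inverse (ennreal u)"
          using True t by (simp add: inverse_ennreal ennreal_leI)
        ultimately show ?thesis using True t
          by (auto simp: divide_ennreal_def intro!: mult_mono)
      qed auto
    qed
    finally have *: "Z / ennreal t * ennreal (t / 2) \<le> I" .
    have "2 * (Z / ennreal t * ennreal (t / 2)) = Z"
    proof -
      have "2 * (Z / ennreal t * ennreal (t / 2)) = Z * (ennreal (inverse t) * (ennreal 2 * ennreal (t/2)))"
        using t by (simp add: divide_ennreal_def inverse_ennreal mult_ac)
      also have "ennreal 2 * ennreal (t/2) = ennreal t"
        using t by (subst ennreal_mult[symmetric]) auto
      also have "Z * (ennreal (inverse t) * ennreal t) = Z"
        using t by (subst ennreal_mult[symmetric]) auto
      finally show ?thesis .
    qed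
    then have "Z \<le> 2 * I" using mult_left_mono[OF *, of 2] by simp
    then have "ennpowr Z (1/r) \<le> ennpowr (2 * I) (1/r)" using r by (intro ennpowr_mono) auto
    then show ?thesis unfolding Z_def using r ennpowr_inverse[of "1/r"] by simp
  qed
  then show ?thesis using J by (intro exI[of _ "enn2real (ennpowr (2 * I) (1/r))"]) simp
qed

lemma lorentz_space_suminf_finite:
  fixes f :: "real ^ 'n \<Rightarrow> real"
  assumes p: "1 < p" and q: "1 \<le> q" and f: "f \<in> lorentz_space p q" and t: "0 < t"
  shows "dyadic_mean f t < top"
proof -
  define \<rho> where "\<rho> = (2::real) powr (1/p - 1)"
  have \<rho>: "0 < \<rho>" "\<rho> < 1" using two_powr_ratio_bounds[OF p] by (auto simp: \<rho>_def)
  obtain K where K: "\<And>t. 0 < t \<Longrightarrow> ennreal ((t/2) powr (1/p)) * rearrangement f t \<le> ennreal K"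
    using lorentz_space_weak_type[OF p q f] by blast
  define c where "c = (2 / (t/2)) powr (1/p)"
  have "ennreal ((1/2) ^ k) * rearrangement f ((1/2) ^ (k+1) * t) \<le> ennreal c * (ennreal (\<rho> ^ k) * ennreal K)" for k
  proof -
    have "(1/2::real) ^ k = c * \<rho> ^ k * ((1/2) ^ (k+1) * (t/2)) powr (1/p)"
      unfolding c_def \<rho>_def using t by (intro half_power_eq_powr) auto
    then have "ennreal ((1/2) ^ k) = ennreal c * (ennreal (\<rho> ^ k) * ennreal (((1/2) ^ (k+1) * t / 2) powr (1/p)))"
      using \<rho> by (simp add: c_def mult.assoc flip: ennreal_mult)
    then show ?thesis using K[of "(1/2) ^ (k+1) * t"] t
      by (auto simp: mult.assoc intro!: mult_left_mono)
  qed
  then have "dyadic_mean f t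
      \<le> (\<Sum>k. ennreal c * (ennreal (\<rho> ^ k) * ennreal K))"
    by (intro suminf_le) (auto simp: summableI)
  also have "\<dots> = ennreal c * (ennreal (1 / (1 - \<rho>)) * ennreal K)"
    using \<rho> by (simp only: ennreal_suminf_cmult ennreal_suminf_multc ennreal_suminf_geometric)
  also have "\<dots> < top" by (auto simp: ennreal_mult_less_top)
  finally show ?thesis .
qed

text \<open>
  The level set \<open>{\<bar>f\<bar> > f\<^sup>*(2\<^sup>-\<^sup>k t)}\<close> has measure at most \<open>2\<^sup>-\<^sup>k t\<close>, and between two consecutive levels
  \<open>\<bar>f\<bar>\<close> is at most \<open>f\<^sup>*(2\<^sup>-\<^sup>k\<^sup>-\<^sup>1 t)\<close>.
\<close>

lemma nn_integral_excess_le: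
  fixes f :: "real ^ 'n \<Rightarrow> real"
  assumes [measurable]: "f \<in> borel_measurable lebesgue" and t: "0 < t"
    and s: "rearrangement f t \<le> ennreal s" "0 \<le> s"
  shows "(\<integral>\<^sup>+x. ennreal (\<bar>f x\<bar> - s) \<partial>lebesgue)
     \<le> ennreal t * dyadic_mean f t"
proof -
  define B where "B k = {x. rearrangement f ((1/2) ^ k * t) < ennreal \<bar>f x\<bar>}" for k
  have [measurable]: "B k \<in> sets lebesgue" for k
  proof -
    have "{x\<in>space lebesgue. rearrangement f ((1/2) ^ k * t) < ennreal \<bar>f x\<bar>} \<in> sets lebesgue" by measurable
    then show ?thesis by (simp add: B_def)
  qed
  have B: "emeasure lebesgue (B k) \<le> ennreal ((1/2) ^ k * t)" for k
    unfolding B_def by (rule emeasure_rearrangement_less) measurable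
  have "emeasure lebesgue (\<Inter>k. B k) \<le> 0"
  proof (rule LIMSEQ_le_const)
    have "(\<lambda>k. (1/2::real) ^ k * t) \<longlonglongrightarrow> 0 * t"
      by (intro tendsto_intros LIMSEQ_realpow_zero) auto
    then show "(\<lambda>k. ennreal ((1/2) ^ k * t)) \<longlonglongrightarrow> 0"
      using tendsto_ennrealI by fastforce
    show "\<exists>N. \<forall>k\<ge>N. emeasure lebesgue (\<Inter>k. B k) \<le> ennreal ((1/2) ^ k * t)"
      by (intro exI allI impI order_trans[OF emeasure_mono B]) auto
  qed
  then have "(\<Inter>k. B k) \<in> null_sets lebesgue" by auto
  then have "AE x in lebesgue. x \<notin> (\<Inter>k. B k)" by (rule AE_not_in)
  then have "AE x in lebesgue. ennreal (\<bar>f x\<bar> - s)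
     \<le> (\<Sum>k. rearrangement f ((1/2) ^ (k+1) * t) * indicator (B k) x)"
  proof (rule AE_mp, intro AE_I2 impI)
    fix x assume "x \<notin> (\<Inter>k. B k)"
    then have ex: "\<exists>j. x \<notin> B j" by auto
    show "ennreal (\<bar>f x\<bar> - s) \<le> (\<Sum>k. rearrangement f ((1/2) ^ (k+1) * t) * indicator (B k) x)"
    proof (cases "\<bar>f x\<bar> \<le> s")
      case True
      then show ?thesis by (simp add: ennreal_neg)
    next
      case False
      then have B0: "x \<in> B 0" using s by (auto simp: B_def ennreal_less_iff intro: le_less_trans)
      \<comment> \<open>The last level that \<open>\<bar>f x\<bar>\<close> exceeds is \<open>j - 1\<close>; it exists for all \<open>x\<close> outside a null set.\<close>
      define j where "j = (LEAST j. x \<notin> B j)"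
      have j: "x \<notin> B j" unfolding j_def using ex by (rule LeastI_ex)
      then have "j \<noteq> 0" using B0 by (intro notI) simp
      then obtain k where k: "j = Suc k" using not0_implies_Suc by blast
      then have "x \<in> B k" using not_less_Least[of k "\<lambda>j. x \<notin> B j"] by (auto simp: j_def)
      moreover have "ennreal (\<bar>f x\<bar> - s) \<le> ennreal \<bar>f x\<bar>"
        using s by (intro ennreal_leI) auto
      moreover have "ennreal \<bar>f x\<bar> \<le> rearrangement f ((1/2) ^ (k+1) * t)"
        using j k by (simp add: B_def not_less)
      ultimately have "ennreal (\<bar>f x\<bar> - s) \<le> rearrangement f ((1/2) ^ (k+1) * t) * indicator (B k) x"
        by (simp only: indicator_simps mult_1_right)
      also have "\<dots> \<le> (\<Sum>k. rearrangement f ((1/2) ^ (k+1) * t) * indicator (B k) x)"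
        by (rule ennreal_le_suminf)
      finally show ?thesis .
    qed
  qed
  then have "(\<integral>\<^sup>+x. ennreal (\<bar>f x\<bar> - s) \<partial>lebesgue)
     \<le> (\<integral>\<^sup>+x. (\<Sum>k. rearrangement f ((1/2) ^ (k+1) * t) * indicator (B k) x) \<partial>lebesgue)"
    by (rule nn_integral_mono_AE)
  also have "\<dots> = (\<Sum>k. rearrangement f ((1/2) ^ (k+1) * t) * emeasure lebesgue (B k))"
    by (simp add: nn_integral_suminf nn_integral_cmult_indicator)
  also have "\<dots> \<le> (\<Sum>k. ennreal t * (ennreal ((1/2) ^ k) * rearrangement f ((1/2) ^ (k+1) * t)))"
  proof (intro suminf_le summableI)
    fix k
    have "rearrangement f ((1/2) ^ (k+1) * t) * emeasure lebesgue (B k)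
      \<le> rearrangement f ((1/2) ^ (k+1) * t) * (ennreal ((1/2) ^ k) * ennreal t)"
      using B[of k] t by (intro mult_left_mono) (auto simp: ennreal_mult)
    then show "rearrangement f ((1/2) ^ (k+1) * t) * emeasure lebesgue (B k)
      \<le> ennreal t * (ennreal ((1/2) ^ k) * rearrangement f ((1/2) ^ (k+1) * t))"
      by (simp add: mult_ac)
  qed
  finally show ?thesis by simp
qed

lemma rearrangement_le_suminf:
  assumes "0 < t"
  shows "rearrangement f t \<le> dyadic_mean f t"
proof -
  have "rearrangement f t \<le> rearrangement f ((1/2) ^ (0+1) * t)"
    using assms by (intro rearrangement_antimono) auto
  also have "\<dots> \<le> dyadic_mean f t"
    using ennreal_le_suminf[of "\<lambda>k. ennreal ((1/2) ^ k) * rearrangement f ((1/2) ^ (k+1) * t)" 0]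
    by simp
  finally show ?thesis .
qed

text \<open>
  A Lorentz function with \<open>p > 1\<close> is the sum of a bounded and an integrable function. It is
  therefore integrable on sets of finite measure and against bounded integrable weights.
\<close>

lemma lorentz_space_excess_finite:
  fixes f :: "real ^ 'n \<Rightarrow> real"
  assumes p: "1 < p" and q: "1 \<le> q" and f: "f \<in> lorentz_space p q"
  obtains s where "0 \<le> s" "(\<integral>\<^sup>+x. ennreal (\<bar>f x\<bar> - s) \<partial>lebesgue) < top"
proof -
  have S: "dyadic_mean f 1 < top"
    using lorentz_space_suminf_finite[OF p q f, of 1] by simp
  define s where "s = enn2real (rearrangement f 1)"
  have "rearrangement f 1 < top"
    using le_less_trans[OF rearrangement_le_suminf S] by simp
  then have "rearrangement f 1 \<le> ennreal s" by (simp add: s_def)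
  from nn_integral_excess_le[OF _ _ this] f S have "(\<integral>\<^sup>+x. ennreal (\<bar>f x\<bar> - s) \<partial>lebesgue) < top"
    by (auto simp: lorentz_space_def s_def intro: le_less_trans)
  then show ?thesis using that[of s] by (simp add: s_def)
qed

lemma lorentz_space_weighted_integrable:
  fixes f w :: "real ^ 'n \<Rightarrow> real"
  assumes p: "1 < p" and q: "1 \<le> q" and f: "f \<in> lorentz_space p q"
    and w: "integrable lebesgue w" and W: "\<And>x. \<bar>w x\<bar> \<le> W"
  shows "integrable lebesgue (\<lambda>x. f x * w x)"
proof -
  have [measurable]: "f \<in> borel_measurable lebesgue" "w \<in> borel_measurable lebesgue"
    using f w by (auto simp: lorentz_space_def)
  obtain s where s: "0 \<le> s" "(\<integral>\<^sup>+x. ennreal (\<bar>f x\<bar> - s) \<partial>lebesgue) < top"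
    using lorentz_space_excess_finite[OF p q f] .
  have "0 \<le> W" using W[of 0] by (meson abs_ge_zero order_trans)
  have "(\<integral>\<^sup>+x. ennreal (norm (f x * w x)) \<partial>lebesgue)
      \<le> (\<integral>\<^sup>+x. ennreal s * ennreal (norm (w x)) + ennreal W * ennreal (\<bar>f x\<bar> - s) \<partial>lebesgue)"
  proof (rule nn_integral_mono)
    fix x
    have "norm (f x * w x) \<le> s * norm (w x) + W * max 0 (\<bar>f x\<bar> - s)"
    proof (cases "\<bar>f x\<bar> \<le> s")
      case True
      then have "norm (f x * w x) \<le> s * norm (w x)"
        by (auto simp: abs_mult intro: mult_right_mono)
      then show ?thesis using True by simp
    next
      case False
      have "norm (f x * w x) = s * norm (w x) + norm (w x) * (\<bar>f x\<bar> - s)"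
        by (simp add: abs_mult algebra_simps)
      also have "\<dots> \<le> s * norm (w x) + W * max 0 (\<bar>f x\<bar> - s)"
        using False W[of x] by (intro add_left_mono mult_mono) auto
      finally show ?thesis .
    qed
    then have "ennreal (norm (f x * w x)) \<le> ennreal (s * norm (w x) + W * max 0 (\<bar>f x\<bar> - s))"
      by (rule ennreal_leI)
    also have "\<dots> = ennreal s * ennreal (norm (w x)) + ennreal W * ennreal (max 0 (\<bar>f x\<bar> - s))"
      using s \<open>0 \<le> W\<close> by (simp add: ennreal_plus ennreal_mult)
    also have "ennreal (max 0 (\<bar>f x\<bar> - s)) = ennreal (\<bar>f x\<bar> - s)"
      by (auto simp: max_def ennreal_neg)
    finally show "ennreal (norm (f x * w x)) \<le> ennreal s * ennreal (norm (w x)) + ennreal W * ennreal (\<bar>f x\<bar> - s)" .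
  qed
  also have "\<dots> = ennreal s * (\<integral>\<^sup>+x. ennreal (norm (w x)) \<partial>lebesgue) + ennreal W * (\<integral>\<^sup>+x. ennreal (\<bar>f x\<bar> - s) \<partial>lebesgue)"
    by (subst nn_integral_add) (auto simp: nn_integral_cmult)
  also have "\<dots> < top"
    using s w by (auto simp: ennreal_mult_less_top integrable_iff_bounded)
  finally show ?thesis by (simp add: integrable_iff_bounded)
qed

lemma lorentz_space_set_integrable:
  fixes f :: "real ^ 'n \<Rightarrow> real"
  assumes p: "1 < p" and q: "1 \<le> q" and f: "f \<in> lorentz_space p q" and A: "A \<in> lmeasurable"
  shows "set_integrable lebesgue A f"
proof -
  have "integrable lebesgue (\<lambda>x. f x * indicator A x)"
    using A by (intro lorentz_space_weighted_integrable[OF p q f, where W = 1] integrable_real_indicator)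
      (auto simp: fmeasurable_def split: split_indicator)
  then show ?thesis by (simp add: set_integrable_def mult.commute)
qed

section \<open>The Hardy--Littlewood maximal function\<close>

text \<open>
  The balls run over all balls that contain \<open>x\<close>, not only those centred at \<open>x\<close>; this makes the
  function lower semicontinuous, hence Borel measurable, for an arbitrary \<open>F\<close>.
\<close>

definition maximal_fun :: "('a::euclidean_space \<Rightarrow> ennreal) \<Rightarrow> 'a \<Rightarrow> ennreal" where
  "maximal_fun F x = Sup {(\<integral>\<^sup>+y\<in>ball c r. F y \<partial>lebesgue) / emeasure lborel (ball c r) | c r. x \<in> ball c r}"

lemma emeasure_ball_finite_pos:
  fixes c :: "'a::euclidean_space"
  assumes "0 < r"
  shows "0 < emeasure lborel (ball c r)" "emeasure lborel (ball c r) < top"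
proof -
  have "emeasure lborel (ball c r) = ennreal (unit_ball_vol (real DIM('a)) * r ^ DIM('a))"
    using assms by (simp add: emeasure_ball)
  then show "0 < emeasure lborel (ball c r)" "emeasure lborel (ball c r) < top"
    using assms by (auto simp: ennreal_zero_less_mult_iff)
qed

lemma average_mult_ball:
  fixes c :: "'a::euclidean_space" and a :: ennreal
  assumes "0 < r"
  shows "a / emeasure lborel (ball c r) * emeasure lborel (ball c r) = a"
  using emeasure_ball_finite_pos[OF assms, of c]
  by (subst ennreal_divide_times) (simp add: ennreal_times_divide[symmetric] ennreal_divide_self mult.commute)

lemma maximal_fun_ge:
  "x \<in> ball c r \<Longrightarrow> (\<integral>\<^sup>+y\<in>ball c r. F y \<partial>lebesgue) / emeasure lborel (ball c r) \<le> maximal_fun F x"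
  unfolding maximal_fun_def by (rule Sup_upper) auto

lemma nn_integral_ball_le_maximal_fun:
  fixes c :: "'a::euclidean_space"
  assumes "x \<in> ball c r"
  shows "(\<integral>\<^sup>+y\<in>ball c r. F y \<partial>lebesgue) \<le> maximal_fun F x * emeasure lborel (ball c r)"
proof -
  have r: "0 < r" using assms by (metis ball_eq_empty empty_iff not_less)
  show ?thesis
    using mult_right_mono[OF maximal_fun_ge[OF assms], of "emeasure lborel (ball c r)" F]
    by (simp add: average_mult_ball[OF r])
qed

lemma less_maximal_fun_iff:
  "a < maximal_fun F x \<longleftrightarrow>
    (\<exists>c r. x \<in> ball c r \<and> a < (\<integral>\<^sup>+y\<in>ball c r. F y \<partial>lebesgue) / emeasure lborel (ball c r))"
  unfolding maximal_fun_def less_Sup_iff by blast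

lemma open_less_maximal_fun:
  fixes F :: "'a::euclidean_space \<Rightarrow> ennreal"
  shows "open {x. a < maximal_fun F x}"
  unfolding open_subopen[of "{x. a < maximal_fun F x}"]
proof (intro ballI)
  fix x assume "x \<in> {x. a < maximal_fun F x}"
  then obtain c r where "x \<in> ball c r" "a < (\<integral>\<^sup>+y\<in>ball c r. F y \<partial>lebesgue) / emeasure lborel (ball c r)"
    unfolding less_maximal_fun_iff mem_Collect_eq by blast
  then show "\<exists>T. open T \<and> x \<in> T \<and> T \<subseteq> {x. a < maximal_fun F x}"
    by (intro exI[of _ "ball c r"]) (unfold less_maximal_fun_iff, blast intro: open_ball)
qed

lemma borel_measurable_maximal_fun [measurable]: "maximal_fun F \<in> borel_measurable borel"
  by (rule borel_measurableI_greater) (simp add: borel_open open_less_maximal_fun)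

lemma maximal_fun_le_add_const:
  fixes F G :: "'a::euclidean_space \<Rightarrow> ennreal"
  assumes [measurable]: "G \<in> borel_measurable lebesgue"
    and le: "\<And>y. F y \<le> G y + s"
  shows "maximal_fun F x \<le> maximal_fun G x + s"
  unfolding maximal_fun_def[of F]
proof (rule Sup_least)
  fix z assume "z \<in> {(\<integral>\<^sup>+y\<in>ball c r. F y \<partial>lebesgue) / emeasure lborel (ball c r) | c r. x \<in> ball c r}"
  then obtain c r where x: "x \<in> ball c r"
    and z: "z = (\<integral>\<^sup>+y\<in>ball c r. F y \<partial>lebesgue) / emeasure lborel (ball c r)" by blast
  have r: "0 < r" using x by (metis ball_eq_empty empty_iff not_less)
  have "(\<integral>\<^sup>+y\<in>ball c r. F y \<partial>lebesgue) \<le> (\<integral>\<^sup>+y. G y * indicator (ball c r) y + s * indicator (ball c r) y \<partial>lebesgue)"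
    using le by (intro nn_integral_mono) (auto simp: indicator_def)
  also have "\<dots> = (\<integral>\<^sup>+y\<in>ball c r. G y \<partial>lebesgue) + s * emeasure lborel (ball c r)"
  proof -
    have [measurable]: "ball c r \<in> sets lebesgue" by simp
    show ?thesis by (subst nn_integral_add) (simp_all add: nn_integral_cmult_indicator)
  qed
  finally have "(\<integral>\<^sup>+y\<in>ball c r. F y \<partial>lebesgue) / emeasure lborel (ball c r)
     \<le> (\<integral>\<^sup>+y\<in>ball c r. G y \<partial>lebesgue) / emeasure lborel (ball c r) + s * emeasure lborel (ball c r) / emeasure lborel (ball c r)"
    by (metis add_divide_distrib_ennreal divide_right_mono_ennreal)
  also have "s * emeasure lborel (ball c r) / emeasure lborel (ball c r) = s"
    using emeasure_ball_finite_pos[OF r, of c]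
    by (simp add: ennreal_times_divide[symmetric] ennreal_divide_self)
  also have "(\<integral>\<^sup>+y\<in>ball c r. G y \<partial>lebesgue) / emeasure lborel (ball c r) \<le> maximal_fun G x"
    by (rule maximal_fun_ge[OF x])
  finally show "z \<le> maximal_fun G x + s"
    by (simp add: add_right_mono z)
qed

text \<open>
  The weak type (1,1) inequality, with the constant of Vitali's covering lemma: the balls on which the average of
  \<open>F\<close> exceeds \<open>a\<close> have bounded radii, and disjoint ones among them cover the set after a
  fivefold dilation.
\<close>

theorem maximal_fun_weak_type:
  fixes F :: "'a::euclidean_space \<Rightarrow> ennreal"
  assumes [measurable]: "F \<in> borel_measurable lebesgue" and a: "0 < a"
  shows "ennreal a * emeasure lborel {x. ennreal a < maximal_fun F x} \<le> 5 ^ DIM('a) * (\<integral>\<^sup>+y. F y \<partial>lebesgue)"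
proof (cases "(\<integral>\<^sup>+y. F y \<partial>lebesgue)")
  case top
  then show ?thesis by (simp add: ennreal_mult_top)
next
  case (real A)
  define V where "V = unit_ball_vol (real DIM('a))"
  have V: "0 < V" by (simp add: V_def)
  have vol: "emeasure lborel (ball c r) = ennreal (V * r ^ DIM('a))"
    "emeasure lborel (cball c r) = ennreal (V * r ^ DIM('a))" if "0 \<le> r" for c :: 'a and r
    using that by (simp_all add: V_def emeasure_ball emeasure_cball)
  define E where "E = {x. ennreal a < maximal_fun F x}"
  have "\<exists>c r. x \<in> ball c r \<and> ennreal a * emeasure lborel (ball c r) \<le> (\<integral>\<^sup>+y\<in>ball c r. F y \<partial>lebesgue)"
    if "x \<in> E" for x
  proof -
    have "ennreal a < maximal_fun F x" using that by (simp add: E_def)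
    then obtain c r where cr: "x \<in> ball c r" "ennreal a < (\<integral>\<^sup>+y\<in>ball c r. F y \<partial>lebesgue) / emeasure lborel (ball c r)"
      unfolding less_maximal_fun_iff by blast
    have r: "0 < r" using cr(1) by (metis ball_eq_empty empty_iff not_less)
    have "ennreal a * emeasure lborel (ball c r) \<le> (\<integral>\<^sup>+y\<in>ball c r. F y \<partial>lebesgue)"
      using mult_right_mono[OF less_imp_le[OF cr(2)], of "emeasure lborel (ball c r)"]
      by (simp add: average_mult_ball[OF r])
    then show ?thesis using cr(1) by blast
  qed
  then obtain c r where cr: "\<And>x. x \<in> E \<Longrightarrow> x \<in> ball (c x) (r x)"
    "\<And>x. x \<in> E \<Longrightarrow> ennreal a * emeasure lborel (ball (c x) (r x)) \<le> (\<integral>\<^sup>+y\<in>ball (c x) (r x). F y \<partial>lebesgue)"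
    by metis
  define B where "B = max 1 (A / (a * V))"
  have r: "0 < r x \<and> r x \<le> B" if "x \<in> E" for x
  proof
    show r0: "0 < r x" using cr(1)[OF that] by (metis ball_eq_empty empty_iff not_less)
    have "ennreal (a * (V * r x ^ DIM('a))) \<le> (\<integral>\<^sup>+y\<in>ball (c x) (r x). F y \<partial>lebesgue)"
      using cr(2)[OF that] r0 a V by (simp add: vol ennreal_mult)
    also have "\<dots> \<le> (\<integral>\<^sup>+y. F y \<partial>lebesgue)"
      by (intro nn_integral_mono) (auto simp: indicator_def)
    finally have "a * (V * r x ^ DIM('a)) \<le> A" using real by simp
    then have *: "r x ^ DIM('a) \<le> A / (a * V)" using a V by (simp add: field_simps)
    show "r x \<le> B"
    proof (cases "r x \<le> 1")
      case False
      then have "r x \<le> r x ^ DIM('a)" by (intro self_le_power) auto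
      then show ?thesis using * by (simp add: B_def)
    qed (simp add: B_def)
  qed
  have cover: "E \<subseteq> (\<Union>x\<in>E. cball (c x) (r x))" using cr(1) ball_subset_cball by blast
  obtain C where C: "countable C" "C \<subseteq> E"
      "pairwise (\<lambda>i j. disjnt (cball (c i) (r i)) (cball (c j) (r j))) C"
      "E \<subseteq> (\<Union>i\<in>C. cball (c i) (5 * r i))"
    by (rule Vitali_covering_lemma_cballs[OF cover r]) (blast intro: that)+
  \<comment> \<open>Enumerations of the selected balls by natural numbers, empty where the enumeration of \<open>C\<close> is undefined.\<close>
  define D where "D n s = (if n \<in> to_nat_on C ` C then cball (c (from_nat_into C n)) (s * r (from_nat_into C n)) else {})" for n s
  define D' where "D' n = (if n \<in> to_nat_on C ` C then ball (c (from_nat_into C n)) (r (from_nat_into C n)) else {})" for n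
  have E_sub: "E \<subseteq> (\<Union>n. D n 5)"
  proof
    fix x assume "x \<in> E"
    then obtain i where i: "i \<in> C" "x \<in> cball (c i) (5 * r i)" using C(4) by blast
    then have "x \<in> D (to_nat_on C i) 5" using C(1) by (simp add: D_def)
    then show "x \<in> (\<Union>n. D n 5)" by blast
  qed
  have disj: "disjoint_family D'"
    unfolding disjoint_family_on_def
  proof (intro ballI impI)
    fix m n :: nat assume mn: "m \<noteq> n"
    show "D' m \<inter> D' n = {}"
    proof (cases "m \<in> to_nat_on C ` C \<and> n \<in> to_nat_on C ` C")
      case True
      then obtain i j where ij: "m = to_nat_on C i" "n = to_nat_on C j" "i \<in> C" "j \<in> C" by blast
      then have "i \<noteq> j" using mn by auto
      then have "disjnt (cball (c i) (r i)) (cball (c j) (r j))"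
        using C(3) ij by (auto simp: pairwise_def)
      then have "ball (c i) (r i) \<inter> ball (c j) (r j) = {}"
        unfolding disjnt_def using ball_subset_cball by blast
      moreover have "D' m = ball (c i) (r i)" "D' n = ball (c j) (r j)"
        using ij C(1) by (auto simp: D'_def)
      ultimately show ?thesis by simp
    qed (auto simp: D'_def)
  qed
  have D_meas: "D n s \<in> sets borel" "D' n \<in> sets borel" for n s
    by (auto simp: D_def D'_def)
  have [measurable]: "D' n \<in> sets lebesgue" for n
    using D_meas(2)[of n] by (intro sets_completionI_sets) simp
  have vol_D: "ennreal a * emeasure lborel (D n 5) \<le> 5 ^ DIM('a) * (\<integral>\<^sup>+y\<in>D' n. F y \<partial>lebesgue)" for n
  proof (cases "n \<in> to_nat_on C ` C")
    case True
    then obtain i where i: "n = to_nat_on C i" "i \<in> C" by blast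
    then have iE: "i \<in> E" using C(2) by blast
    have "emeasure lborel (D n 5) = 5 ^ DIM('a) * emeasure lborel (ball (c i) (r i))"
      using i C(1) r[OF iE] V by (simp add: D_def vol power_mult_distrib ennreal_mult mult_ac flip: ennreal_power ennreal_numeral)
    then have "ennreal a * emeasure lborel (D n 5) = 5 ^ DIM('a) * (ennreal a * emeasure lborel (ball (c i) (r i)))"
      by (simp add: mult_ac)
    also have "\<dots> \<le> 5 ^ DIM('a) * (\<integral>\<^sup>+y\<in>D' n. F y \<partial>lebesgue)"
      using cr(2)[OF iE] i C(1) by (intro mult_left_mono) (auto simp: D'_def)
    finally show ?thesis .
  qed (simp add: D_def)
  have "ennreal a * emeasure lborel E \<le> ennreal a * emeasure lborel (\<Union>n. D n 5)"
    using E_sub D_meas by (intro mult_left_mono emeasure_mono) auto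
  also have "\<dots> \<le> ennreal a * (\<Sum>n. emeasure lborel (D n 5))"
    using D_meas by (intro mult_left_mono emeasure_subadditive_countably) auto
  also have "\<dots> = (\<Sum>n. ennreal a * emeasure lborel (D n 5))" by simp
  also have "\<dots> \<le> (\<Sum>n. 5 ^ DIM('a) * (\<integral>\<^sup>+y\<in>D' n. F y \<partial>lebesgue))"
    by (intro suminf_le vol_D summableI)
  also have "\<dots> = 5 ^ DIM('a) * (\<Sum>n. \<integral>\<^sup>+y\<in>D' n. F y \<partial>lebesgue)" by simp
  also have "(\<Sum>n. \<integral>\<^sup>+y\<in>D' n. F y \<partial>lebesgue) = (\<integral>\<^sup>+y. (\<Sum>n. F y * indicator (D' n) y) \<partial>lebesgue)"
    by (intro nn_integral_suminf[symmetric]) measurable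
  also have "\<dots> = (\<integral>\<^sup>+y. F y * indicator (\<Union>n. D' n) y \<partial>lebesgue)"
    by (simp add: suminf_indicator[OF disj])
  also have "5 ^ DIM('a) * \<dots> \<le> 5 ^ DIM('a) * (\<integral>\<^sup>+y. F y \<partial>lebesgue)"
    by (intro mult_left_mono nn_integral_mono) (auto simp: indicator_def)
  finally show ?thesis by (simp add: E_def)
qed

text \<open>
  The function \<open>f\<close> is cut at height \<open>s = f\<^sup>*(t)\<close>. The lower part contributes at most \<open>s\<close> to the
  maximal function, and the excess is integrable with integral at most \<open>t * S\<close>, so that the weak type inequality applies
  to it.
\<close>

lemma rearrangement_maximal_fun_le:
  fixes f :: "real ^ 'n \<Rightarrow> real"
  assumes f [measurable]: "f \<in> borel_measurable lebesgue" and t: "0 < t"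
  defines "S \<equiv> dyadic_mean f t"
  shows "rearrangement (\<lambda>x. enn2real (maximal_fun (\<lambda>y. ennreal \<bar>f y\<bar>) x)) t \<le> ennreal (1 + 5 ^ CARD('n)) * S"
    and "S < top \<Longrightarrow> AE x in lebesgue. maximal_fun (\<lambda>y. ennreal \<bar>f y\<bar>) x < top"
proof -
  let ?M = "maximal_fun (\<lambda>y. ennreal \<bar>f y\<bar>)"
  have main: "\<exists>s\<ge>0. ennreal s \<le> S \<and> (\<forall>a>0. ennreal a * emeasure lborel {x. ennreal (s + a) < ?M x} \<le> 5 ^ CARD('n) * (ennreal t * S))"
    if S: "S < top"
  proof -
    define s where "s = enn2real (rearrangement f t)"
    have le: "rearrangement f t \<le> S" unfolding S_def by (rule rearrangement_le_suminf[OF t])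
    then have s: "rearrangement f t = ennreal s" "0 \<le> s" using S by (auto simp: s_def)
    define F where "F x = ennreal (\<bar>f x\<bar> - s)" for x
    have [measurable]: "F \<in> borel_measurable lebesgue" unfolding F_def by measurable
    have "ennreal \<bar>f y\<bar> \<le> F y + ennreal s" for y
    proof -
      have "ennreal \<bar>f y\<bar> \<le> ennreal (max 0 (\<bar>f y\<bar> - s) + s)" by (intro ennreal_leI) auto
      also have "\<dots> = ennreal (max 0 (\<bar>f y\<bar> - s)) + ennreal s" using s by (intro ennreal_plus) auto
      also have "ennreal (max 0 (\<bar>f y\<bar> - s)) = F y" by (auto simp: F_def max_def ennreal_neg)
      finally show ?thesis .
    qed
    then have MF: "?M x \<le> maximal_fun F x + ennreal s" for x
      by (intro maximal_fun_le_add_const) auto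
    have "ennreal a * emeasure lborel {x. ennreal (s + a) < ?M x} \<le> 5 ^ CARD('n) * (ennreal t * S)" if a: "0 < a" for a
    proof -
      have "{x. ennreal (s + a) < ?M x} \<subseteq> {x. ennreal a < maximal_fun F x}"
      proof
        fix x assume "x \<in> {x. ennreal (s + a) < ?M x}"
        then have "ennreal a + ennreal s < maximal_fun F x + ennreal s"
          using MF[of x] s a less_le_trans[of "ennreal (s + a)" "?M x" "maximal_fun F x + ennreal s"]
          by (simp add: add.commute)
        then have "\<not> maximal_fun F x \<le> ennreal a"
          using add_right_mono[of "maximal_fun F x" "ennreal a" "ennreal s"] by (auto simp: not_le)
        then show "x \<in> {x. ennreal a < maximal_fun F x}" by (simp add: not_le)
      qed
      then have "ennreal a * emeasure lborel {x. ennreal (s + a) < ?M x} \<le> ennreal a * emeasure lborel {x. ennreal a < maximal_fun F x}"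
        by (intro mult_left_mono emeasure_mono) (auto simp: borel_open open_less_maximal_fun)
      also have "\<dots> \<le> 5 ^ CARD('n) * (\<integral>\<^sup>+y. F y \<partial>lebesgue)"
        using maximal_fun_weak_type[of F a] a by simp
      also have "\<dots> \<le> 5 ^ CARD('n) * (ennreal t * S)"
        unfolding F_def S_def using s t by (intro mult_left_mono nn_integral_excess_le) auto
      finally show ?thesis .
    qed
    then show ?thesis using s le by (intro exI[of _ s]) simp
  qed
  show "AE x in lebesgue. ?M x < top" if S: "S < top"
  proof -
    obtain s where s: "\<And>a. 0 < a \<Longrightarrow> ennreal a * emeasure lborel {x. ennreal (s + a) < ?M x} \<le> 5 ^ CARD('n) * (ennreal t * S)"
      using main[OF S] by blast
    define K where "K = enn2real (5 ^ CARD('n) * (ennreal t * S))"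
    have K: "5 ^ CARD('n) * (ennreal t * S) = ennreal K" "0 \<le> K"
      using S by (auto simp: K_def ennreal_mult_less_top power_less_top_ennreal)
    have "emeasure lborel {x. ?M x = top} \<le> ennreal (K / (1 + real k))" for k :: nat
    proof -
      have "ennreal (1 + real k) * emeasure lborel {x. ?M x = top} \<le> ennreal (1 + real k) * emeasure lborel {x. ennreal (s + (1 + real k)) < ?M x}"
        by (intro mult_left_mono emeasure_mono) (auto simp: borel_open open_less_maximal_fun)
      also have "\<dots> \<le> ennreal K" using s[of "1 + real k"] K by simp
      finally have *: "ennreal (1 + real k) * emeasure lborel {x. ?M x = top} \<le> ennreal K" .
      have "emeasure lborel {x. ?M x = top} = ennreal (1 / (1 + real k)) * (ennreal (1 + real k) * emeasure lborel {x. ?M x = top})"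
      proof -
        have "ennreal (1 / (1 + real k)) * ennreal (1 + real k) = 1"
          by (subst ennreal_mult[symmetric]) auto
        then show ?thesis by (simp only: mult.assoc[symmetric] mult_1)
      qed
      also have "\<dots> \<le> ennreal (1 / (1 + real k)) * ennreal K" by (intro mult_left_mono *) simp
      also have "\<dots> = ennreal (K / (1 + real k))" using K by (simp flip: ennreal_mult)
      finally show ?thesis .
    qed
    moreover have "(\<lambda>k. ennreal (K / (1 + real k))) \<longlonglongrightarrow> 0"
    proof -
      have "(\<lambda>k. K / (1 + real k)) \<longlonglongrightarrow> 0" by (rule real_tendsto_divide_at_top[OF tendsto_const]) (auto intro!: filterlim_tendsto_add_at_top[OF tendsto_const] filterlim_real_sequentially)
      then show ?thesis using tendsto_ennrealI by fastforce
    qed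
    ultimately have "emeasure lborel {x. ?M x = top} \<le> 0"
      by (intro LIMSEQ_le_const) auto
    moreover have "{x \<in> space lborel. ?M x = top} \<in> sets lborel" by measurable
    ultimately have "AE x in lborel. ?M x \<noteq> top"
      by (subst AE_iff_measurable[of "{x. ?M x = top}"]) auto
    then show ?thesis by (auto intro!: AE_completion simp: less_top)
  qed
  show "rearrangement (\<lambda>x. enn2real (?M x)) t \<le> ennreal (1 + 5 ^ CARD('n)) * S"
  proof (cases "S")
    case top
    then show ?thesis by (simp add: ennreal_mult_top)
  next
    case (real S')
    then obtain s where s: "0 \<le> s" "ennreal s \<le> S"
      "\<And>a. 0 < a \<Longrightarrow> ennreal a * emeasure lborel {x. ennreal (s + a) < ?M x} \<le> 5 ^ CARD('n) * (ennreal t * S)"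
      using main by auto
    have "rearrangement (\<lambda>x. enn2real (?M x)) t \<le> ennreal ((1 + 5 ^ CARD('n)) * S') + ennreal e" if e: "0 < e" for e
    proof -
      \<comment> \<open>The summand \<open>e\<close> keeps the level positive when \<open>S = 0\<close>.\<close>
      define a where "a = 5 ^ CARD('n) * S' + e"
      have a: "0 < a" using real e by (simp add: a_def add_nonneg_pos)
      have "emeasure lebesgue {x. s + a < \<bar>enn2real (?M x)\<bar>} \<le> emeasure lebesgue {x. ennreal (s + a) < ?M x}"
      proof (rule emeasure_mono)
        show "{x. s + a < \<bar>enn2real (?M x)\<bar>} \<subseteq> {x. ennreal (s + a) < ?M x}"
        proof
          fix x assume "x \<in> {x. s + a < \<bar>enn2real (?M x)\<bar>}"
          then show "x \<in> {x. ennreal (s + a) < ?M x}"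
            using s(1) a by (cases "?M x") (auto intro: ennreal_lessI simp del: ennreal_plus)
        qed
      qed (simp add: borel_open open_less_maximal_fun)
      also have "\<dots> = emeasure lborel {x. ennreal (s + a) < ?M x}"
        by (simp add: borel_open open_less_maximal_fun)
      also have "\<dots> = ennreal (1 / a) * (ennreal a * emeasure lborel {x. ennreal (s + a) < ?M x})"
      proof -
        have "ennreal (1 / a) * ennreal a = 1"
          using a by (subst ennreal_mult[symmetric]) auto
        then show ?thesis by (simp only: mult.assoc[symmetric] mult_1)
      qed
      also have "\<dots> \<le> ennreal (1 / a) * (5 ^ CARD('n) * (ennreal t * S))"
        by (intro mult_left_mono s a) simp
      also have "\<dots> = ennreal (5 ^ CARD('n) * (t * S') / a)"
      proof -
        have "(5::ennreal) ^ CARD('n) = ennreal (5 ^ CARD('n))"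
          by (simp flip: ennreal_power ennreal_numeral)
        moreover have "1 / a * (5 ^ CARD('n) * (t * S')) = 5 ^ CARD('n) * (t * S') / a" by simp
        ultimately show ?thesis using a t real
          by (simp only: ennreal_mult[symmetric] divide_nonneg_nonneg mult_nonneg_nonneg zero_le_power
              zero_le_numeral zero_le_one less_imp_le)
      qed
      also have "\<dots> \<le> ennreal t"
      proof (rule ennreal_leI)
        have "5 ^ CARD('n) * (t * S') \<le> t * a" using t e by (simp add: a_def algebra_simps)
        then show "5 ^ CARD('n) * (t * S') / a \<le> t" using a by (simp add: field_simps)
      qed
      finally have "rearrangement (\<lambda>x. enn2real (?M x)) t \<le> ennreal (s + a)"
        using s a by (intro rearrangement_le) auto
      also have "\<dots> \<le> ennreal ((1 + 5 ^ CARD('n)) * S' + e)"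
        using s(1,2) real by (intro ennreal_leI) (auto simp: a_def algebra_simps)
      finally show ?thesis using real e by (simp add: ennreal_plus)
    qed
    then have "rearrangement (\<lambda>x. enn2real (?M x)) t \<le> ennreal ((1 + 5 ^ CARD('n)) * S')"
      by (rule ennreal_le_epsilon)
    then show ?thesis using real by (simp add: ennreal_mult)
  qed
qed

theorem lorentz_space_maximal_fun:
  fixes f :: "real ^ 'n \<Rightarrow> real"
  assumes p: "1 < p" and q: "1 \<le> q" and f: "f \<in> lorentz_space p q"
  shows "(\<lambda>x. enn2real (maximal_fun (\<lambda>y. ennreal \<bar>f y\<bar>) x)) \<in> lorentz_space p q"
    and "AE x in lebesgue. maximal_fun (\<lambda>y. ennreal \<bar>f y\<bar>) x < top"
proof -
  have fm: "f \<in> borel_measurable lebesgue" using f by (simp add: lorentz_space_def)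
  have "(\<lambda>x. enn2real (maximal_fun (\<lambda>y. ennreal \<bar>f y\<bar>) x)) \<in> borel_measurable lborel"
    by measurable
  then show "(\<lambda>x. enn2real (maximal_fun (\<lambda>y. ennreal \<bar>f y\<bar>) x)) \<in> lorentz_space p q"
    using rearrangement_maximal_fun_le(1)[OF fm]
    by (intro lorentz_space_rearrangement_bound[OF p q f, where C = "1 + 5 ^ CARD('n)"]) (auto intro: measurable_completion)
  show "AE x in lebesgue. maximal_fun (\<lambda>y. ennreal \<bar>f y\<bar>) x < top"
    using rearrangement_maximal_fun_le(2)[OF fm, of 1] lorentz_space_suminf_finite[OF p q f, of 1] by simp
qed

section \<open>Smooth bump functions\<close>

text \<open>
  Every derivative of \<open>exp (-1/t)\<close>, extended by \<open>0\<close> to the left half-line, is a linear combination of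
  these functions.
\<close>

definition flat_exp :: "nat \<Rightarrow> real \<Rightarrow> real" where
  "flat_exp j t = (if 0 < t then inverse t ^ j / exp (inverse t) else 0)"

lemma flat_exp_tendsto_0: "((\<lambda>t. inverse t ^ j / exp (inverse t)) \<longlongrightarrow> (0::real)) (at_right 0)"
  by (rule filterlim_compose[OF tendsto_power_div_exp_0 filterlim_inverse_at_top_right])

lemma DERIV_flat_exp:
  "(flat_exp j has_real_derivative (flat_exp (j+2) t - real j * flat_exp (j+1) t)) (at t)"
proof -
  consider "0 < t" | "t < 0" | "t = 0" by linarith
  then show ?thesis
  proof cases
    case 1
    have "((\<lambda>t. inverse t ^ j / exp (inverse t)) has_real_derivative
        (flat_exp (j+2) t - real j * flat_exp (j+1) t)) (at t)"
    proof (cases j)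
      case 0
      then show ?thesis using 1
        by (auto intro!: derivative_eq_intros simp: flat_exp_def field_simps power2_eq_square)
    next
      case (Suc m)
      then show ?thesis using 1
        by (auto intro!: derivative_eq_intros simp: flat_exp_def divide_simps power2_eq_square)
          (cases m; simp add: algebra_simps)
    qed
    then show ?thesis
      by (rule has_field_derivative_transform_within_open[where S = "{0<..}"])
        (use 1 in \<open>auto simp: flat_exp_def\<close>)
  next
    case 2
    have "((\<lambda>t. 0) has_real_derivative 0) (at t)" by simp
    then have "(flat_exp j has_real_derivative 0) (at t)"
      by (rule has_field_derivative_transform_within_open[where S = "{..<0}"])
        (use 2 in \<open>auto simp: flat_exp_def\<close>)
    then show ?thesis using 2 by (simp add: flat_exp_def)
  next
    case 3
    have "((\<lambda>h. (flat_exp j (0 + h) - flat_exp j 0) / h) \<longlongrightarrow> 0) (at 0)"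
      unfolding filterlim_split_at[of _ "nhds (0::real)"]
    proof (rule filterlim_split_at)
      show "((\<lambda>h. (flat_exp j (0 + h) - flat_exp j 0) / h) \<longlongrightarrow> 0) (at_left 0)"
        by (rule tendsto_eventually) (auto simp: eventually_at_filter flat_exp_def)
      show "((\<lambda>h. (flat_exp j (0 + h) - flat_exp j 0) / h) \<longlongrightarrow> 0) (at_right 0)"
        by (rule Lim_transform_eventually[OF flat_exp_tendsto_0[of "Suc j"]])
          (auto simp: eventually_at_filter flat_exp_def field_simps)
    qed
    then show ?thesis using 3 by (simp add: DERIV_def flat_exp_def)
  qed
qed

text \<open>
  The algebra generated by the functions \<open>flat_exp j\<close> in affine functions of single coordinates.
  It is closed under partial derivatives, so that smoothness of all its members is a matter of first
  derivatives only.
\<close>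

inductive flat_exp_algebra :: "(real ^ 'n \<Rightarrow> real) \<Rightarrow> bool" where
  const: "flat_exp_algebra (\<lambda>x. c)"
| flat: "flat_exp_algebra (\<lambda>x. flat_exp j (a * x $ i + c))"
| add: "flat_exp_algebra \<phi> \<Longrightarrow> flat_exp_algebra \<psi> \<Longrightarrow> flat_exp_algebra (\<lambda>x. \<phi> x + \<psi> x)"
| mult: "flat_exp_algebra \<phi> \<Longrightarrow> flat_exp_algebra \<psi> \<Longrightarrow> flat_exp_algebra (\<lambda>x. \<phi> x * \<psi> x)"

lemma flat_exp_algebra_prod:
  "finite I \<Longrightarrow> (\<And>i. i \<in> I \<Longrightarrow> flat_exp_algebra (\<phi> i)) \<Longrightarrow> flat_exp_algebra (\<lambda>x. \<Prod>i\<in>I. \<phi> i x)"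
  by (induction I rule: finite_induct) (auto intro: flat_exp_algebra.intros)

lemma flat_exp_algebra_has_derivative:
  fixes \<phi> :: "real ^ 'n \<Rightarrow> real"
  assumes "flat_exp_algebra \<phi>"
  shows "\<exists>D. (\<forall>x. (\<phi> has_derivative D x) (at x)) \<and> (\<forall>k. flat_exp_algebra (\<lambda>x. D x (axis k 1)))"
  using assms
proof induction
  case (const c)
  show ?case by (rule exI[of _ "\<lambda>x h. 0"]) (auto intro: flat_exp_algebra.intros)
next
  case (flat j a i c)
  define d where "d t = flat_exp (j+2) t - real j * flat_exp (j+1) t" for t
  have "((\<lambda>x::real^'n. flat_exp j (a * x $ i + c)) has_derivative (\<lambda>h. d (a * x $ i + c) * (a * h $ i))) (at x)" for x
  proof -
    have 1: "((\<lambda>x::real^'n. a * x $ i + c) has_derivative (\<lambda>h. a * h $ i)) (at x)"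
      by (auto intro!: derivative_eq_intros bounded_linear.has_derivative[OF bounded_linear_vec_nth])
    have "(flat_exp j has_derivative (*) (d (a * x $ i + c))) (at (a * x $ i + c))"
      using DERIV_flat_exp unfolding d_def has_field_derivative_def .
    from has_derivative_compose[OF 1 this] show ?thesis by simp
  qed
  moreover have "flat_exp_algebra (\<lambda>x. d (a * x $ i + c) * (a * axis k 1 $ i))" for k
  proof -
    have "flat_exp_algebra (\<lambda>x. (flat_exp (j+2) (a * x $ i + c) + (- real j) * flat_exp (j+1) (a * x $ i + c))
            * (a * axis k 1 $ i))"
      by (intro flat_exp_algebra.intros)
    then show ?thesis by (simp add: d_def)
  qed
  ultimately show ?case by (intro exI[of _ "\<lambda>x h. d (a * x $ i + c) * (a * h $ i)"]) auto
next
  case (add \<phi> \<psi>)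
  then obtain D E where "\<forall>x. (\<phi> has_derivative D x) (at x)" "\<forall>k. flat_exp_algebra (\<lambda>x. D x (axis k 1))"
    "\<forall>x. (\<psi> has_derivative E x) (at x)" "\<forall>k. flat_exp_algebra (\<lambda>x. E x (axis k 1))" by blast
  then show ?case
    by (intro exI[of _ "\<lambda>x h. D x h + E x h"]) (auto intro: flat_exp_algebra.intros has_derivative_add)
next
  case (mult \<phi> \<psi>)
  then obtain D E where *: "\<And>x. (\<phi> has_derivative D x) (at x)" "\<And>k. flat_exp_algebra (\<lambda>x. D x (axis k 1))"
    "\<And>x. (\<psi> has_derivative E x) (at x)" "\<And>k. flat_exp_algebra (\<lambda>x. E x (axis k 1))" by blast
  have "flat_exp_algebra (\<lambda>x. \<phi> x * E x (axis k 1) + D x (axis k 1) * \<psi> x)" for k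
    by (rule flat_exp_algebra.add[OF flat_exp_algebra.mult[OF mult.hyps(1) *(4)] flat_exp_algebra.mult[OF *(2) mult.hyps(2)]])
  then show ?case
    using has_derivative_mult[OF *(1) *(3)]
    by (intro exI[of _ "\<lambda>x h. \<phi> x * E x h + D x h * \<psi> x"]) auto
qed

lemma flat_exp_algebra_partial_deriv:
  assumes "flat_exp_algebra \<phi>"
  shows "\<phi> differentiable_on UNIV" "flat_exp_algebra (partial_deriv k \<phi>)"
proof -
  obtain D where D: "\<And>x. (\<phi> has_derivative D x) (at x)" "\<And>k. flat_exp_algebra (\<lambda>x. D x (axis k 1))"
    using flat_exp_algebra_has_derivative[OF assms] by blast
  show "\<phi> differentiable_on UNIV"
    using D(1) by (auto simp: differentiable_on_def differentiable_def)
  have "partial_deriv k \<phi> = (\<lambda>x. D x (axis k 1))"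
    by (rule ext) (simp add: partial_deriv_def frechet_derivative_at[OF D(1), symmetric])
  then show "flat_exp_algebra (partial_deriv k \<phi>)" using D(2) by simp
qed

lemma flat_exp_algebra_C_k: "flat_exp_algebra \<phi> \<Longrightarrow> C_k k \<phi>"
  by (induction k arbitrary: \<phi>)
    (auto intro: flat_exp_algebra_partial_deriv differentiable_imp_continuous_on)

text \<open>
  A smooth bump on the unit cube with the origin as a corner, not centred at the origin; the mollifier at
  \<open>x\<close> then averages over the cube \<open>[x, x + \<epsilon>]\<close>, as in \<open>AE_lebesgue_point\<close>.
\<close>

definition bump :: "real ^ 'n \<Rightarrow> real" where
  "bump z = (\<Prod>i\<in>UNIV. flat_exp 0 (z $ i) * flat_exp 0 (1 - z $ i))"

lemma flat_exp_0_bounds: "0 \<le> flat_exp 0 t" "flat_exp 0 t \<le> 1" "flat_exp 0 t \<noteq> 0 \<longleftrightarrow> 0 < t"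
  by (auto simp: flat_exp_def)

lemma bump_nonneg: "0 \<le> bump z" and bump_le_1: "bump z \<le> 1"
  by (auto simp: bump_def intro!: prod_nonneg prod_le_1 mult_nonneg_nonneg mult_le_one flat_exp_0_bounds)

lemma One_nth: "(One :: real ^ 'n) $ i = 1"
  by (simp add: cart_eq_inner_axis axis_in_Basis_iff)

lemma bump_nonzero_iff: "bump z \<noteq> 0 \<longleftrightarrow> z \<in> box 0 One"
proof -
  have "bump z \<noteq> 0 \<longleftrightarrow> (\<forall>i. flat_exp 0 (z $ i) \<noteq> 0 \<and> flat_exp 0 (1 - z $ i) \<noteq> 0)"
    by (auto simp: bump_def)
  also have "\<dots> \<longleftrightarrow> z \<in> box 0 One"
    unfolding flat_exp_0_bounds mem_box_cart One_nth by auto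
  finally show ?thesis .
qed

lemma flat_exp_algebra_scaled_bump:
  fixes x :: "real ^ 'n"
  shows "flat_exp_algebra (\<lambda>y. bump ((1 / \<epsilon>) *\<^sub>R (y - x)))"
proof -
  have "flat_exp_algebra (\<lambda>y::real^'n. (\<Prod>i\<in>UNIV. flat_exp 0 ((1/\<epsilon>) * y $ i + (- x $ i / \<epsilon>)) *
      flat_exp 0 ((- 1/\<epsilon>) * y $ i + (1 + x $ i / \<epsilon>))))"
    by (intro flat_exp_algebra_prod flat_exp_algebra.intros) auto
  moreover have "(1/\<epsilon>) * y $ i + (- x $ i / \<epsilon>) = ((1 / \<epsilon>) *\<^sub>R (y - x)) $ i"
    "(- 1/\<epsilon>) * y $ i + (1 + x $ i / \<epsilon>) = 1 - ((1 / \<epsilon>) *\<^sub>R (y - x)) $ i" for y i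
    by (auto simp: divide_simps algebra_simps)
  ultimately show ?thesis by (simp only: bump_def)
qed

lemma continuous_bump [continuous_intros]: "continuous_on UNIV (bump :: real ^ 'n \<Rightarrow> real)"
  using flat_exp_algebra_C_k[OF flat_exp_algebra_scaled_bump[of 1 0], of 0] by simp

lemma scaled_bump_nonzero:
  assumes "0 < \<epsilon>" "bump ((1 / \<epsilon>) *\<^sub>R (y - x)) \<noteq> 0"
  shows "y \<in> cbox x (x + \<epsilon> *\<^sub>R One)"
  using assms unfolding bump_nonzero_iff
  by (auto simp: mem_box inner_simps field_simps)

lemma test_function_scaled_bump:
  fixes x :: "real ^ 'n"
  assumes "0 < \<epsilon>"
  shows "test_function (\<lambda>y. bump ((1 / \<epsilon>) *\<^sub>R (y - x)))"
proof -
  have "{y. bump ((1 / \<epsilon>) *\<^sub>R (y - x)) \<noteq> 0} \<subseteq> cbox x (x + \<epsilon> *\<^sub>R One)"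
    using scaled_bump_nonzero[OF assms] by blast
  then have "bounded {y. bump ((1 / \<epsilon>) *\<^sub>R (y - x)) \<noteq> 0}"
    using bounded_cbox bounded_subset by blast
  then show ?thesis
    by (auto simp: test_function_def intro: flat_exp_algebra_C_k flat_exp_algebra_scaled_bump)
qed

definition bump_mass :: "'n::finite itself \<Rightarrow> real" where
  "bump_mass _ = (LINT z|lebesgue. bump (z :: real ^ 'n))"

lemma lebesgue_integral_affine:
  fixes F :: "real ^ 'n \<Rightarrow> real"
  assumes [measurable]: "F \<in> borel_measurable borel" and "0 < \<epsilon>"
  shows "(LINT y|lebesgue. F ((1 / \<epsilon>) *\<^sub>R (y - x))) = \<epsilon> ^ CARD('n) * (LINT z|lebesgue. F z)"
proof -
  have "(LINT y|lborel. F ((1 / \<epsilon>) *\<^sub>R (y - x)))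
     = (LINT y|density (distr lborel borel (\<lambda>z. x + \<epsilon> *\<^sub>R z)) (\<lambda>_. ennreal (\<bar>\<epsilon>\<bar> ^ DIM(real^'n))). F ((1 / \<epsilon>) *\<^sub>R (y - x)))"
    using assms(2) by (subst lborel_affine[of \<epsilon> x]) auto
  also have "\<dots> = (LINT y|distr lborel borel (\<lambda>z. x + \<epsilon> *\<^sub>R z). \<epsilon> ^ CARD('n) * F ((1 / \<epsilon>) *\<^sub>R (y - x)))"
    using assms(2) by (subst integral_density) auto
  also have "\<dots> = (LINT z|lborel. \<epsilon> ^ CARD('n) * F z)"
    using assms(2) by (subst integral_distr) auto
  finally show ?thesis by (simp add: integral_completion)
qed

lemma integrable_bump: "integrable lebesgue (bump :: real ^ 'n \<Rightarrow> real)"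
proof -
  have [measurable]: "(bump :: real ^ 'n \<Rightarrow> real) \<in> borel_measurable borel"
    by (intro borel_measurable_continuous_onI continuous_bump)
  have "integrable lebesgue (indicator (cbox 0 (One::real^'n)) :: _ \<Rightarrow> real)" by simp
  then show ?thesis
  proof (rule Bochner_Integration.integrable_bound)
    show "(bump :: real ^ 'n \<Rightarrow> real) \<in> borel_measurable lebesgue"
      by (rule measurable_completion) simp
    show "AE z in lebesgue. norm (bump (z::real^'n)) \<le> norm (indicator (cbox 0 One) z :: real)"
    proof (rule AE_I2)
      fix z :: "real ^ 'n"
      show "norm (bump z) \<le> norm (indicator (cbox 0 One) z :: real)"
        using bump_nonneg[of z] bump_le_1[of z] bump_nonzero_iff[of z] box_subset_cbox[of "0::real^'n" One]
        by (auto simp: indicator_def)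
    qed
  qed
qed

lemma bump_mass_pos: "0 < bump_mass TYPE('n::finite)"
proof -
  have "0 \<le> bump_mass TYPE('n)" unfolding bump_mass_def by (intro integral_nonneg_AE AE_I2 bump_nonneg)
  moreover have "bump_mass TYPE('n) \<noteq> 0"
  proof
    assume "bump_mass TYPE('n) = 0"
    then have "AE z in lebesgue. bump (z :: real ^ 'n) = 0"
      unfolding bump_mass_def
      using integral_nonneg_eq_0_iff_AE[OF integrable_bump[where 'n='n]] bump_nonneg by auto
    then have "AE z in lebesgue. z \<notin> box 0 (One :: real ^ 'n)"
      by eventually_elim (use bump_nonzero_iff in blast)
    then have "box 0 (One :: real ^ 'n) \<in> null_sets lebesgue"
      using AE_iff_null_sets[of "box 0 (One :: real ^ 'n)" lebesgue] by simp
    then show False by (simp add: null_sets_def emeasure_lborel_box_eq)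
  qed
  ultimately show ?thesis by linarith
qed

section \<open>Test functions\<close>

lemma has_derivative_translation:
  fixes \<phi> :: "real ^ 'n \<Rightarrow> real"
  assumes "\<phi> differentiable_on UNIV"
  shows "((\<lambda>y. \<phi> (y - w)) has_derivative frechet_derivative \<phi> (at (y - w))) (at y)"
proof -
  have "(\<phi> has_derivative frechet_derivative \<phi> (at (y - w))) (at (y - w))"
    using assms by (simp add: differentiable_on_def flip: frechet_derivative_works)
  moreover have "((\<lambda>y. y - w) has_derivative (\<lambda>h. h)) (at y)"
    by (auto intro!: derivative_eq_intros)
  ultimately show ?thesis
    using has_derivative_compose[of "\<lambda>y. y - w" "\<lambda>h. h" y UNIV \<phi> "frechet_derivative \<phi> (at (y - w))"]
    by simp
qed

lemma partial_deriv_translation: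
  assumes "\<phi> differentiable_on UNIV"
  shows "partial_deriv i (\<lambda>y. \<phi> (y - w)) = (\<lambda>y. partial_deriv i \<phi> (y - w))"
  by (rule ext)
    (simp add: partial_deriv_def frechet_derivative_at[OF has_derivative_translation[OF assms], symmetric])

lemma differentiable_on_translation:
  "\<phi> differentiable_on UNIV \<Longrightarrow> (\<lambda>y. \<phi> (y - w)) differentiable_on UNIV" for \<phi> :: "real ^ 'n \<Rightarrow> real"
  using has_derivative_translation[of \<phi> w] by (auto simp: differentiable_on_def differentiable_def)

lemma C_k_translation: "C_k k \<phi> \<Longrightarrow> C_k k (\<lambda>y. \<phi> (y - w))"
proof (induction k arbitrary: \<phi>)
  case 0
  then have "continuous_on UNIV \<phi>" by simp
  then have "continuous_on UNIV (\<lambda>y. \<phi> (y - w))"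
    by (rule continuous_on_compose2[of UNIV \<phi> UNIV "\<lambda>y. y - w"]) (auto intro: continuous_on_diff continuous_on_id continuous_on_const)
  then show ?case by simp
qed (simp add: partial_deriv_translation differentiable_on_translation)

lemma test_function_translation:
  fixes \<phi> :: "real ^ 'n \<Rightarrow> real"
  assumes "test_function \<phi>"
  shows "test_function (\<lambda>y. \<phi> (y - w))"
proof -
  have "bounded {y. \<phi> y \<noteq> 0}"
    using assms bounded_subset[OF compact_imp_bounded closure_subset] by (auto simp: test_function_def)
  then have "bounded ((+) w ` {y. \<phi> y \<noteq> 0})" by (rule bounded_translation)
  moreover have "{y. \<phi> (y - w) \<noteq> 0} \<subseteq> (+) w ` {y. \<phi> y \<noteq> 0}"
    by (auto simp: image_iff intro!: exI[of _ "_ - w"])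
  ultimately have "bounded {y. \<phi> (y - w) \<noteq> 0}" by (rule bounded_subset)
  then show ?thesis using assms by (auto simp: test_function_def intro: C_k_translation)
qed

lemma test_function_continuous:
  assumes "test_function \<phi>"
  shows "continuous_on UNIV \<phi>" "\<phi> differentiable_on UNIV" "continuous_on UNIV (partial_deriv i \<phi>)"
proof -
  have "C_k 0 \<phi>" "C_k (Suc 0) \<phi>" using assms by (auto simp only: test_function_def)
  then show "continuous_on UNIV \<phi>" "\<phi> differentiable_on UNIV" "continuous_on UNIV (partial_deriv i \<phi>)" by auto
qed

lemma test_function_has_derivative:
  fixes \<phi> :: "real ^ 'n \<Rightarrow> real"
  assumes "test_function \<phi>"
  shows "(\<phi> has_derivative (\<lambda>h. \<Sum>i\<in>UNIV. h $ i * partial_deriv i \<phi> y)) (at y)"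
proof -
  have D: "(\<phi> has_derivative frechet_derivative \<phi> (at y)) (at y)"
    using test_function_continuous(2)[OF assms] by (simp add: differentiable_on_def flip: frechet_derivative_works)
  then have lin: "linear (frechet_derivative \<phi> (at y))" by (rule has_derivative_linear)
  have "frechet_derivative \<phi> (at y) h = (\<Sum>i\<in>UNIV. h $ i * partial_deriv i \<phi> y)" for h
  proof -
    have "frechet_derivative \<phi> (at y) h = frechet_derivative \<phi> (at y) (\<Sum>i\<in>UNIV. (h $ i) *s axis i 1)"
      by (simp only: basis_expansion)
    also have "\<dots> = (\<Sum>i\<in>UNIV. h $ i * partial_deriv i \<phi> y)"
      by (simp add: linear_sum[OF lin] scalar_mult_eq_scaleR linear_cmul[OF lin] partial_deriv_def)
    finally show ?thesis .
  qed
  then have "frechet_derivative \<phi> (at y) = (\<lambda>h. \<Sum>i\<in>UNIV. h $ i * partial_deriv i \<phi> y)" by (rule ext)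
  with D show ?thesis by simp
qed

lemma continuous_vanishing_bounded:
  fixes g :: "real ^ 'n \<Rightarrow> real"
  assumes "continuous_on UNIV g" "\<And>y. g y \<noteq> 0 \<Longrightarrow> norm y \<le> R"
  shows "\<exists>B\<ge>0. \<forall>y. \<bar>g y\<bar> \<le> B"
proof -
  have "compact (g ` cball 0 R)"
    using continuous_on_subset[OF assms(1), of "cball 0 R"] by (intro compact_continuous_image) auto
  then obtain B where B: "\<forall>y\<in>cball 0 R. \<bar>g y\<bar> \<le> B"
    by (auto dest!: compact_imp_bounded simp: bounded_iff)
  have "\<bar>g y\<bar> \<le> max 0 B" for y
  proof (cases "g y = 0")
    case False
    then have "\<bar>g y\<bar> \<le> B" using B assms(2)[of y] by simp
    then show ?thesis by simp
  qed simp
  then show ?thesis by (intro exI[of _ "max 0 B"]) auto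
qed

lemma test_function_bounds:
  fixes \<phi> :: "real ^ 'n \<Rightarrow> real"
  assumes "test_function \<phi>"
  obtains R B where "0 \<le> R" "0 \<le> B" "\<And>y. \<bar>\<phi> y\<bar> \<le> B" "\<And>y i. \<bar>partial_deriv i \<phi> y\<bar> \<le> B"
    "\<And>y. \<phi> y \<noteq> 0 \<Longrightarrow> norm y \<le> R" "\<And>y i. partial_deriv i \<phi> y \<noteq> 0 \<Longrightarrow> norm y \<le> R"
proof -
  have "bounded (closure {y. \<phi> y \<noteq> 0})"
    using assms compact_imp_bounded by (auto simp: test_function_def)
  then obtain R where R: "0 < R" "\<And>y. y \<in> closure {y. \<phi> y \<noteq> 0} \<Longrightarrow> norm y \<le> R"
    by (auto simp: bounded_pos)
  have 1: "norm y \<le> R" if "\<phi> y \<noteq> 0" for y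
    using R(2)[of y] closure_subset[of "{y. \<phi> y \<noteq> 0}"] that by auto
  have 2: "norm y \<le> R" if "partial_deriv i \<phi> y \<noteq> 0" for y i
  proof (rule ccontr)
    assume "\<not> norm y \<le> R"
    then have y: "y \<in> - closure {y. \<phi> y \<noteq> 0}" using R(2)[of y] by auto
    have "(\<phi> has_derivative (\<lambda>h. 0)) (at y)"
    proof (rule has_derivative_transform_within_open[OF _ _ y])
      show "\<And>x. x \<in> - closure {y. \<phi> y \<noteq> 0} \<Longrightarrow> 0 = \<phi> x"
        using closure_subset[of "{y. \<phi> y \<noteq> 0}"] by auto
    qed auto
    then have "partial_deriv i \<phi> y = 0"
      by (simp add: partial_deriv_def frechet_derivative_at[symmetric])
    then show False using that by simp
  qed
  obtain B0 where B0: "0 \<le> B0" "\<And>y. \<bar>\<phi> y\<bar> \<le> B0"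
    using continuous_vanishing_bounded[OF test_function_continuous(1)[OF assms] 1] by blast
  have "\<forall>i. \<exists>B\<ge>0. \<forall>y. \<bar>partial_deriv i \<phi> y\<bar> \<le> B"
    by (intro allI continuous_vanishing_bounded[OF test_function_continuous(3)[OF assms] 2])
  then obtain B where B: "\<And>i. 0 \<le> B i" "\<And>i y. \<bar>partial_deriv i \<phi> y\<bar> \<le> B i" by metis
  have Bi: "B i \<le> sum B UNIV" for i using B(1) by (intro member_le_sum) auto
  have "0 \<le> sum B UNIV" using B(1) by (intro sum_nonneg) auto
  show ?thesis
  proof (rule that[of R "B0 + sum B UNIV"])
    show "\<bar>partial_deriv i \<phi> y\<bar> \<le> B0 + sum B UNIV" for y i
      using B(2)[of i y] Bi[of i] B0(1) by linarith
    show "\<bar>\<phi> y\<bar> \<le> B0 + sum B UNIV" for y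
      using B0(2)[of y] \<open>0 \<le> sum B UNIV\<close> by linarith
  qed (use R 1 2 B0 \<open>0 \<le> sum B UNIV\<close> in auto)
qed

lemma borel_measurable_test_function:
  assumes "test_function \<phi>"
  shows "\<phi> \<in> borel_measurable borel" "partial_deriv i \<phi> \<in> borel_measurable borel"
  using test_function_continuous[OF assms] by (auto intro: borel_measurable_continuous_onI)

lemma integrable_mult_bounded_support:
  fixes f g :: "'a::euclidean_space \<Rightarrow> real"
  assumes f: "set_integrable lebesgue K f" and f': "f \<in> borel_measurable lebesgue"
    and [measurable]: "g \<in> borel_measurable lebesgue"
    and g: "\<And>y. \<bar>g y\<bar> \<le> B" "\<And>y. g y \<noteq> 0 \<Longrightarrow> y \<in> K"
  shows "integrable lebesgue (\<lambda>y. f y * g y)"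
proof (rule Bochner_Integration.integrable_bound)
  show "integrable lebesgue (\<lambda>y. B * (indicator K y *\<^sub>R f y))"
    using f by (simp add: set_integrable_def)
  have "norm (f y * g y) \<le> norm (B * (indicator K y *\<^sub>R f y))" for y
  proof (cases "g y = 0")
    case False
    have "0 \<le> B" using g(1)[of y] by linarith
    then show ?thesis using g(1)[of y] g(2)[OF False]
      by (simp add: abs_mult mult.commute[of B] mult_left_mono)
  qed simp
  then show "AE y in lebesgue. norm (f y * g y) \<le> norm (B * (indicator K y *\<^sub>R f y))" by simp
qed (use f' in measurable)

lemma integrable_mult_translated_test_function:
  fixes f :: "real ^ 'n \<Rightarrow> real"
  assumes f: "locally_integrable f" "f \<in> borel_measurable lebesgue" and \<phi>: "test_function \<phi>"
  shows "integrable lebesgue (\<lambda>y. f y * \<phi> (y - w))"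
    and "integrable lebesgue (\<lambda>y. f y * partial_deriv i \<phi> (y - w))"
proof -
  obtain R B where RB: "0 \<le> R" "0 \<le> B" "\<And>y. \<bar>\<phi> y\<bar> \<le> B" "\<And>y i. \<bar>partial_deriv i \<phi> y\<bar> \<le> B"
    "\<And>y. \<phi> y \<noteq> 0 \<Longrightarrow> norm y \<le> R" "\<And>y i. partial_deriv i \<phi> y \<noteq> 0 \<Longrightarrow> norm y \<le> R"
    using test_function_bounds[OF \<phi>] by metis
  note [measurable] = borel_measurable_test_function[OF \<phi>]
  have K: "set_integrable lebesgue (cball w R) f"
    using f(1) by (simp add: locally_integrable_def)
  have m1: "(\<lambda>y. \<phi> (y - w)) \<in> borel_measurable lebesgue"
    and m2: "(\<lambda>y. partial_deriv i \<phi> (y - w)) \<in> borel_measurable lebesgue"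
    by (rule measurable_completion, measurable)+
  show "integrable lebesgue (\<lambda>y. f y * \<phi> (y - w))"
    using RB(3,5) by (intro integrable_mult_bounded_support[OF K f(2) m1]) (auto simp: dist_norm norm_minus_commute)
  show "integrable lebesgue (\<lambda>y. f y * partial_deriv i \<phi> (y - w))"
    using RB(4,6) by (intro integrable_mult_bounded_support[OF K f(2) m2]) (auto simp: dist_norm norm_minus_commute)
qed

lemma differentiable_on_UNIV_has_derivative:
  "\<phi> differentiable_on UNIV \<Longrightarrow> (\<phi> has_derivative frechet_derivative \<phi> (at x)) (at x)"
  by (simp add: differentiable_on_def flip: frechet_derivative_works)

lemma
  fixes \<phi> \<psi> :: "real ^ 'n \<Rightarrow> real"
  assumes \<phi>: "\<phi> differentiable_on UNIV"
  shows differentiable_on_add_UNIV: "\<psi> differentiable_on UNIV \<Longrightarrow> (\<lambda>x. \<phi> x + \<psi> x) differentiable_on UNIV"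
    and partial_deriv_add: "\<psi> differentiable_on UNIV \<Longrightarrow>
      partial_deriv i (\<lambda>x. \<phi> x + \<psi> x) = (\<lambda>x. partial_deriv i \<phi> x + partial_deriv i \<psi> x)"
    and differentiable_on_scale_UNIV: "(\<lambda>x. c * \<phi> x) differentiable_on UNIV"
    and partial_deriv_scale: "partial_deriv i (\<lambda>x. c * \<phi> x) = (\<lambda>x. c * partial_deriv i \<phi> x)"
proof -
  note D = differentiable_on_UNIV_has_derivative
  { assume \<psi>: "\<psi> differentiable_on UNIV"
    have *: "((\<lambda>x. \<phi> x + \<psi> x) has_derivative
        (\<lambda>h. frechet_derivative \<phi> (at x) h + frechet_derivative \<psi> (at x) h)) (at x)" for x
      by (intro has_derivative_add D \<phi> \<psi>)
    then show "(\<lambda>x. \<phi> x + \<psi> x) differentiable_on UNIV"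
      by (auto simp: differentiable_on_def differentiable_def)
    show "partial_deriv i (\<lambda>x. \<phi> x + \<psi> x) = (\<lambda>x. partial_deriv i \<phi> x + partial_deriv i \<psi> x)"
      by (rule ext) (simp add: partial_deriv_def frechet_derivative_at[OF *, symmetric]) }
  have *: "((\<lambda>x. c * \<phi> x) has_derivative (\<lambda>h. c * frechet_derivative \<phi> (at x) h)) (at x)" for x
    by (intro has_derivative_mult_right D \<phi>)
  then show "(\<lambda>x. c * \<phi> x) differentiable_on UNIV"
    by (auto simp: differentiable_on_def differentiable_def)
  show "partial_deriv i (\<lambda>x. c * \<phi> x) = (\<lambda>x. c * partial_deriv i \<phi> x)"
    by (rule ext) (simp add: partial_deriv_def frechet_derivative_at[OF *, symmetric])
qed

lemma C_k_add: "C_k k \<phi> \<Longrightarrow> C_k k \<psi> \<Longrightarrow> C_k k (\<lambda>x. \<phi> x + \<psi> x)"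
  by (induction k arbitrary: \<phi> \<psi>)
    (auto simp: differentiable_on_add_UNIV partial_deriv_add intro: continuous_on_add)

lemma C_k_scale: "C_k k \<phi> \<Longrightarrow> C_k k (\<lambda>x. c * \<phi> x)"
  by (induction k arbitrary: \<phi>)
    (auto simp: differentiable_on_scale_UNIV partial_deriv_scale intro: continuous_on_mult_left)

lemma test_function_iff: "test_function \<phi> \<longleftrightarrow> (\<forall>k. C_k k \<phi>) \<and> bounded {x. \<phi> x \<noteq> 0}"
  by (simp add: test_function_def compact_closure)

lemma test_function_add: "test_function \<phi> \<Longrightarrow> test_function \<psi> \<Longrightarrow> test_function (\<lambda>x. \<phi> x + \<psi> x)"
  unfolding test_function_iff
  by (auto intro: C_k_add bounded_subset[of "{x. \<phi> x \<noteq> 0} \<union> {x. \<psi> x \<noteq> 0}"])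

lemma test_function_scale: "test_function \<phi> \<Longrightarrow> test_function (\<lambda>x. c * \<phi> x)"
  unfolding test_function_iff
  by (auto intro: C_k_scale bounded_subset[of "{x. \<phi> x \<noteq> 0}"])

section \<open>Lebesgue points and mollification\<close>

lemma set_integrable_const_cbox:
  "set_integrable lebesgue (cbox a b) (\<lambda>y. r :: real)"
proof -
  have "integrable lebesgue (indicat_real (cbox a b))"
    by (rule integrable_real_indicator) (use emeasure_lborel_cbox_finite[of a b] in auto)
  then show ?thesis by (simp add: set_integrable_def)
qed

text \<open>
  Differentiation of the integrals of \<open>\<bar>f - r\<bar>\<close> for rational \<open>r\<close> controls the averages of
  \<open>\<bar>f - f x\<bar>\<close>, since \<open>r\<close> can be chosen close to \<open>f x\<close>.
\<close>

lemma AE_lebesgue_point: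
  fixes f :: "'a::euclidean_space \<Rightarrow> real"
  assumes f: "\<And>a b. set_integrable lebesgue (cbox a b) f"
  shows "AE x in lebesgue. ((\<lambda>h. (LINT y:cbox x (x + h *\<^sub>R One)|lebesgue. \<bar>f y - f x\<bar>) / h ^ DIM('a)) \<longlongrightarrow> 0) (at_right 0)"
proof -
  note const = set_integrable_const_cbox
  have int: "set_integrable lebesgue (cbox a b) (\<lambda>y. \<bar>f y - r\<bar>)" for a b r
    using set_integral_diff(1)[OF f const] by (rule set_integrable_abs)
  have "\<forall>r. \<exists>N. negligible N \<and> (\<forall>x e. x \<notin> N \<longrightarrow> 0 < e \<longrightarrow> (\<exists>d>0. \<forall>h. 0 < h \<and> h < d \<longrightarrow>
      norm (integral (cbox x (x + h *\<^sub>R One)) (\<lambda>y. \<bar>f y - r\<bar>) /\<^sub>R h ^ DIM('a) - \<bar>f x - r\<bar>) < e))"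
  proof
    fix r
    have "(\<lambda>y. \<bar>f y - r\<bar>) integrable_on cbox a b" for a b
      using set_lebesgue_integral_eq_integral(1)[OF int] .
    from this show "\<exists>N. negligible N \<and> (\<forall>x e. x \<notin> N \<longrightarrow> 0 < e \<longrightarrow> (\<exists>d>0. \<forall>h. 0 < h \<and> h < d \<longrightarrow>
      norm (integral (cbox x (x + h *\<^sub>R One)) (\<lambda>y. \<bar>f y - r\<bar>) /\<^sub>R h ^ DIM('a) - \<bar>f x - r\<bar>) < e))"
    proof (rule integrable_ccontinuous_explicit)
      fix N :: "'a set"
      assume N: "negligible N" "\<And>x e. \<lbrakk>x \<notin> N; 0 < e\<rbrakk> \<Longrightarrow> \<exists>d>0. \<forall>h. 0 < h \<and> h < d \<longrightarrow>
        norm (integral (cbox x (x + h *\<^sub>R One)) (\<lambda>y. \<bar>f y - r\<bar>) /\<^sub>R h ^ DIM('a) - \<bar>f x - r\<bar>) < e"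
      show ?thesis using N by (intro exI[of _ N] conjI allI impI)
    qed
  qed
  then obtain N where N: "\<And>r. negligible (N r)"
    "\<And>r x e. x \<notin> N r \<Longrightarrow> 0 < e \<Longrightarrow> \<exists>d>0. \<forall>h. 0 < h \<and> h < d \<longrightarrow>
      norm (integral (cbox x (x + h *\<^sub>R One)) (\<lambda>y. \<bar>f y - r\<bar>) /\<^sub>R h ^ DIM('a) - \<bar>f x - r\<bar>) < e"
    by metis
  have "negligible (\<Union>(N ` \<rat>))"
    using N(1) by (intro negligible_countable_Union) (auto simp: countable_rat)
  then have "AE x in lebesgue. x \<notin> \<Union>(N ` \<rat>)"
    by (intro AE_not_in) (simp add: negligible_iff_null_sets)
  then show ?thesis
  proof (rule AE_mp, intro AE_I2 impI)
    fix x assume x: "x \<notin> \<Union>(N ` \<rat>)"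
    show "((\<lambda>h. (LINT y:cbox x (x + h *\<^sub>R One)|lebesgue. \<bar>f y - f x\<bar>) / h ^ DIM('a)) \<longlongrightarrow> 0) (at_right 0)"
    proof (rule tendstoI)
      fix e :: real assume e: "0 < e"
      obtain r where r: "r \<in> \<rat>" "f x < r" "r < f x + e / 4"
        using Rats_dense_in_real[of "f x" "f x + e / 4"] e by auto
      then obtain d where d: "d > 0" "\<And>h. 0 < h \<Longrightarrow> h < d \<Longrightarrow>
        norm (integral (cbox x (x + h *\<^sub>R One)) (\<lambda>y. \<bar>f y - r\<bar>) /\<^sub>R h ^ DIM('a) - \<bar>f x - r\<bar>) < e / 4"
        using N(2)[of x r "e / 4"] x e by auto
      have "dist ((LINT y:cbox x (x + h *\<^sub>R One)|lebesgue. \<bar>f y - f x\<bar>) / h ^ DIM('a)) 0 < e"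
        if h: "0 < h" "h < d" for h
      proof -
        let ?Q = "cbox x (x + h *\<^sub>R One)"
        have content: "measure lebesgue ?Q = h ^ DIM('a)"
          using h by (simp add: content_cbox_if box_eq_empty inner_simps)
        have nn: "0 \<le> (LINT y:?Q|lebesgue. \<bar>f y - f x\<bar>)"
          unfolding set_lebesgue_integral_def by (intro integral_nonneg_AE AE_I2) auto
        have "(LINT y:?Q|lebesgue. \<bar>f y - f x\<bar>) \<le> (LINT y:?Q|lebesgue. \<bar>f y - r\<bar> + \<bar>f x - r\<bar>)"
          by (intro set_integral_mono int set_integral_add const) auto
        also have "\<dots> = (LINT y:?Q|lebesgue. \<bar>f y - r\<bar>) + (LINT y:?Q|lebesgue. \<bar>f x - r\<bar>)"
          by (intro set_integral_add int const)
        also have "(LINT y:?Q|lebesgue. \<bar>f x - r\<bar>) = h ^ DIM('a) * \<bar>f x - r\<bar>"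
          by (simp add: set_lebesgue_integral_def content)
        also have "(LINT y:?Q|lebesgue. \<bar>f y - r\<bar>) = integral ?Q (\<lambda>y. \<bar>f y - r\<bar>)"
          by (rule set_lebesgue_integral_eq_integral(2)[OF int])
        finally have le: "(LINT y:?Q|lebesgue. \<bar>f y - f x\<bar>) / h ^ DIM('a)
            \<le> integral ?Q (\<lambda>y. \<bar>f y - r\<bar>) / h ^ DIM('a) + \<bar>f x - r\<bar>"
          using h by (simp add: field_simps)
        have "integral ?Q (\<lambda>y. \<bar>f y - r\<bar>) / h ^ DIM('a)
            = integral ?Q (\<lambda>y. \<bar>f y - r\<bar>) /\<^sub>R h ^ DIM('a)"
          by (simp only: real_scaleR_def divide_inverse mult.commute)
        moreover have "\<bar>integral ?Q (\<lambda>y. \<bar>f y - r\<bar>) /\<^sub>R h ^ DIM('a) - \<bar>f x - r\<bar>\<bar> < e / 4"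
          using d(2)[OF h] by (simp only: real_norm_def)
        moreover have "\<bar>f x - r\<bar> < e / 4" using r by linarith
        ultimately have "(LINT y:?Q|lebesgue. \<bar>f y - f x\<bar>) / h ^ DIM('a) < e"
          using le e by linarith
        then show ?thesis using nn h by (simp add: dist_norm)
      qed
      then show "eventually (\<lambda>h. dist ((LINT y:cbox x (x + h *\<^sub>R One)|lebesgue. \<bar>f y - f x\<bar>) / h ^ DIM('a)) 0 < e) (at_right 0)"
        using d(1) eventually_at_right_field by blast
    qed
  qed
qed

text \<open>
  The kernel has total mass \<open>bump_mass\<close> rather than \<open>1\<close>, so that mollification converges to
  a fixed multiple of \<open>f\<close>.
\<close>

definition mollify :: "(real ^ 'n \<Rightarrow> real) \<Rightarrow> real \<Rightarrow> real ^ 'n \<Rightarrow> real" where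
  "mollify f \<epsilon> x = (LINT y|lebesgue. f y * bump ((1 / \<epsilon>) *\<^sub>R (y - x))) / \<epsilon> ^ CARD('n)"

lemma integrable_mult_scaled_bump:
  fixes f :: "real ^ 'n \<Rightarrow> real"
  assumes "\<And>a b. set_integrable lebesgue (cbox a b) f" "f \<in> borel_measurable lebesgue" "0 < \<epsilon>"
  shows "integrable lebesgue (\<lambda>y. f y * bump ((1 / \<epsilon>) *\<^sub>R (y - x)))"
proof (rule integrable_mult_bounded_support[OF assms(1,2)])
  show "(\<lambda>y. bump ((1 / \<epsilon>) *\<^sub>R (y - x))) \<in> borel_measurable lebesgue"
    using borel_measurable_test_function(1)[OF test_function_scaled_bump[OF assms(3)]]
    by (intro measurable_completion) simp
  show "\<bar>bump ((1 / \<epsilon>) *\<^sub>R (y - x))\<bar> \<le> 1" for y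
    using bump_nonneg[of "(1 / \<epsilon>) *\<^sub>R (y - x)"] bump_le_1[of "(1 / \<epsilon>) *\<^sub>R (y - x)"] by simp
qed (rule scaled_bump_nonzero[OF assms(3)])

theorem AE_mollify_tendsto:
  fixes f :: "real ^ 'n \<Rightarrow> real"
  assumes f: "\<And>a b. set_integrable lebesgue (cbox a b) f" and fm: "f \<in> borel_measurable lebesgue"
  shows "AE x in lebesgue. ((\<lambda>\<epsilon>. mollify f \<epsilon> x) \<longlongrightarrow> f x * bump_mass TYPE('n)) (at_right 0)"
  using AE_lebesgue_point[OF f]
proof (rule AE_mp, intro AE_I2 impI)
  fix x
  let ?A = "\<lambda>h. (LINT y:cbox x (x + h *\<^sub>R One)|lebesgue. \<bar>f y - f x\<bar>) / h ^ DIM(real^'n)"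
  assume lim: "(?A \<longlongrightarrow> 0) (at_right 0)"
  have "\<bar>mollify f \<epsilon> x - f x * bump_mass TYPE('n)\<bar> \<le> ?A \<epsilon>" if e: "0 < \<epsilon>" for \<epsilon>
  proof -
    let ?b = "\<lambda>y. bump ((1 / \<epsilon>) *\<^sub>R (y - x))" and ?Q = "cbox x (x + \<epsilon> *\<^sub>R One)"
    note const = set_integrable_const_cbox
    have [measurable]: "(bump :: real ^ 'n \<Rightarrow> real) \<in> borel_measurable borel"
      by (intro borel_measurable_continuous_onI continuous_bump)
    have int1: "integrable lebesgue (\<lambda>y. f y * ?b y)"
      by (rule integrable_mult_scaled_bump[OF f fm e])
    have int2: "integrable lebesgue (\<lambda>y. f x * ?b y)"
      by (rule integrable_mult_scaled_bump[OF const _ e]) simp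
    have "(LINT y|lebesgue. f x * ?b y) = \<epsilon> ^ CARD('n) * (f x * bump_mass TYPE('n))"
      using lebesgue_integral_affine[of bump \<epsilon> x] e by (simp add: bump_mass_def)
    then have "mollify f \<epsilon> x - f x * bump_mass TYPE('n)
        = ((LINT y|lebesgue. f y * ?b y) - (LINT y|lebesgue. f x * ?b y)) / \<epsilon> ^ CARD('n)"
      using e by (simp add: mollify_def field_simps)
    also have "\<dots> = (LINT y|lebesgue. f y * ?b y - f x * ?b y) / \<epsilon> ^ CARD('n)"
      using int1 int2 by simp
    finally have eq: "\<bar>mollify f \<epsilon> x - f x * bump_mass TYPE('n)\<bar>
        = \<bar>LINT y|lebesgue. f y * ?b y - f x * ?b y\<bar> / \<epsilon> ^ CARD('n)"
      using e by (simp add: abs_divide)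
    have "\<bar>LINT y|lebesgue. f y * ?b y - f x * ?b y\<bar> \<le> (LINT y|lebesgue. \<bar>f y * ?b y - f x * ?b y\<bar>)"
      by (rule integral_abs_bound)
    also have "\<dots> \<le> (LINT y:?Q|lebesgue. \<bar>f y - f x\<bar>)"
      unfolding set_lebesgue_integral_def
    proof (rule integral_mono)
      show "integrable lebesgue (\<lambda>y. indicator ?Q y *\<^sub>R \<bar>f y - f x\<bar>)"
        using set_integrable_abs[OF set_integral_diff(1)[OF f const]] by (simp add: set_integrable_def)
      show "\<bar>f y * ?b y - f x * ?b y\<bar> \<le> indicator ?Q y *\<^sub>R \<bar>f y - f x\<bar>" for y
      proof (cases "?b y = 0")
        case False
        then have "y \<in> ?Q" by (rule scaled_bump_nonzero[OF e])
        moreover have "\<bar>f y * ?b y - f x * ?b y\<bar> = \<bar>f y - f x\<bar> * ?b y"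
          using bump_nonneg[of "(1 / \<epsilon>) *\<^sub>R (y - x)"] by (simp add: abs_mult flip: left_diff_distrib)
        ultimately show ?thesis
          using mult_left_mono[OF bump_le_1[of "(1 / \<epsilon>) *\<^sub>R (y - x)"], of "\<bar>f y - f x\<bar>"] by simp
      qed simp
    qed (use int1 int2 in simp)
    finally show ?thesis unfolding eq using e by (simp add: divide_right_mono)
  qed
  then have "((\<lambda>\<epsilon>. mollify f \<epsilon> x - f x * bump_mass TYPE('n)) \<longlongrightarrow> 0) (at_right 0)"
    by (intro Lim_null_comparison[OF _ lim]) (auto simp: eventually_at_filter)
  then show "((\<lambda>\<epsilon>. mollify f \<epsilon> x) \<longlongrightarrow> f x * bump_mass TYPE('n)) (at_right 0)"
    by (simp add: LIM_zero_iff)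
qed

section \<open>Weak gradients imply the pointwise inequality\<close>

lemma sigma_finite_lebesgue: "sigma_finite_measure (lebesgue :: 'a::euclidean_space measure)"
proof
  obtain A :: "nat \<Rightarrow> 'a set" where A: "range A \<subseteq> sets lborel" "(\<Union>i. A i) = space lborel"
    "\<And>i. emeasure lborel (A i) \<noteq> \<infinity>"
    by (rule lborel.sigma_finite) (blast intro: that)
  have A': "A i \<in> sets lborel" for i using A(1) by auto
  have "A i \<in> sets lebesgue" for i using A' by (rule sets_completionI_sets)
  moreover have "emeasure lebesgue (A i) \<noteq> \<infinity>" for i
    using A(3)[of i] A'[of i] by (simp add: emeasure_completion)
  ultimately show "\<exists>A::'a set set. countable A \<and> A \<subseteq> sets lebesgue \<and> \<Union>A = space lebesgue \<and> (\<forall>a\<in>A. emeasure lebesgue a \<noteq> \<infinity>)"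
    using A(2) by (intro exI[of _ "range A"]) auto
qed


text \<open>
  The fundamental theorem of calculus along a segment. The arguments \<open>y - x\<close> are those of the translated
  kernels, whence the sign.
\<close>

lemma test_function_diff_eq_integral:
  fixes \<phi> :: "real ^ 'n \<Rightarrow> real"
  assumes \<phi>: "test_function \<phi>"
  shows "\<phi> (y - (x + a)) - \<phi> (y - x)
    = - (LINT t|lborel. (\<Sum>i\<in>UNIV. a $ i * partial_deriv i \<phi> (y - (x + t *\<^sub>R a))) * indicator {0..1} t)"
proof -
  have D: "((\<lambda>t. \<phi> (y - (x + t *\<^sub>R a))) has_real_derivative
      - (\<Sum>i\<in>UNIV. a $ i * partial_deriv i \<phi> (y - (x + t *\<^sub>R a)))) (at t)" for t
  proof -
    have 1: "((\<lambda>t. y - (x + t *\<^sub>R a)) has_derivative (\<lambda>h. - (h *\<^sub>R a))) (at t)"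
      by (auto intro!: derivative_eq_intros)
    have "((\<lambda>t. \<phi> (y - (x + t *\<^sub>R a))) has_derivative
      (\<lambda>h. \<Sum>i\<in>UNIV. (- (h *\<^sub>R a)) $ i * partial_deriv i \<phi> (y - (x + t *\<^sub>R a)))) (at t)"
      by (rule has_derivative_compose[OF 1]) (rule test_function_has_derivative[OF \<phi>])
    moreover have "(\<lambda>h. \<Sum>i\<in>UNIV. (- (h *\<^sub>R a)) $ i * partial_deriv i \<phi> (y - (x + t *\<^sub>R a)))
        = (*) (- (\<Sum>i\<in>UNIV. a $ i * partial_deriv i \<phi> (y - (x + t *\<^sub>R a))))"
      by (auto simp: fun_eq_iff sum_distrib_left sum_distrib_right sum_negf mult_ac)
    ultimately show ?thesis by (simp add: has_field_derivative_def)
  qed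
  have cont: "isCont (\<lambda>t. - (\<Sum>i\<in>UNIV. a $ i * partial_deriv i \<phi> (y - (x + t *\<^sub>R a)))) t" for t
  proof -
    have "continuous_on UNIV (\<lambda>t. partial_deriv i \<phi> (y - (x + t *\<^sub>R a)))" for i
      by (rule continuous_on_compose2[OF test_function_continuous(3)[OF \<phi>], of UNIV "\<lambda>t. y - (x + t *\<^sub>R a)"])
        (auto intro!: continuous_on_diff continuous_on_add continuous_on_const continuous_on_scaleR continuous_on_id)
    then have "continuous_on UNIV (\<lambda>t. - (\<Sum>i\<in>UNIV. a $ i * partial_deriv i \<phi> (y - (x + t *\<^sub>R a))))"
      by (intro continuous_on_minus continuous_on_sum continuous_on_mult continuous_on_const)
    then show ?thesis by (simp add: continuous_on_eq_continuous_at)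
  qed
  have "(LINT t|lborel. - (\<Sum>i\<in>UNIV. a $ i * partial_deriv i \<phi> (y - (x + t *\<^sub>R a))) * indicator {0..1} t)
    = \<phi> (y - (x + 1 *\<^sub>R a)) - \<phi> (y - (x + 0 *\<^sub>R a))"
    using D cont by (intro integral_FTC_Icc_real) auto
  then show ?thesis by simp
qed

text \<open>
  The gradient of a convolution of \<open>f\<close> with a test function is the convolution of \<open>v\<close> with it. In
  this integrated form it is an instance of Fubini's theorem.
\<close>

lemma weak_gradient_convolution_diff:
  fixes f :: "real ^ 'n \<Rightarrow> real"
  assumes wg: "has_weak_gradient f v" and fm [measurable]: "f \<in> borel_measurable lebesgue" and \<phi>: "test_function \<phi>"
  shows "(LINT y|lebesgue. f y * \<phi> (y - (x + a))) - (LINT y|lebesgue. f y * \<phi> (y - x))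
    = (LINT t|lborel. (\<Sum>i\<in>UNIV. a $ i * (LINT y|lebesgue. v y $ i * \<phi> (y - (x + t *\<^sub>R a)))) * indicator {0..1} t)"
proof -
  interpret L: sigma_finite_measure "lebesgue :: (real ^ 'n) measure" by (rule sigma_finite_lebesgue)
  interpret P: pair_sigma_finite "lebesgue :: (real ^ 'n) measure" "lborel :: real measure" ..
  obtain R B where RB: "0 \<le> R" "0 \<le> B" "\<And>y. \<bar>\<phi> y\<bar> \<le> B" "\<And>y i. \<bar>partial_deriv i \<phi> y\<bar> \<le> B"
    "\<And>y. \<phi> y \<noteq> 0 \<Longrightarrow> norm y \<le> R" "\<And>y i. partial_deriv i \<phi> y \<noteq> 0 \<Longrightarrow> norm y \<le> R"
    using test_function_bounds[OF \<phi>] by metis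
  have loc: "locally_integrable f" using wg by (simp add: has_weak_gradient_def)
  note int = integrable_mult_translated_test_function[OF loc fm \<phi>]
  note bm[measurable] = borel_measurable_test_function[OF \<phi>]
  define P where "P y t = (\<Sum>i\<in>UNIV. a $ i * partial_deriv i \<phi> (y - (x + t *\<^sub>R a)))" for y t
  define K where "K = cball (0 :: real ^ 'n) (R + norm x + norm a)"
  \<comment> \<open>For \<open>t\<close> in the unit interval the integrand vanishes off \<open>K\<close> and is bounded by \<open>A\<close>.\<close>
  define A where "A = (\<Sum>i\<in>UNIV. \<bar>a $ i\<bar>) * B"
  have A: "0 \<le> A" using RB(2) by (simp add: A_def sum_nonneg)
  have P_le: "\<bar>P y t * indicator {0..1} t\<bar> \<le> A * indicator K y * indicator {0..1} t" for y t
  proof (cases "t \<in> {0..1} \<and> P y t \<noteq> 0")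
    case True
    have "\<exists>i. partial_deriv i \<phi> (y - (x + t *\<^sub>R a)) \<noteq> 0"
    proof (rule ccontr)
      assume "\<not> ?thesis"
      then have "P y t = 0" by (simp add: P_def)
      with True show False by simp
    qed
    then obtain i where "partial_deriv i \<phi> (y - (x + t *\<^sub>R a)) \<noteq> 0" by blast
    then have "norm (y - (x + t *\<^sub>R a)) \<le> R" by (rule RB(6))
    moreover have "norm (t *\<^sub>R a) \<le> norm a" using True by (simp add: mult_left_le_one_le)
    moreover have "norm y \<le> norm (y - (x + t *\<^sub>R a)) + norm (x + t *\<^sub>R a)"
      using norm_triangle_ineq[of "y - (x + t *\<^sub>R a)" "x + t *\<^sub>R a"] by simp
    moreover have "norm (x + t *\<^sub>R a) \<le> norm x + norm (t *\<^sub>R a)" by (rule norm_triangle_ineq)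
    ultimately have "y \<in> K" by (simp add: K_def)
    moreover have "\<bar>P y t\<bar> \<le> A"
      unfolding P_def A_def sum_distrib_right
      by (rule order_trans[OF sum_abs]) (auto simp: abs_mult intro!: sum_mono mult_left_mono RB(4))
    ultimately show ?thesis using True by simp
  next
    case False
    then show ?thesis using A by (auto simp: indicator_def)
  qed
  have fst_m[measurable]: "fst \<in> (lebesgue \<Otimes>\<^sub>M (lborel :: real measure)) \<rightarrow>\<^sub>M (borel :: (real ^ 'n) measure)"
  proof -
    have "(\<lambda>y. y) \<in> lebesgue \<rightarrow>\<^sub>M (borel :: (real ^ 'n) measure)"
      by (rule measurable_completion) simp
    then show ?thesis by (rule measurable_compose[OF measurable_fst])
  qed
  have f_m[measurable]: "(\<lambda>z. f (fst z)) \<in> borel_measurable (lebesgue \<Otimes>\<^sub>M (lborel :: real measure))"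
    by (rule measurable_compose[OF measurable_fst fm])
  have K_m[measurable]: "K \<in> sets borel" by (simp add: K_def)
  have int_K: "integrable lebesgue (\<lambda>y. f y * indicator K y)"
    using loc by (simp add: locally_integrable_def K_def set_integrable_def mult.commute)
  define G where "G y t = f y * (P y t * indicator {0..1} t)" for y t
  have G_int: "integrable (lebesgue \<Otimes>\<^sub>M lborel) (case_prod G)"
  proof (rule Bochner_Integration.integrable_bound)
    have eq: "(LINT t|lborel. norm (A * \<bar>f y * indicator K y\<bar> * indicator {0..1::real} t)) = A * \<bar>f y * indicator K y\<bar>" for y
      using A by (simp add: abs_mult content_real)
    show "integrable (lebesgue \<Otimes>\<^sub>M lborel) (\<lambda>z. A * \<bar>f (fst z) * indicator K (fst z)\<bar> * indicator {0..1::real} (snd z))"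
    proof (rule P.Fubini_integrable)
      show "integrable lebesgue (\<lambda>y. LINT t|lborel. norm (A * \<bar>f (fst (y, t)) * indicator K (fst (y, t))\<bar> * indicator {0..1::real} (snd (y, t))))"
        using int_K by (simp add: eq del: norm_mult abs_mult real_norm_def)
      show "AE y in lebesgue. integrable lborel (\<lambda>t. A * \<bar>f (fst (y, t)) * indicator K (fst (y, t))\<bar> * indicator {0..1::real} (snd (y, t)))"
        by (rule AE_I2) (simp add: integrable_real_indicator)
    qed measurable
    show "case_prod G \<in> borel_measurable (lebesgue \<Otimes>\<^sub>M lborel)"
      unfolding G_def P_def case_prod_beta by measurable
    have "norm (G y t) \<le> norm (A * \<bar>f y * indicator K y\<bar> * indicator {0..1} t)" for y t
    proof -
      have "norm (G y t) = \<bar>f y\<bar> * \<bar>P y t * indicator {0..1} t\<bar>" by (simp add: G_def abs_mult)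
      also have "\<dots> \<le> \<bar>f y\<bar> * (A * indicator K y * indicator {0..1} t)"
        by (intro mult_left_mono P_le) simp
      also have "\<dots> = norm (A * \<bar>f y * indicator K y\<bar> * indicator {0..1} t)"
        using A by (simp add: abs_mult)
      finally show ?thesis .
    qed
    then show "AE z in lebesgue \<Otimes>\<^sub>M lborel. norm (case_prod G z)
        \<le> norm (A * \<bar>f (fst z) * indicator K (fst z)\<bar> * indicator {0..1::real} (snd z))"
      by (intro AE_I2) (simp add: case_prod_beta)
  qed
  have inner: "(LINT y|lebesgue. G y t)
      = - ((\<Sum>i\<in>UNIV. a $ i * (LINT y|lebesgue. v y $ i * \<phi> (y - (x + t *\<^sub>R a)))) * indicator {0..1} t)" for t
  proof -
    have "(LINT y|lebesgue. G y t)
        = (LINT y|lebesgue. (\<Sum>i\<in>UNIV. a $ i * (f y * partial_deriv i \<phi> (y - (x + t *\<^sub>R a)))) * indicator {0..1} t)"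
      by (rule Bochner_Integration.integral_cong)
        (auto simp: G_def P_def sum_distrib_left sum_distrib_right mult_ac)
    also have "\<dots> = (\<Sum>i\<in>UNIV. a $ i * (LINT y|lebesgue. f y * partial_deriv i \<phi> (y - (x + t *\<^sub>R a)))) * indicator {0..1} t"
      using int(2) by (simp add: Bochner_Integration.integral_sum)
    also have "\<dots> = (\<Sum>i\<in>UNIV. a $ i * - (LINT y|lebesgue. v y $ i * \<phi> (y - (x + t *\<^sub>R a)))) * indicator {0..1} t"
    proof -
      have "(LINT y|lebesgue. f y * partial_deriv i \<phi> (y - w)) = - (LINT y|lebesgue. v y $ i * \<phi> (y - w))" for i w
      proof -
        have "(LINT y|lebesgue. f y * partial_deriv i (\<lambda>y. \<phi> (y - w)) y) = - (LINT y|lebesgue. v y $ i * \<phi> (y - w))"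
          using wg test_function_translation[OF \<phi>] by (simp add: has_weak_gradient_def)
        then show ?thesis by (simp add: partial_deriv_translation[OF test_function_continuous(2)[OF \<phi>]])
      qed
      then show ?thesis by simp
    qed
    finally show ?thesis by (simp add: sum_negf)
  qed
  have "(LINT y|lebesgue. f y * \<phi> (y - (x + a))) - (LINT y|lebesgue. f y * \<phi> (y - x))
      = (LINT y|lebesgue. f y * (\<phi> (y - (x + a)) - \<phi> (y - x)))"
    using int(1) by (simp add: right_diff_distrib)
  also have "\<dots> = (LINT y|lebesgue. - (LINT t|lborel. G y t))"
    by (rule Bochner_Integration.integral_cong)
      (auto simp: test_function_diff_eq_integral[OF \<phi>] G_def P_def)
  also have "\<dots> = - (LINT y|lebesgue. (LINT t|lborel. G y t))" by simp
  also have "(LINT y|lebesgue. (LINT t|lborel. G y t)) = (LINT t|lborel. (LINT y|lebesgue. G y t))"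
    by (rule P.Fubini_integral[OF G_int, symmetric])
  finally show ?thesis by (simp add: inner)
qed

text \<open>
  The cube \<open>[w, w + \<epsilon>]\<close> lies in the ball about \<open>w\<close> of radius \<open>(n + 1) * \<epsilon>\<close>.
\<close>

lemma scaled_bump_le_maximal_fun:
  fixes g :: "real ^ 'n \<Rightarrow> real"
  assumes g: "\<And>y. 0 \<le> g y" and int: "integrable lebesgue (\<lambda>y. g y * bump ((1 / \<epsilon>) *\<^sub>R (y - w)))" and e: "0 < \<epsilon>"
  shows "ennreal (LINT y|lebesgue. g y * bump ((1 / \<epsilon>) *\<^sub>R (y - w)))
    \<le> maximal_fun (\<lambda>y. ennreal (g y)) w * ennreal (unit_ball_vol (real CARD('n)) * (real CARD('n) + 1) ^ CARD('n) * \<epsilon> ^ CARD('n))"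
proof -
  let ?r = "(real CARD('n) + 1) * \<epsilon>"
  have "ennreal (LINT y|lebesgue. g y * bump ((1 / \<epsilon>) *\<^sub>R (y - w)))
      = (\<integral>\<^sup>+y. ennreal (g y * bump ((1 / \<epsilon>) *\<^sub>R (y - w))) \<partial>lebesgue)"
    by (intro nn_integral_eq_integral[symmetric] int AE_I2 mult_nonneg_nonneg g bump_nonneg)
  also have "\<dots> \<le> (\<integral>\<^sup>+y\<in>ball w ?r. ennreal (g y) \<partial>lebesgue)"
  proof (rule nn_integral_mono)
    fix y
    show "ennreal (g y * bump ((1 / \<epsilon>) *\<^sub>R (y - w))) \<le> ennreal (g y) * indicator (ball w ?r) y"
    proof (cases "bump ((1 / \<epsilon>) *\<^sub>R (y - w)) = 0")
      case False
      then have y: "y \<in> cbox w (w + \<epsilon> *\<^sub>R One)" by (rule scaled_bump_nonzero[OF e])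
      have "norm (y - w) \<le> (\<Sum>i\<in>UNIV. \<bar>(y - w) $ i\<bar>)" by (rule norm_le_l1_cart)
      also have "\<dots> \<le> (\<Sum>i\<in>(UNIV::'n set). \<epsilon>)"
      proof (rule sum_mono)
        fix i
        have "w $ i \<le> y $ i \<and> y $ i \<le> w $ i + \<epsilon> * (One :: real ^ 'n) $ i"
          using y unfolding mem_box_cart vector_add_component vector_scaleR_component real_scaleR_def by blast
        then show "\<bar>(y - w) $ i\<bar> \<le> \<epsilon>" unfolding One_nth vector_minus_component by linarith
      qed
      also have "\<dots> < ?r" using e by simp
      finally have "y \<in> ball w ?r" by (simp add: dist_norm norm_minus_commute)
      then show ?thesis
        using mult_left_mono[OF bump_le_1[of "(1 / \<epsilon>) *\<^sub>R (y - w)"] g[of y]] by (simp add: ennreal_leI)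
    qed simp
  qed
  also have "\<dots> \<le> maximal_fun (\<lambda>y. ennreal (g y)) w * emeasure lborel (ball w ?r)"
    using e by (intro nn_integral_ball_le_maximal_fun) auto
  also have "emeasure lborel (ball w ?r) = ennreal (unit_ball_vol (real CARD('n)) * (real CARD('n) + 1) ^ CARD('n) * \<epsilon> ^ CARD('n))"
    using e by (subst emeasure_ball) (auto simp: power_mult_distrib mult.assoc)
  finally show ?thesis .
qed

lemma integral_norm_bound_ennreal':
  fixes f :: "'a \<Rightarrow> real"
  shows "ennreal \<bar>integral\<^sup>L M f\<bar> \<le> (\<integral>\<^sup>+x. ennreal \<bar>f x\<bar> \<partial>M)"
proof (cases "integrable M f")
  case True
  then show ?thesis using integral_norm_bound_ennreal[OF True] by simp
qed (simp add: not_integrable_integral_eq)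

lemma weak_gradient_mollify_diff:
  fixes f :: "real ^ 'n \<Rightarrow> real"
  assumes wg: "has_weak_gradient f v" and fm: "f \<in> borel_measurable lebesgue"
    and vm: "(\<lambda>x. norm (v x)) \<in> borel_measurable lebesgue" and e: "0 < \<epsilon>"
  defines "c \<equiv> real CARD('n) * (unit_ball_vol (real CARD('n)) * (real CARD('n) + 1) ^ CARD('n))"
  shows "ennreal \<bar>mollify f \<epsilon> z - mollify f \<epsilon> x\<bar>
    \<le> ennreal (c * norm (z - x)) * (\<integral>\<^sup>+t\<in>{0..1}. maximal_fun (\<lambda>y. ennreal (norm (v y))) (x + t *\<^sub>R (z - x)) \<partial>lborel)"
proof -
  define a where "a = z - x"
  define \<phi> :: "real ^ 'n \<Rightarrow> real" where "\<phi> y = bump ((1 / \<epsilon>) *\<^sub>R y)" for y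
  have \<phi>: "test_function \<phi>" using test_function_scaled_bump[OF e, of 0] by (simp add: \<phi>_def[abs_def])
  have \<phi>_nn: "0 \<le> \<phi> y" for y by (simp add: \<phi>_def bump_nonneg)
  have v_loc: "locally_integrable v" using wg by (simp add: has_weak_gradient_def)
  have "locally_integrable (\<lambda>y. norm (v y))"
    using v_loc set_integrable_norm by (auto simp: locally_integrable_def)
  note nint = integrable_mult_translated_test_function(1)[OF this vm \<phi>]
  let ?H = "maximal_fun (\<lambda>y. ennreal (norm (v y)))"
  define V where "V = unit_ball_vol (real CARD('n)) * (real CARD('n) + 1) ^ CARD('n)"
  have V: "0 \<le> V" by (simp add: V_def)
  have inner: "ennreal \<bar>\<Sum>i\<in>UNIV. a $ i * (LINT y|lebesgue. v y $ i * \<phi> (y - w))\<bar>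
      \<le> ennreal (c * norm a * \<epsilon> ^ CARD('n)) * ?H w" for w
  proof -
    have 1: "\<bar>LINT y|lebesgue. v y $ i * \<phi> (y - w)\<bar> \<le> (LINT y|lebesgue. norm (v y) * \<phi> (y - w))" for i
    proof -
      have "\<bar>LINT y|lebesgue. v y $ i * \<phi> (y - w)\<bar> \<le> (LINT y|lebesgue. \<bar>v y $ i * \<phi> (y - w)\<bar>)"
        by (rule integral_abs_bound)
      also have "\<dots> \<le> (LINT y|lebesgue. norm (v y) * \<phi> (y - w))"
      proof (rule integral_mono')
        show "\<bar>v y $ i * \<phi> (y - w)\<bar> \<le> norm (v y) * \<phi> (y - w)" for y
          using \<phi>_nn[of "y - w"] component_le_norm_cart[of "v y" i] by (simp add: abs_mult mult_right_mono)
      qed (use nint \<phi>_nn in auto)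
      finally show ?thesis .
    qed
    have "\<bar>\<Sum>i\<in>UNIV. a $ i * (LINT y|lebesgue. v y $ i * \<phi> (y - w))\<bar>
        \<le> (\<Sum>i\<in>UNIV. \<bar>a $ i\<bar> * \<bar>LINT y|lebesgue. v y $ i * \<phi> (y - w)\<bar>)"
      by (rule order_trans[OF sum_abs]) (simp add: abs_mult)
    also have "\<dots> \<le> (\<Sum>i\<in>(UNIV::'n set). norm a * (LINT y|lebesgue. norm (v y) * \<phi> (y - w)))"
      by (intro sum_mono mult_mono component_le_norm_cart 1) auto
    also have "\<dots> = real CARD('n) * norm a * (LINT y|lebesgue. norm (v y) * \<phi> (y - w))" by simp
    finally have "ennreal \<bar>\<Sum>i\<in>UNIV. a $ i * (LINT y|lebesgue. v y $ i * \<phi> (y - w))\<bar>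
        \<le> ennreal (real CARD('n) * norm a) * ennreal (LINT y|lebesgue. norm (v y) * \<phi> (y - w))"
      by (simp add: ennreal_leI flip: ennreal_mult')
    also have "\<dots> \<le> ennreal (real CARD('n) * norm a) * (?H w * ennreal (V * \<epsilon> ^ CARD('n)))"
      using scaled_bump_le_maximal_fun[of "\<lambda>y. norm (v y)" \<epsilon> w] nint[of w] e
      by (intro mult_left_mono) (auto simp: \<phi>_def V_def)
    also have "\<dots> = ennreal (real CARD('n) * norm a) * ennreal (V * \<epsilon> ^ CARD('n)) * ?H w"
      by (simp only: mult_ac)
    also have "ennreal (real CARD('n) * norm a) * ennreal (V * \<epsilon> ^ CARD('n)) = ennreal (c * norm a * \<epsilon> ^ CARD('n))"
      using V e by (simp add: c_def V_def[symmetric] mult_ac flip: ennreal_mult)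
    finally show ?thesis .
  qed
  have "mollify f \<epsilon> z - mollify f \<epsilon> x
    = ((LINT y|lebesgue. f y * \<phi> (y - (x + a))) - (LINT y|lebesgue. f y * \<phi> (y - x))) / \<epsilon> ^ CARD('n)"
    by (simp add: mollify_def \<phi>_def a_def diff_divide_distrib)
  then have "ennreal \<bar>mollify f \<epsilon> z - mollify f \<epsilon> x\<bar>
    = ennreal (1 / \<epsilon> ^ CARD('n)) * ennreal \<bar>(LINT y|lebesgue. f y * \<phi> (y - (x + a))) - (LINT y|lebesgue. f y * \<phi> (y - x))\<bar>"
    using e by (simp flip: ennreal_mult)
  also have "\<dots> \<le> ennreal (1 / \<epsilon> ^ CARD('n)) * (\<integral>\<^sup>+t. ennreal \<bar>(\<Sum>i\<in>UNIV. a $ i * (LINT y|lebesgue. v y $ i * \<phi> (y - (x + t *\<^sub>R a)))) * indicator {0..1} t\<bar> \<partial>lborel)"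
    unfolding weak_gradient_convolution_diff[OF wg fm \<phi>]
    by (intro mult_left_mono integral_norm_bound_ennreal') auto
  also have "\<dots> \<le> ennreal (1 / \<epsilon> ^ CARD('n)) * (\<integral>\<^sup>+t. ennreal (c * norm a * \<epsilon> ^ CARD('n)) * (?H (x + t *\<^sub>R a) * indicator {0..1} t) \<partial>lborel)"
  proof (intro mult_left_mono nn_integral_mono)
    fix t :: real
    show "ennreal \<bar>(\<Sum>i\<in>UNIV. a $ i * (LINT y|lebesgue. v y $ i * \<phi> (y - (x + t *\<^sub>R a)))) * indicator {0..1} t\<bar>
      \<le> ennreal (c * norm a * \<epsilon> ^ CARD('n)) * (?H (x + t *\<^sub>R a) * indicator {0..1} t)"
      using inner[of "x + t *\<^sub>R a"] by (auto simp: indicator_def)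
  qed simp
  also have "\<dots> = ennreal (1 / \<epsilon> ^ CARD('n)) * ennreal (c * norm a * \<epsilon> ^ CARD('n)) * (\<integral>\<^sup>+t\<in>{0..1}. ?H (x + t *\<^sub>R a) \<partial>lborel)"
    by (subst nn_integral_cmult) (auto simp: mult.assoc)
  also have "ennreal (1 / \<epsilon> ^ CARD('n)) * ennreal (c * norm a * \<epsilon> ^ CARD('n)) = ennreal (c * norm a)"
    using e V by (subst ennreal_mult[symmetric]) (auto simp: c_def)
  finally show ?thesis by (simp add: a_def)
qed

lemma ennreal_mult_right_le_cancel:
  fixes a b m :: ennreal
  assumes "a * m \<le> b * m" "0 < m" "m < top"
  shows "a \<le> b"
  using divide_right_mono_ennreal[OF assms(1), of m] assms(2,3)
  by (simp add: ennreal_mult_divide_eq)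

lemma nn_integral_lborel_dilation:
  fixes G :: "'a::euclidean_space \<Rightarrow> ennreal"
  assumes [measurable]: "G \<in> borel_measurable borel" and t: "0 < t"
  shows "(\<integral>\<^sup>+u. G u \<partial>lborel) = ennreal (t ^ DIM('a)) * (\<integral>\<^sup>+z. G (s + t *\<^sub>R z) \<partial>lborel)"
proof -
  have "(\<integral>\<^sup>+u. G u \<partial>lborel)
      = (\<integral>\<^sup>+u. G u \<partial>density (distr lborel borel (\<lambda>z. s + t *\<^sub>R z)) (\<lambda>_. ennreal (\<bar>t\<bar> ^ DIM('a))))"
    using t by (subst lborel_affine[of t s]) auto
  also have "\<dots> = (\<integral>\<^sup>+u. ennreal (\<bar>t\<bar> ^ DIM('a)) * G u \<partial>distr lborel borel (\<lambda>z. s + t *\<^sub>R z))"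
    by (subst nn_integral_density) auto
  also have "\<dots> = (\<integral>\<^sup>+z. ennreal (\<bar>t\<bar> ^ DIM('a)) * G (s + t *\<^sub>R z) \<partial>lborel)"
    by (subst nn_integral_distr) auto
  also have "\<dots> = ennreal (\<bar>t\<bar> ^ DIM('a)) * (\<integral>\<^sup>+z. G (s + t *\<^sub>R z) \<partial>lborel)"
    by (rule nn_integral_cmult) auto
  finally show ?thesis using t by simp
qed

text \<open>
  For fixed \<open>t > 0\<close> the substitution \<open>u = w + t * (z - w)\<close> maps the ball to a ball of radius
  \<open>t * r\<close> that still contains \<open>w\<close>; the Jacobian is exactly the ratio of the two volumes.
\<close>

lemma nn_integral_segment_average:
  fixes H :: "'a::euclidean_space \<Rightarrow> ennreal"
  assumes H [measurable]: "H \<in> borel_measurable borel" and w: "w \<in> ball x r"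
  shows "(\<integral>\<^sup>+z\<in>ball x r. (\<integral>\<^sup>+t\<in>{0..1}. H (w + t *\<^sub>R (z - w)) \<partial>lborel) \<partial>lborel)
    \<le> maximal_fun H w * emeasure lborel (ball x r)"
proof -
  have [measurable]: "ball x r \<in> sets borel" by simp
  have r: "0 < r" using w by (metis ball_eq_empty empty_iff not_less)
  have slice: "(\<integral>\<^sup>+z\<in>ball x r. H (w + t *\<^sub>R (z - w)) \<partial>lborel) \<le> maximal_fun H w * emeasure lborel (ball x r)"
    if t: "0 < t" for t
  proof -
    define c where "c = w + t *\<^sub>R (x - w)"
    have [measurable]: "ball c (t * r) \<in> sets borel" by simp
    have w_in: "w \<in> ball c (t * r)"
      using w t by (simp add: c_def dist_norm norm_minus_commute)
    have scale: "emeasure lborel (ball c (t * r)) = ennreal (t ^ DIM('a)) * emeasure lborel (ball x r)"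
      using r t by (subst (1 2) emeasure_ball) (auto simp: power_mult_distrib mult_ac simp flip: ennreal_mult)
    have "ennreal (t ^ DIM('a)) * (\<integral>\<^sup>+z\<in>ball x r. H (w + t *\<^sub>R (z - w)) \<partial>lborel)
        = ennreal (t ^ DIM('a)) * (\<integral>\<^sup>+z. H ((w - t *\<^sub>R w) + t *\<^sub>R z) * indicator (ball c (t * r)) ((w - t *\<^sub>R w) + t *\<^sub>R z) \<partial>lborel)"
    proof (rule arg_cong[where f="\<lambda>u. ennreal (t ^ DIM('a)) * u"], rule nn_integral_cong)
      fix z
      have e1: "w + t *\<^sub>R (z - w) = (w - t *\<^sub>R w) + t *\<^sub>R z" by (simp add: algebra_simps)
      have "c - ((w - t *\<^sub>R w) + t *\<^sub>R z) = t *\<^sub>R (x - z)" by (simp add: c_def algebra_simps)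
      then have "(w - t *\<^sub>R w) + t *\<^sub>R z \<in> ball c (t * r) \<longleftrightarrow> z \<in> ball x r"
        using t by (simp add: dist_norm)
      then show "H (w + t *\<^sub>R (z - w)) * indicator (ball x r) z
          = H ((w - t *\<^sub>R w) + t *\<^sub>R z) * indicator (ball c (t * r)) ((w - t *\<^sub>R w) + t *\<^sub>R z)"
        unfolding e1 by (simp only: indicator_def)
    qed
    also have "\<dots> = (\<integral>\<^sup>+u. H u * indicator (ball c (t * r)) u \<partial>lborel)"
      by (rule nn_integral_lborel_dilation[OF _ t, symmetric]) measurable
    also have "\<dots> \<le> maximal_fun H w * emeasure lborel (ball c (t * r))"
      using nn_integral_ball_le_maximal_fun[OF w_in, of H] by (simp add: nn_integral_completion)
    also have "\<dots> = ennreal (t ^ DIM('a)) * (maximal_fun H w * emeasure lborel (ball x r))"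
      by (simp only: scale mult.left_commute)
    finally have "(\<integral>\<^sup>+z\<in>ball x r. H (w + t *\<^sub>R (z - w)) \<partial>lborel) * ennreal (t ^ DIM('a))
        \<le> (maximal_fun H w * emeasure lborel (ball x r)) * ennreal (t ^ DIM('a))"
      by (simp only: mult.commute[of "ennreal (t ^ DIM('a))"])
    then show ?thesis by (rule ennreal_mult_right_le_cancel) (use t in auto)
  qed
  have "(\<integral>\<^sup>+z\<in>ball x r. (\<integral>\<^sup>+t\<in>{0..1}. H (w + t *\<^sub>R (z - w)) \<partial>lborel) \<partial>lborel)
      = (\<integral>\<^sup>+z. (\<integral>\<^sup>+t. H (w + t *\<^sub>R (z - w)) * indicator {0..1::real} t * indicator (ball x r) z \<partial>lborel) \<partial>lborel)"
    by (intro nn_integral_cong nn_integral_multc[symmetric]) measurable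
  also have "\<dots> = (\<integral>\<^sup>+t. (\<integral>\<^sup>+z. H (w + t *\<^sub>R (z - w)) * indicator {0..1::real} t * indicator (ball x r) z \<partial>lborel) \<partial>lborel)"
    by (rule lborel_pair.Fubini'[symmetric]) measurable
  also have "\<dots> \<le> (\<integral>\<^sup>+t. maximal_fun H w * emeasure lborel (ball x r) * indicator {0..1::real} t \<partial>lborel)"
  proof (rule nn_integral_mono_AE)
    have "AE t::real in lborel. t \<noteq> 0" by (rule AE_lborel_singleton)
    then show "AE t::real in lborel. (\<integral>\<^sup>+z. H (w + t *\<^sub>R (z - w)) * indicator {0..1} t * indicator (ball x r) z \<partial>lborel)
        \<le> maximal_fun H w * emeasure lborel (ball x r) * indicator {0..1} t"
    proof (rule AE_mp, intro AE_I2 impI)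
      fix t :: real assume "t \<noteq> 0"
      show "(\<integral>\<^sup>+z. H (w + t *\<^sub>R (z - w)) * indicator {0..1} t * indicator (ball x r) z \<partial>lborel)
        \<le> maximal_fun H w * emeasure lborel (ball x r) * indicator {0..1} t"
      proof (cases "t \<in> {0..1}")
        case True
        then show ?thesis using slice[of t] \<open>t \<noteq> 0\<close> by simp
      qed simp
    qed
  qed
  also have "\<dots> = maximal_fun H w * emeasure lborel (ball x r)"
    by (subst nn_integral_cmult_indicator) auto
  finally show ?thesis .
qed

lemma maximal_fun_cong_AE:
  assumes "AE y in lebesgue. F y = G y"
  shows "maximal_fun F = maximal_fun G"
proof -
  have "(\<integral>\<^sup>+y\<in>ball c r. F y \<partial>lebesgue) = (\<integral>\<^sup>+y\<in>ball c r. G y \<partial>lebesgue)" for c r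
    by (rule nn_integral_cong_AE) (use assms in \<open>auto elim: eventually_mono\<close>)
  then show ?thesis unfolding maximal_fun_def by simp
qed

text \<open>
  A third point \<open>z\<close> enters because the values of \<open>M(M\<bar>v\<bar>)\<close> at \<open>x\<close> and \<open>y\<close> control averages of \<open>M\<bar>v\<bar>\<close>
  over balls, not along the segment from \<open>x\<close> to \<open>y\<close>; averaging over \<open>z\<close> turns segments
  into balls.
\<close>

theorem weak_gradient_pointwise_estimate:
  fixes f :: "real ^ 'n \<Rightarrow> real"
  assumes wg: "has_weak_gradient f v" and fm: "f \<in> borel_measurable lebesgue"
    and vm: "(\<lambda>x. norm (v x)) \<in> borel_measurable lebesgue"
  obtains C N where "0 \<le> C" "N \<in> null_sets lebesgue"
    "\<And>x y. x \<notin> N \<Longrightarrow> y \<notin> N \<Longrightarrow> ennreal \<bar>f x - f y\<bar> \<le> ennreal (C * norm (x - y)) *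
       (maximal_fun (maximal_fun (\<lambda>y. ennreal (norm (v y)))) x + maximal_fun (maximal_fun (\<lambda>y. ennreal (norm (v y)))) y)"
proof -
  define H where "H = maximal_fun (\<lambda>y. ennreal (norm (v y)))"
  have Hm [measurable]: "H \<in> borel_measurable borel" by (simp add: H_def)
  define c where "c = real CARD('n) * (unit_ball_vol (real CARD('n)) * (real CARD('n) + 1) ^ CARD('n))"
  have c: "0 \<le> c" by (simp add: c_def)
  define m where "m = bump_mass TYPE('n)"
  have m: "0 < m" by (simp add: m_def bump_mass_pos)
  define J where "J w z = (\<integral>\<^sup>+t\<in>{0..1}. H (w + t *\<^sub>R (z - w)) \<partial>lborel)" for w z
  have Jm [measurable]: "J w \<in> borel_measurable borel" for w unfolding J_def by measurable
  have "set_integrable lebesgue (cbox a b) f" for a b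
    using wg by (simp add: has_weak_gradient_def locally_integrable_def)
  from AE_mollify_tendsto[OF this fm]
  have "AE x in lebesgue. ((\<lambda>\<epsilon>. mollify f \<epsilon> x) \<longlongrightarrow> f x * m) (at_right 0)" by (simp add: m_def)
  then obtain N where N: "N \<in> null_sets lebesgue"
    "{x \<in> space lebesgue. \<not> ((\<lambda>\<epsilon>. mollify f \<epsilon> x) \<longlongrightarrow> f x * m) (at_right 0)} \<subseteq> N"
    unfolding eventually_ae_filter by blast
  have lim: "((\<lambda>\<epsilon>. mollify f \<epsilon> x) \<longlongrightarrow> f x * m) (at_right 0)" if "x \<notin> N" for x
    using N(2) that by auto
  have segment: "ennreal (m * \<bar>f z - f x\<bar>) \<le> ennreal (c * norm (z - x)) * J x z" if "x \<notin> N" "z \<notin> N" for x z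
  proof (rule tendsto_upperbound)
    have "((\<lambda>\<epsilon>. \<bar>mollify f \<epsilon> z - mollify f \<epsilon> x\<bar>) \<longlongrightarrow> \<bar>f z * m - f x * m\<bar>) (at_right 0)"
      by (intro tendsto_intros lim that)
    also have "\<bar>f z * m - f x * m\<bar> = m * \<bar>f z - f x\<bar>"
    proof -
      have "f z * m - f x * m = m * (f z - f x)" by (simp add: algebra_simps)
      then show ?thesis using m by (simp add: abs_mult)
    qed
    finally show "((\<lambda>\<epsilon>. ennreal \<bar>mollify f \<epsilon> z - mollify f \<epsilon> x\<bar>) \<longlongrightarrow> ennreal (m * \<bar>f z - f x\<bar>)) (at_right 0)"
      by (rule tendsto_ennrealI)
    show "eventually (\<lambda>\<epsilon>. ennreal \<bar>mollify f \<epsilon> z - mollify f \<epsilon> x\<bar> \<le> ennreal (c * norm (z - x)) * J x z) (at_right 0)"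
      using weak_gradient_mollify_diff[OF wg fm vm, of _ z x]
      by (auto simp: eventually_at_filter J_def H_def c_def)
  qed simp
  define C where "C = 4 * c / m"
  have main: "ennreal \<bar>f x - f y\<bar> \<le> ennreal (C * norm (x - y)) * (maximal_fun H x + maximal_fun H y)"
    if xy: "x \<notin> N" "y \<notin> N" for x y
  proof (cases "x = y")
    case False
    \<comment> \<open>The factor \<open>2\<close> puts \<open>y\<close> inside the open ball about \<open>x\<close>.\<close>
    define r where "r = 2 * norm (x - y)"
    have r: "0 < r" using False by (simp add: r_def)
    have x_in: "x \<in> ball x r" and y_in: "y \<in> ball x r" using False by (auto simp: r_def dist_norm)
    have [measurable]: "ball x r \<in> sets borel" by simp
    let ?B = "emeasure lborel (ball x r)"
    have "AE z in lebesgue. z \<notin> N" using N(1) by (rule AE_not_in)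
    then have "AE z in lebesgue. ennreal (m * \<bar>f x - f y\<bar>) * indicator (ball x r) z
        \<le> ennreal (2 * c * r) * (J x z * indicator (ball x r) z + J y z * indicator (ball x r) z)"
    proof (rule AE_mp, intro AE_I2 impI)
      fix z assume z: "z \<notin> N"
      show "ennreal (m * \<bar>f x - f y\<bar>) * indicator (ball x r) z
        \<le> ennreal (2 * c * r) * (J x z * indicator (ball x r) z + J y z * indicator (ball x r) z)"
      proof (cases "z \<in> ball x r")
        case True
        then have "norm (z - x) < r" by (simp add: dist_norm norm_minus_commute)
        moreover have "norm (z - y) \<le> norm (z - x) + norm (x - y)"
          using norm_triangle_ineq[of "z - x" "x - y"] by simp
        ultimately have zx: "norm (z - x) \<le> 2 * r" and zy: "norm (z - y) \<le> 2 * r"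
          using r unfolding r_def by linarith+
        have "m * \<bar>f x - f y\<bar> \<le> m * \<bar>f z - f x\<bar> + m * \<bar>f z - f y\<bar>"
          using m by (simp add: abs_triangle_ineq4 flip: distrib_left)
        then have "ennreal (m * \<bar>f x - f y\<bar>) \<le> ennreal (m * \<bar>f z - f x\<bar>) + ennreal (m * \<bar>f z - f y\<bar>)"
          using m by (simp add: ennreal_leI flip: ennreal_plus)
        also have "\<dots> \<le> ennreal (c * norm (z - x)) * J x z + ennreal (c * norm (z - y)) * J y z"
          by (intro add_mono segment xy z)
        also have "\<dots> \<le> ennreal (c * (2 * r)) * J x z + ennreal (c * (2 * r)) * J y z"
          using zx zy c by (intro add_mono mult_right_mono ennreal_leI mult_left_mono) auto
        also have "\<dots> = ennreal (2 * c * r) * (J x z + J y z)"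
        proof -
          have "c * (2 * r) = 2 * c * r" by simp
          then show ?thesis by (simp only: distrib_left)
        qed
        finally show ?thesis using True by simp
      qed simp
    qed
    then have "(\<integral>\<^sup>+z. ennreal (m * \<bar>f x - f y\<bar>) * indicator (ball x r) z \<partial>lebesgue)
        \<le> (\<integral>\<^sup>+z. ennreal (2 * c * r) * (J x z * indicator (ball x r) z + J y z * indicator (ball x r) z) \<partial>lebesgue)"
      by (rule nn_integral_mono_AE)
    then have "ennreal (m * \<bar>f x - f y\<bar>) * ?B
        \<le> ennreal (2 * c * r) * ((\<integral>\<^sup>+z\<in>ball x r. J x z \<partial>lborel) + (\<integral>\<^sup>+z\<in>ball x r. J y z \<partial>lborel))"
      by (simp add: nn_integral_completion nn_integral_cmult nn_integral_add nn_integral_cmult_indicator)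
    also have "\<dots> \<le> ennreal (2 * c * r) * (maximal_fun H x * ?B + maximal_fun H y * ?B)"
      unfolding J_def by (intro mult_left_mono add_mono nn_integral_segment_average Hm x_in y_in) simp
    also have "\<dots> = ennreal (2 * c * r) * (maximal_fun H x + maximal_fun H y) * ?B"
      by (simp add: distrib_left distrib_right mult.assoc)
    finally have "ennreal (m * \<bar>f x - f y\<bar>) \<le> ennreal (2 * c * r) * (maximal_fun H x + maximal_fun H y)"
      by (rule ennreal_mult_right_le_cancel) (use emeasure_ball_finite_pos[OF r, of x] in auto)
    then have "ennreal (1 / m) * ennreal (m * \<bar>f x - f y\<bar>)
        \<le> ennreal (1 / m) * (ennreal (2 * c * r) * (maximal_fun H x + maximal_fun H y))"
      by (rule mult_left_mono) simp
    moreover have "ennreal (1 / m) * ennreal (m * \<bar>f x - f y\<bar>) = ennreal \<bar>f x - f y\<bar>"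
      using m by (subst ennreal_mult[symmetric]) auto
    moreover have "ennreal (1 / m) * ennreal (2 * c * r) = ennreal (C * norm (x - y))"
      using m c r by (subst ennreal_mult[symmetric]) (auto simp: C_def r_def mult_ac)
    ultimately show ?thesis by (simp only: mult.assoc[symmetric])
  qed simp
  show ?thesis
    using main c m N(1) by (intro that[of C N]) (auto simp: C_def H_def)
qed

theorem sobolev_lorentz_imp_pointwise:
  fixes f :: "real ^ 'n \<Rightarrow> real"
  assumes p: "1 < p" and q: "1 \<le> q" and f: "f \<in> sobolev_lorentz_space p q"
  shows "\<exists>g \<in> lorentz_space p q. (\<forall>x. 0 \<le> g x) \<and> (\<exists>S \<in> null_sets lebesgue. \<forall>x y. x \<notin> S \<longrightarrow> y \<notin> S \<longrightarrow>
      \<bar>f x - f y\<bar> \<le> norm (x - y) * (g x + g y))"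
proof -
  obtain v where wg: "has_weak_gradient f v" and v: "(\<lambda>x. norm (v x)) \<in> lorentz_space p q"
    and fL: "f \<in> lorentz_space p q"
    using f by (auto simp: sobolev_lorentz_space_def)
  define H where "H = maximal_fun (\<lambda>y. ennreal (norm (v y)))"
  define h where "h x = enn2real (H x)" for x
  have h: "h \<in> lorentz_space p q" "AE x in lebesgue. H x < top"
    using lorentz_space_maximal_fun[OF p q v] by (simp_all add: H_def h_def[abs_def])
  have MH: "maximal_fun (\<lambda>y. ennreal \<bar>h y\<bar>) = maximal_fun H"
    by (rule maximal_fun_cong_AE) (use h(2) in \<open>auto elim: eventually_mono simp: h_def\<close>)
  have MH': "(\<lambda>x. enn2real (maximal_fun H x)) \<in> lorentz_space p q" "AE x in lebesgue. maximal_fun H x < top"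
    using lorentz_space_maximal_fun[OF p q h(1)] by (simp_all add: MH)
  have fm: "f \<in> borel_measurable lebesgue" and vm: "(\<lambda>x. norm (v x)) \<in> borel_measurable lebesgue"
    using fL v by (auto simp: lorentz_space_def)
  obtain C N where CN: "0 \<le> C" "N \<in> null_sets lebesgue"
    "\<And>x y. x \<notin> N \<Longrightarrow> y \<notin> N \<Longrightarrow> ennreal \<bar>f x - f y\<bar> \<le> ennreal (C * norm (x - y)) * (maximal_fun H x + maximal_fun H y)"
    unfolding H_def by (rule weak_gradient_pointwise_estimate[OF wg fm vm]) blast
  obtain N' where N': "N' \<in> null_sets lebesgue" "{x \<in> space lebesgue. \<not> maximal_fun H x < top} \<subseteq> N'"
    using MH'(2) unfolding eventually_ae_filter by blast
  define g where "g x = C * enn2real (maximal_fun H x)" for x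
  have g0: "0 \<le> g x" for x using CN(1) by (simp add: g_def)
  have gL: "g \<in> lorentz_space p q"
  proof (rule lorentz_space_mono[OF p q MH'(1) _ CN(1)])
    have [measurable]: "(\<lambda>x. enn2real (maximal_fun H x)) \<in> borel_measurable lebesgue"
      using MH'(1) by (simp add: lorentz_space_def)
    show "g \<in> borel_measurable lebesgue" unfolding g_def by measurable
  qed (use CN(1) in \<open>simp add: g_def abs_mult\<close>)
  have "\<bar>f x - f y\<bar> \<le> norm (x - y) * (g x + g y)" if "x \<notin> N \<union> N'" "y \<notin> N \<union> N'" for x y
  proof -
    have "maximal_fun H x < top" "maximal_fun H y < top" using that N'(2) by auto
    then have fin: "maximal_fun H x + maximal_fun H y
        = ennreal (enn2real (maximal_fun H x) + enn2real (maximal_fun H y))"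
      by (simp add: ennreal_plus)
    have "ennreal \<bar>f x - f y\<bar> \<le> ennreal (C * norm (x - y)) * (maximal_fun H x + maximal_fun H y)"
      using that by (intro CN(3)) auto
    also have "\<dots> = ennreal (C * norm (x - y)) * ennreal (enn2real (maximal_fun H x) + enn2real (maximal_fun H y))"
      by (simp only: fin)
    also have "\<dots> = ennreal (norm (x - y) * (g x + g y))"
      using CN(1) by (subst ennreal_mult[symmetric]) (auto simp: g_def algebra_simps)
    finally show ?thesis using g0 by (simp add: ennreal_le_iff)
  qed
  then show ?thesis using gL g0 CN(2) N'(1) by (intro bexI[of _ g] conjI bexI[of _ "N \<union> N'"]) auto
qed

section \<open>Representation of functionals bounded in the first mean\<close>

text \<open>
  A functional that is bounded in \<open>L\<^sup>1\<close> of a finite measure is bounded in \<open>L\<^sup>2\<close>, so that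
  \<open>J a = \<integral>a\<^sup>2 / 2 - \<Lambda> a\<close> is bounded below on \<open>T\<close>. A minimising sequence is a Cauchy sequence by the
  parallelogram law, and its limit represents \<open>\<Lambda>\<close> because the derivative of \<open>J\<close> along it tends to \<open>0\<close> in every
  direction. The limit is taken only in \<open>L\<^sup>1\<close>, which suffices as the members of \<open>T\<close> are
  bounded.
\<close>

lemma (in finite_measure) riesz_representation_bounded_functions:
  fixes T :: "('a \<Rightarrow> real) set" and \<Lambda> :: "('a \<Rightarrow> real) \<Rightarrow> real"
  assumes meas: "\<And>a. a \<in> T \<Longrightarrow> a \<in> borel_measurable M"
    and bnd: "\<And>a. a \<in> T \<Longrightarrow> \<exists>B. \<forall>x. \<bar>a x\<bar> \<le> B"
    and ne: "T \<noteq> {}"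
    and add: "\<And>a b. a \<in> T \<Longrightarrow> b \<in> T \<Longrightarrow> (\<lambda>x. a x + b x) \<in> T"
    and scale: "\<And>c a. a \<in> T \<Longrightarrow> (\<lambda>x. c * a x) \<in> T"
    and \<Lambda>_add: "\<And>a b. a \<in> T \<Longrightarrow> b \<in> T \<Longrightarrow> \<Lambda> (\<lambda>x. a x + b x) = \<Lambda> a + \<Lambda> b"
    and \<Lambda>_scale: "\<And>c a. a \<in> T \<Longrightarrow> \<Lambda> (\<lambda>x. c * a x) = c * \<Lambda> a"
    and \<Lambda>_le: "\<And>a. a \<in> T \<Longrightarrow> \<bar>\<Lambda> a\<bar> \<le> C * (LINT x|M. \<bar>a x\<bar>)"
  shows "\<exists>W. integrable M W \<and> (\<forall>a\<in>T. \<Lambda> a = (LINT x|M. W x * a x))"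
proof -
  have int: "integrable M a" if a: "a \<in> T" for a
  proof -
    obtain B where "\<forall>x. \<bar>a x\<bar> \<le> B" using bnd[OF a] by blast
    then show ?thesis by (intro integrable_const_bound[of _ B] meas a) auto
  qed
  have int2: "integrable M (\<lambda>x. a x * b x)" if ab: "a \<in> T" "b \<in> T" for a b
  proof -
    obtain B where B: "\<forall>x. \<bar>a x\<bar> \<le> B" using bnd[OF ab(1)] by blast
    obtain B' where B': "\<forall>x. \<bar>b x\<bar> \<le> B'" using bnd[OF ab(2)] by blast
    have "\<bar>a x * b x\<bar> \<le> B * B'" for x
      unfolding abs_mult using B B' by (intro mult_mono) (auto intro: order_trans[OF abs_ge_zero])
    then show ?thesis by (intro integrable_const_bound[of _ "B * B'"] borel_measurable_times meas ab) auto
  qed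
  define J where "J a = (LINT x|M. a x * a x) / 2 - \<Lambda> a" for a
  define m where "m = measure M (space M)"
  have m: "0 \<le> m" by (simp add: m_def)
  have J_ge: "- (C\<^sup>2 * m / 2) \<le> J a" if a: "a \<in> T" for a
  proof -
    have "\<Lambda> a \<le> C * (LINT x|M. \<bar>a x\<bar>)" using \<Lambda>_le[OF a] by linarith
    also have "\<dots> = (LINT x|M. C * \<bar>a x\<bar>)" by simp
    also have "\<dots> \<le> (LINT x|M. a x * a x / 2 + C\<^sup>2 / 2)"
    proof (rule integral_mono)
      show "C * \<bar>a x\<bar> \<le> a x * a x / 2 + C\<^sup>2 / 2" for x
        using zero_le_power2[of "\<bar>a x\<bar> - C"] by (simp add: power2_eq_square algebra_simps)
    qed (use int[OF a] int2[OF a a] in auto)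
    also have "\<dots> = (LINT x|M. a x * a x) / 2 + C\<^sup>2 * m / 2"
      using int2[OF a a] by (simp add: m_def)
    finally show ?thesis by (simp add: J_def)
  qed
  define I where "I = Inf (J ` T)"
  have bdd: "bdd_below (J ` T)" using J_ge by (intro bdd_belowI2[of T "- (C\<^sup>2 * m / 2)"]) auto
  have I_le: "I \<le> J a" if "a \<in> T" for a unfolding I_def using bdd that by (intro cInf_lower) auto
  \<comment> \<open>The minimising sequence approaches the infimum up to \<open>\<delta>\<^sup>2\<close>, so that
    consecutive members differ by order \<open>\<delta>\<close> in the mean and the differences are summable.\<close>
  define \<delta> where "\<delta> k = (1/4::real) ^ k" for k
  have \<delta>: "0 < \<delta> k" for k by (simp add: \<delta>_def)
  have "\<exists>a\<in>T. J a < I + \<delta> k * \<delta> k" for k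
  proof -
    have "I < I + \<delta> k * \<delta> k" using \<delta>[of k] by simp
    then show ?thesis unfolding I_def using cInf_lessD[of "J ` T"] ne by fastforce
  qed
  then obtain a where a: "\<And>k. a k \<in> T" "\<And>k. J (a k) < I + \<delta> k * \<delta> k" by metis
  have J_line: "J (\<lambda>x. b x + s * d x) = J b + s * ((LINT x|M. b x * d x) - \<Lambda> d) + s\<^sup>2 * (LINT x|M. d x * d x) / 2"
    if bd: "b \<in> T" "d \<in> T" for b d s
  proof -
    have "(LINT x|M. (b x + s * d x) * (b x + s * d x))
        = (LINT x|M. b x * b x + 2 * s * (b x * d x) + s\<^sup>2 * (d x * d x))"
      by (rule Bochner_Integration.integral_cong) (auto simp: power2_eq_square algebra_simps)
    also have "\<dots> = (LINT x|M. b x * b x) + 2 * s * (LINT x|M. b x * d x) + s\<^sup>2 * (LINT x|M. d x * d x)"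
      using int2 bd by simp
    finally show ?thesis
      using bd by (simp add: J_def \<Lambda>_add \<Lambda>_scale scale algebra_simps)
  qed
  define D where "D k x = a (Suc k) x - a k x" for k x
  have D_T: "D k \<in> T" for k
    using add[OF a(1)[of "Suc k"] scale[OF a(1)[of k], of "-1"]] by (simp add: D_def[abs_def])
  have a_Suc: "a (Suc k) = (\<lambda>x. a k x + 1 * D k x)" for k by (simp add: D_def)
  have D2: "(LINT x|M. D k x * D k x) \<le> 8 * (\<delta> k * \<delta> k)" for k
  proof -
    let ?q = "LINT x|M. D k x * D k x" and ?l = "(LINT x|M. a k x * D k x) - \<Lambda> (D k)"
    have 1: "J (a (Suc k)) = J (a k) + ?l + ?q / 2"
      using J_line[OF a(1)[of k] D_T[of k], of 1] by (subst a_Suc) simp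
    have "I \<le> J (\<lambda>x. a k x + (1/2) * D k x)" by (intro I_le add scale a(1) D_T)
    also have "\<dots> = J (a k) + (1/2) * ?l + ?q / 8"
      using J_line[OF a(1)[of k] D_T[of k], of "1/2"] by (simp add: power2_eq_square)
    finally have 2: "I \<le> J (a k) + (1/2) * ?l + ?q / 8" .
    have "\<delta> (Suc k) * \<delta> (Suc k) \<le> \<delta> k * \<delta> k"
      by (intro mult_mono) (auto simp: \<delta>_def)
    \<comment> \<open>The parallelogram law: the midpoint value is the mean of the end point values
      less an eighth of the squared distance.\<close>
    moreover have "q \<le> 8 * e" if "A' = A + l + q / 2" "i \<le> A + (1/2) * l + q / 8" "A < i + e" "A' < i + e'" "e' \<le> e"
      for A A' l q i e e' :: real
      using that by linarith
    ultimately show ?thesis using 1 2 a(2)[of k] a(2)[of "Suc k"] by blast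
  qed
  have D1: "(LINT x|M. \<bar>D k x\<bar>) \<le> \<delta> k * (4 + m / 2)" for k
  proof -
    have "(LINT x|M. \<bar>D k x\<bar>) \<le> (LINT x|M. (D k x * D k x) / (2 * \<delta> k) + \<delta> k / 2)"
    proof (rule integral_mono)
      fix x
      have "0 \<le> (\<bar>D k x\<bar> - \<delta> k)\<^sup>2" by simp
      then have "2 * \<delta> k * \<bar>D k x\<bar> \<le> D k x * D k x + \<delta> k * \<delta> k"
        by (simp add: power2_eq_square algebra_simps)
      then show "\<bar>D k x\<bar> \<le> D k x * D k x / (2 * \<delta> k) + \<delta> k / 2"
        using \<delta>[of k] by (simp add: field_simps)
    qed (use int[OF D_T] int2[OF D_T D_T] in auto)
    also have "\<dots> = (LINT x|M. D k x * D k x) / (2 * \<delta> k) + \<delta> k * m / 2"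
      using int2[OF D_T D_T] by (simp add: m_def)
    also have "\<dots> \<le> 8 * (\<delta> k * \<delta> k) / (2 * \<delta> k) + \<delta> k * m / 2"
      using \<delta>[of k] D2[of k] by (intro add_right_mono divide_right_mono) auto
    also have "\<dots> = \<delta> k * (4 + m / 2)"
      using \<delta>[of k] by (simp add: field_simps)
    finally show ?thesis .
  qed
  have sum_D: "summable (\<lambda>k. LINT x|M. norm (D k x))"
  proof (rule summable_comparison_test')
    show "summable (\<lambda>k. \<delta> k * (4 + m / 2))"
      unfolding \<delta>_def by (intro summable_mult2 summable_geometric) simp
    show "norm (LINT x|M. norm (D k x)) \<le> \<delta> k * (4 + m / 2)" for k
      using D1[of k] by (simp add: integral_nonneg_AE)
  qed
  have AE_D: "AE x in M. summable (\<lambda>k. norm (D k x))"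
  proof -
    have "(\<integral>\<^sup>+x. (\<Sum>k. ennreal (norm (D k x))) \<partial>M) = (\<Sum>k. \<integral>\<^sup>+x. ennreal (norm (D k x)) \<partial>M)"
      using meas[OF D_T] by (intro nn_integral_suminf) measurable
    also have "\<dots> = (\<Sum>k. ennreal (LINT x|M. norm (D k x)))"
      using int[OF D_T] by (intro suminf_cong nn_integral_eq_integral integrable_norm) auto
    also have "\<dots> < top"
      using sum_D by (simp add: ennreal_suminf_neq_top integral_nonneg_AE less_top[symmetric])
    finally have "(\<integral>\<^sup>+x. (\<Sum>k. ennreal (norm (D k x))) \<partial>M) \<noteq> \<infinity>" by simp
    then have "AE x in M. (\<Sum>k. ennreal (norm (D k x))) \<noteq> \<infinity>"
      using meas[OF D_T] by (intro nn_integral_noteq_infinite) measurable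
    then show ?thesis
      by eventually_elim (auto intro: summable_suminf_not_top)
  qed
  define W where "W x = a 0 x + (\<Sum>k. D k x)" for x
  define G where "G x = \<bar>a 0 x\<bar> + (\<Sum>k. norm (D k x))" for x
  have W_int: "integrable M W"
    unfolding W_def by (intro Bochner_Integration.integrable_add int a(1) integrable_suminf AE_D sum_D D_T)
  have G_int: "integrable M G"
    unfolding G_def using AE_D sum_D
    by (intro Bochner_Integration.integrable_add integrable_abs int a(1) integrable_suminf integrable_norm D_T) auto
  have tele: "a n x = a 0 x + (\<Sum>k<n. D k x)" for n x
    by (induction n) (auto simp: D_def)
  have rep: "\<Lambda> b = (LINT x|M. W x * b x)" if b: "b \<in> T" for b
  proof -
    obtain B where B: "\<And>x. \<bar>b x\<bar> \<le> B" using bnd[OF b] by blast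
    have lim: "(\<lambda>n. LINT x|M. a n x * b x) \<longlonglongrightarrow> (LINT x|M. W x * b x)"
    proof (rule integral_dominated_convergence)
      show "integrable M (\<lambda>x. B * G x)" using G_int by simp
      show "AE x in M. (\<lambda>n. a n x * b x) \<longlonglongrightarrow> W x * b x"
        using AE_D
      proof eventually_elim
        case (elim x)
        then have "(\<lambda>n. \<Sum>k<n. D k x) \<longlonglongrightarrow> (\<Sum>k. D k x)"
          by (rule summable_LIMSEQ[OF summable_norm_cancel])
        then have "(\<lambda>n. (a 0 x + (\<Sum>k<n. D k x)) * b x) \<longlonglongrightarrow> W x * b x"
          unfolding W_def by (intro tendsto_intros)
        then show ?case by (simp only: tele[symmetric])
      qed
      show "AE x in M. norm (a n x * b x) \<le> B * G x" for n
        using AE_D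
      proof eventually_elim
        case (elim x)
        have "\<bar>\<Sum>k<n. D k x\<bar> \<le> (\<Sum>k<n. norm (D k x))"
          using sum_abs[of "\<lambda>k. D k x" "{..<n}"] by simp
        also have "\<dots> \<le> (\<Sum>k. norm (D k x))"
          using elim by (intro sum_le_suminf) auto
        finally have "\<bar>a n x\<bar> \<le> G x" unfolding tele[of n x] G_def by linarith
        then show ?case using B[of x] mult_mono[of "\<bar>a n x\<bar>" "G x" "\<bar>b x\<bar>" B]
          by (simp add: abs_mult mult.commute)
      qed
    qed (use W_int int a(1) b meas in auto)
    define r where "r = (LINT x|M. W x * b x) - \<Lambda> b"
    define \<beta> where "\<beta> = (LINT x|M. b x * b x)"
    have \<beta>: "0 \<le> \<beta>" unfolding \<beta>_def by (intro integral_nonneg_AE AE_I2) simp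
    have quad: "0 \<le> s * r + s\<^sup>2 * \<beta> / 2" for s
    proof (rule LIMSEQ_le_const)
      have "(\<lambda>k. \<delta> k) \<longlonglongrightarrow> 0" unfolding \<delta>_def by (rule LIMSEQ_realpow_zero) auto
      then have "(\<lambda>k. \<delta> k * \<delta> k + s * ((LINT x|M. a k x * b x) - \<Lambda> b) + s\<^sup>2 * \<beta> / 2)
          \<longlonglongrightarrow> 0 * 0 + s * r + s\<^sup>2 * \<beta> / 2"
        unfolding r_def by (intro tendsto_intros lim)
      then show "(\<lambda>k. \<delta> k * \<delta> k + s * ((LINT x|M. a k x * b x) - \<Lambda> b) + s\<^sup>2 * \<beta> / 2)
          \<longlonglongrightarrow> s * r + s\<^sup>2 * \<beta> / 2" by simp
      have "0 \<le> \<delta> k * \<delta> k + s * ((LINT x|M. a k x * b x) - \<Lambda> b) + s\<^sup>2 * \<beta> / 2" for k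
        using I_le[OF add[OF a(1)[of k] scale[OF b, of s]]] a(2)[of k] J_line[OF a(1)[of k] b, of s]
        by (simp add: \<beta>_def)
      then show "\<exists>N. \<forall>k\<ge>N. 0 \<le> \<delta> k * \<delta> k + s * ((LINT x|M. a k x * b x) - \<Lambda> b) + s\<^sup>2 * \<beta> / 2"
        by blast
    qed
    have "r = 0"
    proof -
      \<comment> \<open>The choice \<open>s = - r / (\<beta> + 1)\<close> makes the quadratic expression negative unless \<open>r = 0\<close>.\<close>
      have "0 \<le> - (r / (\<beta> + 1)) * r + (- (r / (\<beta> + 1)))\<^sup>2 * \<beta> / 2" by (rule quad)
      also have "\<dots> = - (r\<^sup>2 * (\<beta> + 2)) / (2 * (\<beta> + 1)\<^sup>2)"
        using \<beta> by (simp add: power2_eq_square divide_simps) (simp add: algebra_simps)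
      finally have q: "0 \<le> - (r\<^sup>2 * (\<beta> + 2)) / (2 * (\<beta> + 1)\<^sup>2)" .
      have P: "0 < 2 * (\<beta> + 1)\<^sup>2" using \<beta> by simp
      have "0 \<le> - (r\<^sup>2 * (\<beta> + 2)) / (2 * (\<beta> + 1)\<^sup>2) * (2 * (\<beta> + 1)\<^sup>2)"
        by (rule mult_nonneg_nonneg[OF q less_imp_le[OF P]])
      also have "\<dots> = - (r\<^sup>2 * (\<beta> + 2))"
        using P by (intro nonzero_eq_divide_eq[THEN iffD1, OF _ refl]) linarith
      finally have "r\<^sup>2 * (\<beta> + 2) \<le> 0" by simp
      then show ?thesis using \<beta> by (simp add: mult_le_0_iff)
    qed
    then show ?thesis by (simp add: r_def)
  qed
  show ?thesis using W_int rep by blast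
qed

section \<open>The pointwise inequality implies a weak gradient\<close>

lemma lebesgue_translation:
  fixes w :: "'a::euclidean_space"
  shows "(\<lambda>x. w + x) \<in> lebesgue \<rightarrow>\<^sub>M lebesgue" "distr lebesgue lebesgue (\<lambda>x. w + x) = lebesgue"
proof -
  have T: "(\<lambda>x. w + (\<Sum>j\<in>Basis. (1 * (x \<bullet> j)) *\<^sub>R j)) = (\<lambda>x. w + x)"
    by (simp add: euclidean_representation)
  show "(\<lambda>x. w + x) \<in> lebesgue \<rightarrow>\<^sub>M lebesgue"
    using lebesgue_affine_measurable[of "\<lambda>_. 1" w] unfolding T by simp
  have "lebesgue = density (distr lebesgue lebesgue (\<lambda>x. w + x)) (\<lambda>_. (\<Prod>j\<in>(Basis::'a set). \<bar>1::real\<bar>))"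
    using lebesgue_affine_euclidean[of "\<lambda>_. 1" w] unfolding T by simp
  then show "distr lebesgue lebesgue (\<lambda>x. w + x) = lebesgue" by (simp add: density_1)
qed

lemma
  fixes F :: "'a::euclidean_space \<Rightarrow> real"
  assumes F: "F \<in> borel_measurable lebesgue"
  shows lebesgue_integral_translation: "(LINT x|lebesgue. F (w + x)) = (LINT x|lebesgue. F x)"
    and lebesgue_integrable_translation: "integrable lebesgue F \<Longrightarrow> integrable lebesgue (\<lambda>x. F (w + x))"
proof -
  have "(LINT x|lebesgue. F x) = (LINT x|distr lebesgue lebesgue (\<lambda>x. w + x). F x)"
    by (simp add: lebesgue_translation(2))
  also have "\<dots> = (LINT x|lebesgue. F (w + x))"
    by (rule integral_distr[OF lebesgue_translation(1) F])
  finally show "(LINT x|lebesgue. F (w + x)) = (LINT x|lebesgue. F x)" ..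
  assume "integrable lebesgue F"
  then have "integrable (distr lebesgue lebesgue (\<lambda>x. w + x)) F" by (simp add: lebesgue_translation(2))
  then show "integrable lebesgue (\<lambda>x. F (w + x))"
    using integrable_distr_eq[OF lebesgue_translation(1)[of w] F] by simp
qed

lemma AE_lebesgue_translation:
  fixes w :: "'a::euclidean_space"
  assumes "AE x in lebesgue. P x"
  shows "AE x in lebesgue. P (w + x)"
proof -
  have "AE x in distr lebesgue lebesgue (\<lambda>x. w + x). P x"
    unfolding lebesgue_translation(2) by (rule assms)
  then show ?thesis by (rule AE_distrD[OF lebesgue_translation(1)])
qed

lemma DERIV_test_function_axis:
  fixes \<phi> :: "real ^ 'n \<Rightarrow> real"
  assumes \<phi>: "test_function \<phi>"
  shows "((\<lambda>t. \<phi> (x - t *\<^sub>R axis i 1)) has_real_derivative - partial_deriv i \<phi> (x - t *\<^sub>R axis i 1)) (at t)"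
proof -
  have 1: "((\<lambda>t. x - t *\<^sub>R axis i 1) has_derivative (\<lambda>h. - (h *\<^sub>R axis i (1::real)))) (at t)"
    by (auto intro!: derivative_eq_intros)
  have "((\<lambda>t. \<phi> (x - t *\<^sub>R axis i 1)) has_derivative
      (\<lambda>h. \<Sum>j\<in>UNIV. (- (h *\<^sub>R axis i (1::real))) $ j * partial_deriv j \<phi> (x - t *\<^sub>R axis i 1))) (at t)"
    by (rule has_derivative_compose[OF 1]) (rule test_function_has_derivative[OF \<phi>])
  moreover have "(\<Sum>j\<in>UNIV. (- (h *\<^sub>R axis i (1::real))) $ j * partial_deriv j \<phi> (x - t *\<^sub>R axis i 1))
      = - partial_deriv i \<phi> (x - t *\<^sub>R axis i 1) * h" for h
  proof -
    have "(\<Sum>j\<in>UNIV. (- (h *\<^sub>R axis i (1::real))) $ j * partial_deriv j \<phi> (x - t *\<^sub>R axis i 1))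
      = (\<Sum>j\<in>UNIV. if j = i then - h * partial_deriv i \<phi> (x - t *\<^sub>R axis i 1) else 0)"
      by (intro sum.cong) (auto simp: axis_def)
    then show ?thesis by (simp add: mult.commute)
  qed
  ultimately show ?thesis unfolding has_field_derivative_def by (simp only:)
qed

text \<open>
  The partial derivative of \<open>\<phi>\<close> is the limit of difference quotients. A translation moves each of them
  to \<open>f\<close>, where the hypothesis bounds it by \<open>g x + g (x + h)\<close>; moving the translation of \<open>g\<close> back
  to \<open>\<phi>\<close> reduces the remaining limit to the continuity of \<open>\<phi>\<close>.
\<close>

theorem distributional_derivative_bound:
  fixes f g :: "real ^ 'n \<Rightarrow> real"
  assumes f: "locally_integrable f" and fm: "f \<in> borel_measurable lebesgue"
    and g: "locally_integrable g" and gm: "g \<in> borel_measurable lebesgue"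
    and S: "S \<in> null_sets lebesgue"
    and le: "\<And>x y. x \<notin> S \<Longrightarrow> y \<notin> S \<Longrightarrow> \<bar>f x - f y\<bar> \<le> norm (x - y) * (g x + g y)"
    and \<phi>: "test_function \<phi>"
  shows "\<bar>LINT x|lebesgue. f x * partial_deriv i \<phi> x\<bar> \<le> 2 * (LINT x|lebesgue. g x * \<bar>\<phi> x\<bar>)"
proof -
  obtain R B where RB: "0 \<le> R" "0 \<le> B" "\<And>y. \<bar>\<phi> y\<bar> \<le> B" "\<And>y i. \<bar>partial_deriv i \<phi> y\<bar> \<le> B"
    "\<And>y. \<phi> y \<noteq> 0 \<Longrightarrow> norm y \<le> R" "\<And>y i. partial_deriv i \<phi> y \<noteq> 0 \<Longrightarrow> norm y \<le> R"
    using test_function_bounds[OF \<phi>] by metis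
  note [measurable] = borel_measurable_test_function[OF \<phi>]
  define e where "e = (axis i 1 :: real ^ 'n)"
  have e: "norm e = 1" by (simp add: e_def norm_axis_1)
  define h where "h k = inverse (real (Suc k))" for k
  have h: "0 < h k" "h k \<le> 1" for k by (auto simp: h_def inverse_eq_divide)
  have h_lim: "h \<longlonglongrightarrow> 0" unfolding h_def by (rule LIMSEQ_inverse_real_of_nat)
  define K where "K = cball (0 :: real ^ 'n) (R + 1)"
  have far: "x \<in> K" if "\<phi> (x - h k *\<^sub>R e) \<noteq> 0" for x k
  proof -
    have "norm x \<le> norm (x - h k *\<^sub>R e) + norm (h k *\<^sub>R e)"
      using norm_triangle_ineq[of "x - h k *\<^sub>R e" "h k *\<^sub>R e"] by simp
    also have "\<dots> \<le> R + 1" using RB(5)[OF that] h[of k] e by simp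
    finally show ?thesis by (simp add: K_def)
  qed
  have near: "x \<in> K" if "\<phi> x \<noteq> 0" for x using RB(5)[OF that] by (simp add: K_def)
  define q where "q k x = (\<phi> x - \<phi> (x - h k *\<^sub>R e)) / h k" for k x
  have q_bound: "\<bar>q k x\<bar> \<le> B * indicator K x" for k x
  proof (cases "x \<in> K")
    case True
    obtain z where "\<phi> (x - h k *\<^sub>R e) - \<phi> (x - 0 *\<^sub>R e) = (h k - 0) * - partial_deriv i \<phi> (x - z *\<^sub>R e)"
      using MVT2[of 0 "h k" "\<lambda>t. \<phi> (x - t *\<^sub>R e)" "\<lambda>t. - partial_deriv i \<phi> (x - t *\<^sub>R e)"]
        DERIV_test_function_axis[OF \<phi>] h[of k] unfolding e_def by blast
    then have "q k x = partial_deriv i \<phi> (x - z *\<^sub>R e)" using h[of k] by (simp add: q_def field_simps)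
    then show ?thesis using True RB(4) by simp
  next
    case False
    then have "\<phi> x = 0" "\<phi> (x - h k *\<^sub>R e) = 0" using far[of x k] near[of x] by auto
    then have "q k x = 0" by (simp add: q_def)
    then show ?thesis using False by simp
  qed
  have q_lim: "(\<lambda>k. q k x) \<longlonglongrightarrow> partial_deriv i \<phi> x" for x
  proof -
    have "((\<lambda>t. (\<phi> (x - (0 + t) *\<^sub>R e) - \<phi> (x - 0 *\<^sub>R e)) / t) \<longlongrightarrow> - partial_deriv i \<phi> x) (at 0)"
      using DERIV_test_function_axis[OF \<phi>, of x i 0] by (simp add: DERIV_def e_def)
    moreover have "filterlim h (at 0) sequentially"
      using h_lim h by (auto simp: filterlim_at eventually_sequentially) (metis less_irrefl)
    ultimately have "(\<lambda>k. (\<phi> (x - (0 + h k) *\<^sub>R e) - \<phi> (x - 0 *\<^sub>R e)) / h k) \<longlonglongrightarrow> - partial_deriv i \<phi> x"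
      by (rule filterlim_compose)
    from tendsto_minus[OF this] show ?thesis by (simp add: q_def minus_divide_left)
  qed
  have fK: "integrable lebesgue (\<lambda>x. \<bar>indicator K x * f x\<bar>)" and gK: "integrable lebesgue (\<lambda>x. \<bar>indicator K x * g x\<bar>)"
    using f g by (simp_all add: locally_integrable_def set_integrable_def K_def)
  have trans_m: "(\<lambda>x. \<phi> (x - w)) \<in> borel_measurable lebesgue" for w
    by (rule measurable_completion) measurable
  have d_m: "partial_deriv i \<phi> \<in> borel_measurable lebesgue" and \<phi>_m: "\<phi> \<in> borel_measurable lebesgue"
    by (rule measurable_completion, measurable)+
  note fm [measurable] gm [measurable] trans_m [measurable] d_m [measurable] \<phi>_m [measurable]
  have q_m [measurable]: "q k \<in> borel_measurable lebesgue" for k unfolding q_def by measurable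
  have lim1: "(\<lambda>k. LINT x|lebesgue. f x * q k x) \<longlonglongrightarrow> (LINT x|lebesgue. f x * partial_deriv i \<phi> x)"
  proof (rule integral_dominated_convergence)
    show "integrable lebesgue (\<lambda>x. B * \<bar>indicator K x * f x\<bar>)" using fK by simp
    show "AE x in lebesgue. (\<lambda>k. f x * q k x) \<longlonglongrightarrow> f x * partial_deriv i \<phi> x"
      by (intro AE_I2 tendsto_mult tendsto_const q_lim)
    show "AE x in lebesgue. norm (f x * q k x) \<le> B * \<bar>indicator K x * f x\<bar>" for k
    proof (rule AE_I2)
      fix x
      show "norm (f x * q k x) \<le> B * \<bar>indicator K x * f x\<bar>"
        using mult_left_mono[OF q_bound[of k x], of "\<bar>f x\<bar>"] by (simp add: abs_mult mult_ac)
    qed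
  qed measurable
  have int_g: "integrable lebesgue (\<lambda>x. g x * \<bar>\<phi> (x - w)\<bar>)" for w
    using integrable_abs[OF integrable_mult_translated_test_function(1)[OF g gm \<phi>, of w]]
  proof (rule Bochner_Integration.integrable_bound)
    show "AE x in lebesgue. norm (g x * \<bar>\<phi> (x - w)\<bar>) \<le> norm \<bar>g x * \<phi> (x - w)\<bar>"
      by (simp add: abs_mult)
  qed measurable
  note int_f = integrable_mult_translated_test_function(1)[OF f fm \<phi>]
  have bound: "\<bar>LINT x|lebesgue. f x * q k x\<bar>
      \<le> (LINT x|lebesgue. g x * \<bar>\<phi> x\<bar>) + (LINT x|lebesgue. g x * \<bar>\<phi> (x - h k *\<^sub>R e)\<bar>)" for k
  proof -
    let ?w = "h k *\<^sub>R e"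
    have fs: "integrable lebesgue (\<lambda>x. f (?w + x) * \<phi> x)"
      "(LINT x|lebesgue. f (?w + x) * \<phi> x) = (LINT x|lebesgue. f x * \<phi> (x - ?w))"
      using lebesgue_integrable_translation[of "\<lambda>x. f x * \<phi> (x - ?w)" ?w]
        lebesgue_integral_translation[of "\<lambda>x. f x * \<phi> (x - ?w)" ?w] int_f[of ?w] by simp_all
    have gs: "integrable lebesgue (\<lambda>x. g (?w + x) * \<bar>\<phi> x\<bar>)"
      "(LINT x|lebesgue. g (?w + x) * \<bar>\<phi> x\<bar>) = (LINT x|lebesgue. g x * \<bar>\<phi> (x - ?w)\<bar>)"
      using lebesgue_integrable_translation[of "\<lambda>x. g x * \<bar>\<phi> (x - ?w)\<bar>" ?w]
        lebesgue_integral_translation[of "\<lambda>x. g x * \<bar>\<phi> (x - ?w)\<bar>" ?w] int_g[of ?w] by simp_all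
    have "(LINT x|lebesgue. f x * q k x) = (LINT x|lebesgue. (f x * \<phi> x - f x * \<phi> (x - ?w)) / h k)"
      by (rule Bochner_Integration.integral_cong) (auto simp: q_def field_simps)
    also have "\<dots> = ((LINT x|lebesgue. f x * \<phi> x) - (LINT x|lebesgue. f (?w + x) * \<phi> x)) / h k"
      using int_f[of 0] int_f[of ?w] by (simp add: fs(2))
    also have "\<dots> = (LINT x|lebesgue. (f x * \<phi> x - f (?w + x) * \<phi> x) / h k)"
      using int_f[of 0] fs(1) by simp
    finally have eq: "(LINT x|lebesgue. f x * q k x) = (LINT x|lebesgue. (f x * \<phi> x - f (?w + x) * \<phi> x) / h k)" .
    have nS: "AE x in lebesgue. x \<notin> S" using S by (rule AE_not_in)
    then have "AE x in lebesgue. x \<notin> S \<and> ?w + x \<notin> S"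
      using AE_lebesgue_translation[OF nS, of ?w] by (rule AE_conjI)
    then have ae: "AE x in lebesgue. \<bar>(f x * \<phi> x - f (?w + x) * \<phi> x) / h k\<bar> \<le> g x * \<bar>\<phi> x\<bar> + g (?w + x) * \<bar>\<phi> x\<bar>"
    proof eventually_elim
      case (elim x)
      have "\<bar>f x - f (?w + x)\<bar> \<le> h k * (g x + g (?w + x))"
        using le[of x "?w + x"] elim h[of k] e by simp
      then have "\<bar>f x - f (?w + x)\<bar> * \<bar>\<phi> x\<bar> \<le> h k * (g x + g (?w + x)) * \<bar>\<phi> x\<bar>"
        by (rule mult_right_mono) simp
      then have "\<bar>f x - f (?w + x)\<bar> * \<bar>\<phi> x\<bar> / h k \<le> (g x + g (?w + x)) * \<bar>\<phi> x\<bar>"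
        unfolding pos_divide_le_eq[OF h(1)[of k]] by (simp only: mult_ac)
      moreover have "\<bar>(f x * \<phi> x - f (?w + x) * \<phi> x) / h k\<bar> = \<bar>f x - f (?w + x)\<bar> * \<bar>\<phi> x\<bar> / h k"
        using h(1)[of k] by (simp add: abs_divide abs_mult flip: left_diff_distrib)
      ultimately show ?case by (simp only: distrib_right)
    qed
    have "\<bar>LINT x|lebesgue. f x * q k x\<bar> \<le> (LINT x|lebesgue. \<bar>(f x * \<phi> x - f (?w + x) * \<phi> x) / h k\<bar>)"
      unfolding eq by (rule integral_abs_bound)
    also have "\<dots> \<le> (LINT x|lebesgue. g x * \<bar>\<phi> x\<bar> + g (?w + x) * \<bar>\<phi> x\<bar>)"
      by (rule integral_mono_AE) (use ae int_f[of 0] fs(1) gs(1) int_g[of 0] in auto)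
    also have "\<dots> = (LINT x|lebesgue. g x * \<bar>\<phi> x\<bar>) + (LINT x|lebesgue. g x * \<bar>\<phi> (x - ?w)\<bar>)"
      using int_g[of 0] gs by simp
    finally show ?thesis .
  qed
  have lim2: "(\<lambda>k. LINT x|lebesgue. g x * \<bar>\<phi> (x - h k *\<^sub>R e)\<bar>) \<longlonglongrightarrow> (LINT x|lebesgue. g x * \<bar>\<phi> x\<bar>)"
  proof (rule integral_dominated_convergence)
    show "integrable lebesgue (\<lambda>x. B * \<bar>indicator K x * g x\<bar>)" using gK by simp
    show "AE x in lebesgue. (\<lambda>k. g x * \<bar>\<phi> (x - h k *\<^sub>R e)\<bar>) \<longlonglongrightarrow> g x * \<bar>\<phi> x\<bar>"
    proof (rule AE_I2)
      fix x
      have "(\<lambda>k. x - h k *\<^sub>R e) \<longlonglongrightarrow> x - 0 *\<^sub>R e" by (intro tendsto_intros h_lim)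
      then have "(\<lambda>k. \<phi> (x - h k *\<^sub>R e)) \<longlonglongrightarrow> \<phi> x"
        using test_function_continuous(1)[OF \<phi>]
        by (intro isCont_tendsto_compose[of x \<phi>]) (auto simp: continuous_on_eq_continuous_at)
      then show "(\<lambda>k. g x * \<bar>\<phi> (x - h k *\<^sub>R e)\<bar>) \<longlonglongrightarrow> g x * \<bar>\<phi> x\<bar>"
        by (intro tendsto_intros)
    qed
    show "AE x in lebesgue. norm (g x * \<bar>\<phi> (x - h k *\<^sub>R e)\<bar>) \<le> B * \<bar>indicator K x * g x\<bar>" for k
    proof (rule AE_I2)
      fix x
      show "norm (g x * \<bar>\<phi> (x - h k *\<^sub>R e)\<bar>) \<le> B * \<bar>indicator K x * g x\<bar>"
      proof (cases "\<phi> (x - h k *\<^sub>R e) = 0")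
        case True
        then show ?thesis using RB(2) by simp
      next
        case False
        then show ?thesis
          using far[OF False] mult_left_mono[OF RB(3)[of "x - h k *\<^sub>R e"], of "\<bar>g x\<bar>"]
          by (simp add: abs_mult mult_ac)
      qed
    qed
  qed measurable
  have "\<bar>LINT x|lebesgue. f x * partial_deriv i \<phi> x\<bar>
      \<le> (LINT x|lebesgue. g x * \<bar>\<phi> x\<bar>) + (LINT x|lebesgue. g x * \<bar>\<phi> x\<bar>)"
  proof (rule LIMSEQ_le)
    show "(\<lambda>k. \<bar>LINT x|lebesgue. f x * q k x\<bar>) \<longlonglongrightarrow> \<bar>LINT x|lebesgue. f x * partial_deriv i \<phi> x\<bar>"
      by (intro tendsto_intros lim1)
    show "(\<lambda>k. (LINT x|lebesgue. g x * \<bar>\<phi> x\<bar>) + (LINT x|lebesgue. g x * \<bar>\<phi> (x - h k *\<^sub>R e)\<bar>))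
        \<longlonglongrightarrow> (LINT x|lebesgue. g x * \<bar>\<phi> x\<bar>) + (LINT x|lebesgue. g x * \<bar>\<phi> x\<bar>)"
      by (intro tendsto_intros lim2)
  qed (use bound in blast)
  then show ?thesis by simp
qed

text \<open>
  The weight is constant on shells \<open>N - 1 < \<bar>x\<bar> \<le> N\<close>, where it is \<open>2\<^sup>-\<^sup>N\<close> divided by one plus the
  volume of a ball that contains the shell.
\<close>

lemma integrable_weight_exists:
  obtains w :: "'a::euclidean_space \<Rightarrow> real" where "integrable lebesgue w" "w \<in> borel_measurable borel"
    "\<And>x. 0 < w x" "\<And>x. w x \<le> 1" "\<And>R. \<exists>c>0. \<forall>x. norm x \<le> R \<longrightarrow> c \<le> w x"
proof -
  define V where "V N = measure lborel (ball (0::'a) (real N + 1))" for N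
  have V0: "0 \<le> V N" for N by (simp add: V_def)
  define c where "c N = (1/2) ^ N / (1 + V N)" for N
  have c_pos: "0 < c N" for N using V0[of N] by (simp add: c_def)
  define w where "w x = c (nat \<lceil>norm x\<rceil>)" for x :: 'a
  have V_mono: "V N \<le> V N'" if "N \<le> N'" for N N'
    unfolding V_def using that emeasure_lborel_ball_finite
    by (intro measure_mono_fmeasurable) (auto simp: fmeasurable_def)
  have c_anti: "c N' \<le> c N" if "N \<le> N'" for N N'
    unfolding c_def using that V_mono[OF that] V0[of N]
    by (intro frac_le power_decreasing) auto
  have wm [measurable]: "w \<in> borel_measurable borel" unfolding w_def by measurable
  have "(\<integral>\<^sup>+x. ennreal (w x) \<partial>lborel)
      \<le> (\<integral>\<^sup>+x. (\<Sum>N. ennreal (c N) * indicator (ball (0::'a) (real N + 1)) x) \<partial>lborel)"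
  proof (rule nn_integral_mono)
    fix x :: 'a
    let ?N = "nat \<lceil>norm x\<rceil>"
    have "norm x < real ?N + 1" by (meson le_less_trans less_add_one real_nat_ceiling_ge)
    then have "ennreal (w x) = ennreal (c ?N) * indicator (ball (0::'a) (real ?N + 1)) x"
      by (simp add: w_def)
    also have "\<dots> \<le> (\<Sum>N. ennreal (c N) * indicator (ball (0::'a) (real N + 1)) x)"
      by (rule ennreal_le_suminf)
    finally show "ennreal (w x) \<le> (\<Sum>N. ennreal (c N) * indicator (ball (0::'a) (real N + 1)) x)" .
  qed
  also have "\<dots> = (\<Sum>N. \<integral>\<^sup>+x. ennreal (c N) * indicator (ball (0::'a) (real N + 1)) (x::'a) \<partial>lborel)"
    by (rule nn_integral_suminf) (auto intro!: borel_measurable_times_ennreal borel_measurable_indicator)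
  also have "\<dots> = (\<Sum>N. ennreal (c N) * emeasure lborel (ball (0::'a) (real N + 1)))"
    by (simp add: nn_integral_cmult_indicator)
  also have "\<dots> \<le> (\<Sum>N. ennreal ((1/2) ^ N))"
  proof (intro suminf_le summableI)
    fix N
    have "emeasure lborel (ball (0::'a) (real N + 1)) = ennreal (V N)"
      unfolding V_def using emeasure_lborel_ball_finite[of "0::'a" "real N + 1"]
      by (intro emeasure_eq_ennreal_measure) auto
    then have "ennreal (c N) * emeasure lborel (ball (0::'a) (real N + 1)) = ennreal (c N * V N)"
      using c_pos[of N] V0[of N] by (simp add: ennreal_mult)
    also have "\<dots> \<le> ennreal ((1/2) ^ N)"
    proof (rule ennreal_leI)
      have "(1/2) ^ N * (V N / (1 + V N)) \<le> (1/2) ^ N * 1"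
        using V0[of N] by (intro mult_left_mono) auto
      then show "c N * V N \<le> (1/2) ^ N" by (simp add: c_def)
    qed
    finally show "ennreal (c N) * emeasure lborel (ball (0::'a) (real N + 1)) \<le> ennreal ((1/2) ^ N)" .
  qed
  also have "\<dots> < top" by (subst ennreal_suminf_geometric) auto
  finally have "(\<integral>\<^sup>+x. ennreal (w x) \<partial>lborel) < top" .
  then have "integrable lborel w"
    using less_imp_le[OF c_pos] by (auto simp: integrable_iff_bounded w_def)
  then have "integrable lebesgue w" by (rule integrable_completion[THEN iffD2, rotated]) simp
  moreover have "w x \<le> 1" for x
  proof -
    have "(1/2::real) ^ N \<le> 1" for N by (rule power_le_one) auto
    then have "c N \<le> 1 / 1" for N unfolding c_def using V0[of N] by (intro frac_le) auto
    then show ?thesis by (simp add: w_def)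
  qed
  moreover have "\<exists>c>0. \<forall>x. norm x \<le> R \<longrightarrow> c \<le> w x" for R
    using c_pos by (intro exI[of _ "c (nat \<lceil>R\<rceil>)"] conjI allI impI)
      (auto simp: w_def intro!: c_anti nat_mono ceiling_mono)
  ultimately show ?thesis using that[of w] wm c_pos by (simp add: w_def)
qed

text \<open>
  The distributional derivative is represented on the finite measure with density \<open>g * w\<close>, after
  dividing the test functions by the weight \<open>w\<close>; the weight cancels in the resulting density \<open>u\<close>.
\<close>

theorem pointwise_imp_weak_partial_derivative:
  fixes f g :: "real ^ 'n \<Rightarrow> real"
  assumes p: "1 < p" and q: "1 \<le> q" and f: "f \<in> lorentz_space p q" and g: "g \<in> lorentz_space p q"
    and g0: "\<And>x. 0 \<le> g x" and S: "S \<in> null_sets lebesgue"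
    and le: "\<And>x y. x \<notin> S \<Longrightarrow> y \<notin> S \<Longrightarrow> \<bar>f x - f y\<bar> \<le> norm (x - y) * (g x + g y)"
  shows "\<exists>u. u \<in> borel_measurable lebesgue \<and> locally_integrable u \<and>
    (\<forall>\<phi>. test_function \<phi> \<longrightarrow> (LINT x|lebesgue. f x * partial_deriv i \<phi> x) = - (LINT x|lebesgue. u x * \<phi> x)) \<and>
    (AE x in lebesgue. \<bar>u x\<bar> \<le> 2 * g x)"
proof -
  have loc: "locally_integrable h" if "h \<in> lorentz_space p q" for h :: "real ^ 'n \<Rightarrow> real"
    unfolding locally_integrable_def
    using lorentz_space_set_integrable[OF p q that] by (simp add: lmeasurable_compact)
  have fm [measurable]: "f \<in> borel_measurable lebesgue" and gm [measurable]: "g \<in> borel_measurable lebesgue"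
    using f g by (auto simp: lorentz_space_def)
  obtain w :: "real ^ 'n \<Rightarrow> real" where w: "integrable lebesgue w" "w \<in> borel_measurable borel"
    "\<And>x. 0 < w x" "\<And>x. w x \<le> 1" "\<And>R. \<exists>c>0. \<forall>x. norm x \<le> R \<longrightarrow> c \<le> w x"
    by (rule integrable_weight_exists) blast
  have wm [measurable]: "w \<in> borel_measurable lebesgue" using w(1) by auto
  have w_ne: "w x \<noteq> 0" for x using w(3)[of x] by simp
  have gw: "integrable lebesgue (\<lambda>x. g x * w x)"
    using w by (intro lorentz_space_weighted_integrable[OF p q g w(1), where W = 1]) (simp add: less_imp_le)
  have gw0: "0 \<le> g x * w x" for x using g0[of x] w(3)[of x] by simp
  define \<nu> where "\<nu> = density lebesgue (\<lambda>x. ennreal (g x * w x))"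
  have sets_\<nu>: "sets \<nu> = sets lebesgue" by (simp add: \<nu>_def)
  interpret \<nu>: finite_measure \<nu>
  proof
    have "emeasure \<nu> (space \<nu>) = (\<integral>\<^sup>+x. ennreal (g x * w x) \<partial>lebesgue)"
      by (simp add: \<nu>_def emeasure_density)
    also have "\<dots> \<noteq> \<infinity>"
      using gw gw0 by (simp add: nn_integral_eq_integral)
    finally show "emeasure \<nu> (space \<nu>) \<noteq> \<infinity>" .
  qed
  have int_\<nu>: "(LINT x|\<nu>. a x) = (LINT x|lebesgue. g x * w x * a x)"
    if "a \<in> borel_measurable lebesgue" for a :: "real ^ 'n \<Rightarrow> real"
    unfolding \<nu>_def using that gw0 by (subst integral_density) auto
  have \<phi>_m: "\<phi> \<in> borel_measurable lebesgue" if "test_function \<phi>" for \<phi> :: "real ^ 'n \<Rightarrow> real"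
    using borel_measurable_test_function(1)[OF that] by (intro measurable_completion) simp
  define T where "T = {a. test_function (\<lambda>x. a x * w x)}"
  define \<Lambda> where "\<Lambda> a = - (LINT x|lebesgue. f x * partial_deriv i (\<lambda>x. a x * w x) x)" for a
  have T_m: "a \<in> borel_measurable lebesgue" if "a \<in> T" for a
  proof -
    have [measurable]: "(\<lambda>x. a x * w x) \<in> borel_measurable lebesgue"
      using that by (intro \<phi>_m) (simp add: T_def)
    have "(\<lambda>x. a x * w x / w x) \<in> borel_measurable lebesgue" by measurable
    then show ?thesis using w_ne by simp
  qed
  have T_add: "(\<lambda>x. a x + b x) \<in> T" if "a \<in> T" "b \<in> T" for a b
    using that test_function_add by (simp add: T_def distrib_right)
  have T_scale: "(\<lambda>x. c * a x) \<in> T" if "a \<in> T" for c a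
    using that test_function_scale[of "\<lambda>x. a x * w x" c] by (simp add: T_def mult.assoc)
  have dint: "integrable lebesgue (\<lambda>x. f x * partial_deriv i \<phi> x)" if "test_function \<phi>" for \<phi>
    using integrable_mult_translated_test_function(2)[OF loc[OF f] fm that, of i 0] by simp
  have "\<exists>W. integrable \<nu> W \<and> (\<forall>a\<in>T. \<Lambda> a = (LINT x|\<nu>. W x * a x))"
  proof (rule \<nu>.riesz_representation_bounded_functions[where C = 2])
    show "a \<in> borel_measurable \<nu>" if "a \<in> T" for a
      using T_m[OF that] by (simp add: \<nu>_def)
    show "\<exists>B. \<forall>x. \<bar>a x\<bar> \<le> B" if a: "a \<in> T" for a
    proof -
      obtain R B where RB: "0 \<le> B" "\<And>x. \<bar>a x * w x\<bar> \<le> B" "\<And>x. a x * w x \<noteq> 0 \<Longrightarrow> norm x \<le> R"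
        using test_function_bounds[of "\<lambda>x. a x * w x"] a by (metis T_def mem_Collect_eq)
      obtain c where c: "0 < c" "\<And>x. norm x \<le> R \<Longrightarrow> c \<le> w x" using w(5)[of R] by blast
      have "\<bar>a x\<bar> \<le> B / c" for x
      proof (cases "a x = 0")
        case False
        then have "c \<le> w x" using RB(3)[of x] w_ne c(2) by simp
        then have "\<bar>a x\<bar> * c \<le> \<bar>a x\<bar> * w x" by (rule mult_left_mono) simp
        also have "\<dots> \<le> B" using RB(2)[of x] w(3)[of x] by (simp add: abs_mult)
        finally show ?thesis using c(1) by (simp add: field_simps)
      qed (use RB(1) c(1) in simp)
      then show ?thesis by blast
    qed
    have "test_function (\<lambda>x::real^'n. 0 * bump ((1 / 1) *\<^sub>R (x - 0)))"
      by (intro test_function_scale test_function_scaled_bump) simp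
    then have "(\<lambda>x. 0) \<in> T" by (simp add: T_def)
    then show "T \<noteq> {}" by blast
    show "\<Lambda> (\<lambda>x. a x + b x) = \<Lambda> a + \<Lambda> b" if "a \<in> T" "b \<in> T" for a b
    proof -
      have t: "test_function (\<lambda>x. a x * w x)" "test_function (\<lambda>x. b x * w x)" using that by (auto simp: T_def)
      show ?thesis unfolding \<Lambda>_def distrib_right
          partial_deriv_add[OF test_function_continuous(2)[OF t(1)] test_function_continuous(2)[OF t(2)]]
        using dint[OF t(1)] dint[OF t(2)] by (simp add: distrib_left)
    qed
    show "\<Lambda> (\<lambda>x. c * a x) = c * \<Lambda> a" if "a \<in> T" for c a
    proof -
      have t: "test_function (\<lambda>x. a x * w x)" using that by (auto simp: T_def)
      show ?thesis unfolding \<Lambda>_def mult.assoc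
          partial_deriv_scale[OF test_function_continuous(2)[OF t]]
        by (simp add: mult.left_commute)
    qed
    show "\<bar>\<Lambda> a\<bar> \<le> 2 * (LINT x|\<nu>. \<bar>a x\<bar>)" if "a \<in> T" for a
    proof -
      have t: "test_function (\<lambda>x. a x * w x)" using that by (auto simp: T_def)
      have "(LINT x|\<nu>. \<bar>a x\<bar>) = (LINT x|lebesgue. g x * w x * \<bar>a x\<bar>)"
        using T_m[OF that] by (intro int_\<nu>) measurable
      also have "\<dots> = (LINT x|lebesgue. g x * \<bar>a x * w x\<bar>)"
        using w(3) by (intro Bochner_Integration.integral_cong) (auto simp: abs_mult less_imp_le)
      finally show ?thesis
        using distributional_derivative_bound[OF loc[OF f] fm loc[OF g] gm S le t, of i] by (simp add: \<Lambda>_def)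
    qed
  qed (fact T_add T_scale)+
  then obtain W where W: "integrable \<nu> W" "\<And>a. a \<in> T \<Longrightarrow> \<Lambda> a = (LINT x|\<nu>. W x * a x)" by blast
  have Wm [measurable]: "W \<in> borel_measurable lebesgue"
    using W(1) by (auto simp: \<nu>_def dest: borel_measurable_integrable)
  define u where "u x = W x * g x" for x
  have um [measurable]: "u \<in> borel_measurable lebesgue" unfolding u_def by measurable
  have uw: "integrable lebesgue (\<lambda>x. u x * w x)"
  proof -
    have "integrable lebesgue (\<lambda>x. g x * w x * W x)"
      using W(1) gw0 unfolding \<nu>_def by (subst (asm) integrable_density) auto
    then show ?thesis by (simp add: u_def mult_ac)
  qed
  have u_loc: "locally_integrable u"
    unfolding locally_integrable_def
  proof (intro allI impI)
    fix K :: "(real ^ 'n) set" assume K: "compact K"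
    then obtain R where R: "\<And>x. x \<in> K \<Longrightarrow> norm x \<le> R"
      by (meson bounded_iff compact_imp_bounded)
    have [measurable]: "K \<in> sets lebesgue" using K by (simp add: lmeasurable_compact fmeasurableD)
    obtain c where c: "0 < c" "\<And>x. norm x \<le> R \<Longrightarrow> c \<le> w x" using w(5)[of R] by blast
    show "set_integrable lebesgue K u"
      unfolding set_integrable_def
    proof (rule Bochner_Integration.integrable_bound)
      show "integrable lebesgue (\<lambda>x. (1 / c) * (u x * w x))" using uw by simp
      show "AE x in lebesgue. norm (indicator K x *\<^sub>R u x) \<le> norm ((1 / c) * (u x * w x))"
      proof (rule AE_I2)
        fix x
        show "norm (indicator K x *\<^sub>R u x) \<le> norm ((1 / c) * (u x * w x))"
        proof (cases "x \<in> K")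
          case True
          then have "c \<le> w x" by (intro c(2) R)
          then have "\<bar>u x\<bar> * c \<le> \<bar>u x\<bar> * w x" by (rule mult_left_mono) simp
          then show ?thesis using True c(1) w(3)[of x] by (simp add: abs_mult field_simps)
        qed simp
      qed
    qed measurable
  qed
  have rep: "(LINT x|lebesgue. f x * partial_deriv i \<phi> x) = - (LINT x|lebesgue. u x * \<phi> x)"
    if \<phi>: "test_function \<phi>" for \<phi>
  proof -
    define a where "a x = \<phi> x / w x" for x
    have aw: "(\<lambda>x. a x * w x) = \<phi>" using w_ne by (simp add: a_def)
    then have aT: "a \<in> T" using \<phi> by (simp add: T_def)
    have "- (LINT x|lebesgue. f x * partial_deriv i \<phi> x) = \<Lambda> a" by (simp add: \<Lambda>_def aw)
    also have "\<dots> = (LINT x|\<nu>. W x * a x)" by (rule W(2)[OF aT])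
    also have "\<dots> = (LINT x|lebesgue. g x * w x * (W x * a x))"
      using T_m[OF aT] by (intro int_\<nu>) measurable
    also have "\<dots> = (LINT x|lebesgue. u x * \<phi> x)"
      using w_ne by (intro Bochner_Integration.integral_cong) (auto simp: u_def a_def)
    finally show ?thesis by simp
  qed
  have cboxes: "set_integrable lebesgue (cbox a b) h" if "locally_integrable h" for a b and h :: "real ^ 'n \<Rightarrow> real"
    using that by (simp add: locally_integrable_def)
  define m where "m = bump_mass TYPE('n)"
  have m: "0 < m" by (simp add: m_def bump_mass_pos)
  have "AE x in lebesgue. ((\<lambda>\<epsilon>. mollify u \<epsilon> x) \<longlongrightarrow> u x * m) (at_right 0)"
    unfolding m_def by (rule AE_mollify_tendsto[OF cboxes[OF u_loc] um])
  moreover have "AE x in lebesgue. ((\<lambda>\<epsilon>. mollify g \<epsilon> x) \<longlongrightarrow> g x * m) (at_right 0)"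
    unfolding m_def by (rule AE_mollify_tendsto[OF cboxes[OF loc[OF g]] gm])
  ultimately have "AE x in lebesgue. \<bar>u x\<bar> \<le> 2 * g x"
  proof eventually_elim
    case (elim x)
    have "\<bar>u x * m\<bar> \<le> 2 * (g x * m)"
    proof (rule tendsto_le[of "at_right (0::real)"])
      show "((\<lambda>\<epsilon>. \<bar>mollify u \<epsilon> x\<bar>) \<longlongrightarrow> \<bar>u x * m\<bar>) (at_right 0)"
        "((\<lambda>\<epsilon>. 2 * mollify g \<epsilon> x) \<longlongrightarrow> 2 * (g x * m)) (at_right 0)"
        using elim by (auto intro!: tendsto_intros)
      have "\<bar>mollify u \<epsilon> x\<bar> \<le> 2 * mollify g \<epsilon> x" if e: "0 < \<epsilon>" for \<epsilon>
      proof -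
        let ?\<phi> = "\<lambda>y. bump ((1 / \<epsilon>) *\<^sub>R (y - x))"
        have t: "test_function ?\<phi>" by (rule test_function_scaled_bump[OF e])
        have "\<bar>LINT y|lebesgue. u y * ?\<phi> y\<bar> \<le> 2 * (LINT y|lebesgue. g y * \<bar>?\<phi> y\<bar>)"
          using distributional_derivative_bound[OF loc[OF f] fm loc[OF g] gm S le t, of i] rep[OF t] by simp
        then have "\<bar>LINT y|lebesgue. u y * ?\<phi> y\<bar> / \<epsilon> ^ CARD('n) \<le> 2 * (LINT y|lebesgue. g y * ?\<phi> y) / \<epsilon> ^ CARD('n)"
          using e by (intro divide_right_mono) (simp_all only: abs_of_nonneg[OF bump_nonneg] zero_le_power less_imp_le)
        then show ?thesis using e by (simp add: mollify_def abs_divide)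
      qed
      then show "eventually (\<lambda>\<epsilon>. \<bar>mollify u \<epsilon> x\<bar> \<le> 2 * mollify g \<epsilon> x) (at_right 0)"
        by (auto simp: eventually_at_filter)
    qed simp
    then have "\<bar>u x\<bar> * m \<le> (2 * g x) * m" using m by (simp add: abs_mult mult.assoc)
    then show ?case using m by simp
  qed
  then show ?thesis using um u_loc rep by blast
qed

theorem pointwise_imp_sobolev_lorentz:
  fixes f g :: "real ^ 'n \<Rightarrow> real"
  assumes p: "1 < p" and q: "1 \<le> q" and f: "f \<in> lorentz_space p q" and g: "g \<in> lorentz_space p q"
    and g0: "\<And>x. 0 \<le> g x" and S: "S \<in> null_sets lebesgue"
    and le: "\<And>x y. x \<notin> S \<Longrightarrow> y \<notin> S \<Longrightarrow> \<bar>f x - f y\<bar> \<le> norm (x - y) * (g x + g y)"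
  shows "f \<in> sobolev_lorentz_space p q"
proof -
  define Q where "Q i u \<longleftrightarrow> u \<in> borel_measurable lebesgue \<and> locally_integrable u \<and>
    (\<forall>\<phi>. test_function \<phi> \<longrightarrow> (LINT x|lebesgue. f x * partial_deriv i \<phi> x) = - (LINT x|lebesgue. u x * \<phi> x)) \<and>
    (AE x in lebesgue. \<bar>u x\<bar> \<le> 2 * g x)" for i u
  have "\<exists>u. Q i u" for i
    unfolding Q_def by (rule pointwise_imp_weak_partial_derivative[OF p q f g g0 S le])
  then obtain u where "\<And>i. Q i (u i)" by metis
  then have u: "\<And>i. u i \<in> borel_measurable lebesgue" "\<And>i. locally_integrable (u i)"
    "\<And>i \<phi>. test_function \<phi> \<Longrightarrow> (LINT x|lebesgue. f x * partial_deriv i \<phi> x) = - (LINT x|lebesgue. u i x * \<phi> x)"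
    "\<And>i. AE x in lebesgue. \<bar>u i x\<bar> \<le> 2 * g x"
    by (simp_all only: Q_def)
  define v where "v x = (\<Sum>i\<in>UNIV. u i x *\<^sub>R axis i (1::real))" for x
  have v_nth: "v x $ i = u i x" for x i
    by (simp add: v_def axis_def if_distrib[of "\<lambda>t. _ * t"] cong: if_cong)
  have v_loc: "locally_integrable v"
    unfolding locally_integrable_def
  proof (intro allI impI)
    fix K :: "(real ^ 'n) set" assume "compact K"
    then have "integrable lebesgue (\<lambda>x. \<Sum>i\<in>UNIV. (indicator K x *\<^sub>R u i x) *\<^sub>R axis i (1::real))"
      using u(2) by (intro Bochner_Integration.integrable_sum integrable_scaleR_left)
        (simp add: locally_integrable_def set_integrable_def)
    then show "set_integrable lebesgue K v"
      by (simp add: set_integrable_def v_def scaleR_sum_right)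
  qed
  have f_loc: "locally_integrable f"
    unfolding locally_integrable_def
    using lorentz_space_set_integrable[OF p q f] by (simp add: lmeasurable_compact)
  have wg: "has_weak_gradient f v"
    using f_loc v_loc u(3) by (simp add: has_weak_gradient_def v_nth)
  have vm: "(\<lambda>x. norm (v x)) \<in> borel_measurable lebesgue"
    unfolding v_def using u(1) by measurable
  have "AE x in lebesgue. \<forall>i\<in>UNIV. \<bar>u i x\<bar> \<le> 2 * g x"
    using u(4) by (intro AE_finite_allI) auto
  then have "AE x in lebesgue. \<bar>norm (v x)\<bar> \<le> 2 * real CARD('n) * \<bar>g x\<bar>"
  proof eventually_elim
    case (elim x)
    have "norm (v x) \<le> (\<Sum>i\<in>UNIV. \<bar>v x $ i\<bar>)" by (rule norm_le_l1_cart)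
    also have "\<dots> \<le> (\<Sum>i\<in>(UNIV::'n set). 2 * g x)" using elim by (intro sum_mono) (simp add: v_nth)
    finally show ?case using g0[of x] by simp
  qed
  then have "(\<lambda>x. norm (v x)) \<in> lorentz_space p q"
    by (intro lorentz_space_mono[OF p q g vm]) auto
  with wg f show ?thesis unfolding sobolev_lorentz_space_def by blast
qed

section \<open>The characterization\<close>

theorem corollary3p4:
  fixes p :: real and q :: ennreal and f :: "real ^ 'n \<Rightarrow> real"
  assumes "p > 1" and "q \<ge> 1"
  shows "f \<in> sobolev_lorentz_space p q \<longleftrightarrow>
    f \<in> lorentz_space p q \<and>
    (\<exists>g \<in> lorentz_space p q. (\<forall>x. 0 \<le> g x) \<and>
       (\<exists>S \<in> null_sets lebesgue. \<forall>x y. x \<notin> S \<longrightarrow> y \<notin> S \<longrightarrow>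
          \<bar>f x - f y\<bar> \<le> norm (x - y) * (g x + g y)))"
proof (rule iffI)
  assume f: "f \<in> sobolev_lorentz_space p q"
  then have "f \<in> lorentz_space p q" by (simp add: sobolev_lorentz_space_def)
  with sobolev_lorentz_imp_pointwise[OF assms f]
  show "f \<in> lorentz_space p q \<and>
    (\<exists>g \<in> lorentz_space p q. (\<forall>x. 0 \<le> g x) \<and>
       (\<exists>S \<in> null_sets lebesgue. \<forall>x y. x \<notin> S \<longrightarrow> y \<notin> S \<longrightarrow>
          \<bar>f x - f y\<bar> \<le> norm (x - y) * (g x + g y)))" by (rule conjI[rotated])
next
  assume "f \<in> lorentz_space p q \<and>
    (\<exists>g \<in> lorentz_space p q. (\<forall>x. 0 \<le> g x) \<and>
       (\<exists>S \<in> null_sets lebesgue. \<forall>x y. x \<notin> S \<longrightarrow> y \<notin> S \<longrightarrow>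
          \<bar>f x - f y\<bar> \<le> norm (x - y) * (g x + g y)))"
  then obtain g S where "f \<in> lorentz_space p q" "g \<in> lorentz_space p q" "\<forall>x. 0 \<le> g x"
    "S \<in> null_sets lebesgue"
    "\<forall>x y. x \<notin> S \<longrightarrow> y \<notin> S \<longrightarrow> \<bar>f x - f y\<bar> \<le> norm (x - y) * (g x + g y)"
    by blast
  then show "f \<in> sobolev_lorentz_space p q"
    by (intro pointwise_imp_sobolev_lorentz[OF assms, of f g S]) simp_all
qed

end
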